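(* Let $\alpha\in(0,1)$, let $\Lambda\subset[p]$, and consider a sequence of problems indexed by $n\to\infty$. Suppose $\frac{\lambda}{n}\in\big[6\sigma_0^2\frac{(|\tau_0|+1)\log(p/2)}{n}+t,\ 0.05\,C_{\min}\big]$ for a positive constant $t>0$, and that $\frac{|\tau_0|\log(p)}{n}<0.23$ and $C_{\min}>120\frac{(|\tau_0|+2)\log(p+1)}{n}\sigma_0^2$ when $n$ is large enough. Then for any finite $d$, the confidence set $\Gamma_\alpha^{\beta_\Lambda}$ satisfies $$\mathbb P_{(\mathcal U^d,Y)}\{\beta_{0,\Lambda}\in\Gamma_\alpha^{\beta_\Lambda}(Y)\}\ge\alpha-o(e^{-c_2n})\quad(n\to\infty)$$ for some $c_2>0$. Further, $\mathbb P_{Y|\mathcal U^d}\{\beta_{0,\Lambda}\in\Gamma_\alpha^{\beta_\Lambda}(Y)\}\ge\alpha-o_p(e^{-c_2n})$.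
   Context: Setting. $n,p$ are positive integers and $X\in\mathbb R^{n\times p}$ is a fixed matrix. For $\tau\subset[p]=\{1,\dots,p\}$ (a "model"), $X_\tau$ is the submatrix of the columns of $X$ indexed by $\tau$, $|\tau|$ is the cardinality, and $H_\tau$ is the orthogonal projection matrix onto the column span of $X_\tau$. The data are $Y=X_{\tau_0}\beta_0+\sigma_0U$, where $\tau_0\subset[p]$ (nonempty), $\beta_0\in\mathbb R^{|\tau_0|}$, $\sigma_0>0$ are fixed and $U\sim N(0,I_n)$. $\beta_0^{full}\in\mathbb R^p$ equals $\beta_0$ on $\tau_0$ and $0$ off $\tau_0$, and $\beta_{0,\Lambda}$ is its subvector indexed by $\Lambda$. In the sequence of problems, $p,X,\tau_0,\beta_0,\Lambda,\lambda$ may depend on $n$, while $d,t,\sigma_0,\alpha$ are fixed. Identifiability: $\tau_0$ is the unique model of smallest cardinality in $\{\tau\subset[p]: X_\tau\beta_\tau=X_{\tau_0}\beta_0\text{ for some }\beta_\tau\}$. Define $$C_{\min}=\min_{\tau\ne\tau_0,\ |\tau|\le|\tau_0|}\ \min_{\beta_\tau\in\mathbb R^{|\tau|}}\ \frac{\|X_{\tau_0}\beta_0-X_\tau\beta_\tau\|_2^2}{n\max(|\tau_0\setminus\tau|,1)}>0.$$ Candidate set. $\mathcal U^d=(U_1^*,\dots,U_d^* )$ are i.i.d. $N(0,I_n)$, independent of $U$. For $\lambda>0$, $\hat\tau_b=\arg\min_{\tau}\min_{\beta_\tau\in\mathbb R^{|\tau|},\sigma\in\mathbb R}\{\|Y-X_\tau\beta_\tau-\sigma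 U_b^*\|_2^2+\lambda|\tau|\}$ (fixed tie-breaking rule) and $S^{(d)}=\{\hat\tau_b:b=1,\dots,d\}$. Confidence set. Let $O_{\tau,\Lambda}$ be the orthogonal projection matrix onto the column span of $(I-H_{\tau\setminus\Lambda})X_{\Lambda\cap\tau}$. For $y\in\mathbb R^n$, $\beta_\Lambda=(\beta_i)_{i\in\Lambda}$ and a model $\tau$, let $r=y-X_\Lambda\beta_\Lambda$ and $$\tilde T(y,(\beta_\Lambda,\tau))=\begin{cases}\dfrac{r^\top O_{\tau,\Lambda}r/|\Lambda\cap\tau|}{r^\top(I-H_\tau)r/(n-|\tau|)}&\text{if }\Lambda\cap\tau\ne\emptyset\text{ and }\beta_i=0\ \forall i\in\Lambda\setminus\tau,\\ \infty&\text{if }\beta_i\ne0\text{ for some }i\in\Lambda\setminus\tau,\\ 0&\text{if }\Lambda\cap\tau=\emptyset\text{ and }\beta_i=0\ \forall i\in\Lambda.\end{cases}$$ Let $B_\alpha(\beta_\Lambda,\tau)=[0,F^{-1}_{|\Lambda\cap\tau|,\,n-|\tau|}(\alpha)]$, where $F^{-1}_{k,m}$ is the quantile function of the $F$ distribution with $(k,m)$ degrees of freedom (when $\Lambda\cap\tau=\emptyset$, take $\{0\}$; any fixed convention may be used if $|\tau|\ge n$). Then $$\Gamma_\alpha^{\beta_\Lambda}(y)=\bigcup_{\tau\in S^{(d)}}\{\beta_\Lambda:\tilde T(y,(\beta_\Lambda,\tau))\in B_\alpha(\beta_\Lambda,\tau)\}.$$ $\mathbb P_{(\mathcal U^d,Y)}$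 is the joint probability over $U$ and $\mathcal U^d$; $\mathbb P_{Y|\mathcal U^d}$ is the conditional probability given $\mathcal U^d$, and $o_p$ is with respect to $\mathcal U^d$ as $n\to\infty$. *)

theory Defs
  imports
    "HOL-Probability.Probability"
    "Jordan_Normal_Form.DL_Submatrix"
    "Jordan_Normal_Form.VS_Connect"
begin

unbundle no vec_syntax
no_notation inner (infix \<open>\<bullet>\<close> 70)

text \<open>
  Vectors and matrices are those of \<open>Jordan_Normal_Form\<close>, so that the dimensions may vary with \<open>n\<close>.
  The columns of an \<open>n \<times> p\<close> matrix are numbered \<open>0, \<dots>, p - 1\<close>, and a model is a subset of \<open>{..<p}\<close>.
  A vector \<open>(b\<^sub>i)\<^sub>i\<^sub>\<in>\<^sub>A\<close> indexed by a finite set \<open>A\<close> of numbers is a vector of length \<open>card A\<close> that lists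
  the entries in increasing order of the index, like the columns of \<open>submatrix X UNIV A\<close>.
\<close>

section \<open>Models\<close>

definition cols_at :: "real mat \<Rightarrow> nat set \<Rightarrow> real mat" where
  "cols_at X \<tau> = submatrix X UNIV \<tau>"

text \<open>The entry \<open>b\<^sub>i\<close> of \<open>b = (b\<^sub>i)\<^sub>i\<^sub>\<in>\<^sub>A\<close>, for \<open>i \<in> A\<close>.\<close>

definition entry_at :: "nat set \<Rightarrow> real vec \<Rightarrow> nat \<Rightarrow> real" where
  "entry_at A b i = b $ card {a \<in> A. a < i}"

definition full_coef :: "nat \<Rightarrow> nat set \<Rightarrow> real vec \<Rightarrow> real vec" where
  "full_coef p \<tau> b = vec p (\<lambda>i. if i \<in> \<tau> then entry_at \<tau> b i else 0)"

definition subvector :: "real vec \<Rightarrow> nat set \<Rightarrow> real vec" where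
  "subvector v A = vec (card A) (\<lambda>j. v $ pick A j)"

definition sq_norm2 :: "real vec \<Rightarrow> real" where
  "sq_norm2 v = v \<bullet> v"

text \<open>The orthogonal projection matrix onto a linear subspace \<open>V\<close> of \<open>\<real>\<^sup>n\<close>.\<close>

definition orth_proj :: "nat \<Rightarrow> real vec set \<Rightarrow> real mat" where
  "orth_proj n V = (THE P. P \<in> carrier_mat n n \<and>
     (\<forall>y \<in> carrier_vec n. P *\<^sub>v y \<in> V \<and> (\<forall>v \<in> V. (y - P *\<^sub>v y) \<bullet> v = 0)))"

definition col_proj :: "real mat \<Rightarrow> real mat" where
  "col_proj A = orth_proj (dim_row A) (vec_space.col_space (dim_row A) A)"

definition hat_mat :: "real mat \<Rightarrow> nat set \<Rightarrow> real mat" where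
  "hat_mat X \<tau> = col_proj (cols_at X \<tau>)"

definition representing_models :: "real mat \<Rightarrow> nat set \<Rightarrow> real vec \<Rightarrow> nat set set" where
  "representing_models X \<tau>\<^sub>0 \<beta>\<^sub>0 = {\<tau>. \<tau> \<subseteq> {..<dim_col X} \<and>
     (\<exists>b \<in> carrier_vec (card \<tau>). cols_at X \<tau> *\<^sub>v b = cols_at X \<tau>\<^sub>0 *\<^sub>v \<beta>\<^sub>0)}"

definition identifiable :: "real mat \<Rightarrow> nat set \<Rightarrow> real vec \<Rightarrow> bool" where
  "identifiable X \<tau>\<^sub>0 \<beta>\<^sub>0 \<longleftrightarrow>
     {\<tau>. is_arg_min card (\<lambda>\<tau>. \<tau> \<in> representing_models X \<tau>\<^sub>0 \<beta>\<^sub>0) \<tau>} = {\<tau>\<^sub>0}"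

text \<open>
  Here and in \<open>repro_crit\<close> the infimum of the least squares problem is attained, so it is a minimum.
  The outer minimum ranges over a finite set, which contains \<open>{}\<close> as soon as \<open>\<tau>\<^sub>0 \<noteq> {}\<close>.
\<close>

definition C_min :: "real mat \<Rightarrow> nat set \<Rightarrow> real vec \<Rightarrow> real" where
  "C_min X \<tau>\<^sub>0 \<beta>\<^sub>0 =
     (MIN \<tau> \<in> {\<tau>. \<tau> \<subseteq> {..<dim_col X} \<and> \<tau> \<noteq> \<tau>\<^sub>0 \<and> card \<tau> \<le> card \<tau>\<^sub>0}.
        INF b \<in> carrier_vec (card \<tau>).
          sq_norm2 (cols_at X \<tau>\<^sub>0 *\<^sub>v \<beta>\<^sub>0 - cols_at X \<tau> *\<^sub>v b)
            / (real (dim_row X) * real (max (card (\<tau>\<^sub>0 - \<tau>)) 1)))"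

definition response :: "real mat \<Rightarrow> nat set \<Rightarrow> real vec \<Rightarrow> real \<Rightarrow> real vec \<Rightarrow> real vec" where
  "response X \<tau>\<^sub>0 \<beta>\<^sub>0 \<sigma>\<^sub>0 u = cols_at X \<tau>\<^sub>0 *\<^sub>v \<beta>\<^sub>0 + \<sigma>\<^sub>0 \<cdot>\<^sub>v u"

section \<open>Candidate set\<close>

definition repro_crit :: "real mat \<Rightarrow> real \<Rightarrow> real vec \<Rightarrow> real vec \<Rightarrow> nat set \<Rightarrow> real" where
  "repro_crit X lam y u \<tau> =
     (INF (b, \<sigma>) \<in> carrier_vec (card \<tau>) \<times> UNIV.
        sq_norm2 (y - cols_at X \<tau> *\<^sub>v b - \<sigma> \<cdot>\<^sub>v u) + lam * real (card \<tau>))"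

text \<open>The tie-breaking rule \<open>sel\<close> picks an element of the set of all minimisers.\<close>

definition tau_hat ::
  "(nat set set \<Rightarrow> nat set) \<Rightarrow> real mat \<Rightarrow> real \<Rightarrow> real vec \<Rightarrow> real vec \<Rightarrow> nat set" where
  "tau_hat sel X lam y u =
     sel {\<tau>. is_arg_min (repro_crit X lam y u) (\<lambda>\<tau>. \<tau> \<subseteq> {..<dim_col X}) \<tau>}"

definition candidate_set ::
  "(nat set set \<Rightarrow> nat set) \<Rightarrow> real mat \<Rightarrow> real \<Rightarrow> real vec \<Rightarrow> nat \<Rightarrow> (nat \<Rightarrow> real vec) \<Rightarrow> nat set set"
where
  "candidate_set sel X lam y d us = (\<lambda>b. tau_hat sel X lam y (us b)) ` {1..d}"

section \<open>Confidence set\<close>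

definition chi_square_distr :: "nat \<Rightarrow> real measure" where
  "chi_square_distr k =
     distr (\<Pi>\<^sub>M i \<in> {..<k}. std_normal_distribution) borel (\<lambda>z. \<Sum>i<k. (z i)\<^sup>2)"

definition F_distr :: "nat \<Rightarrow> nat \<Rightarrow> real measure" where
  "F_distr k m =
     distr (chi_square_distr k \<Otimes>\<^sub>M chi_square_distr m) borel
       (\<lambda>(a, b). (a / real k) / (b / real m))"

definition quantile :: "real measure \<Rightarrow> real \<Rightarrow> real" where
  "quantile D q = Inf {x. q \<le> cdf D x}"

definition O_mat :: "real mat \<Rightarrow> nat set \<Rightarrow> nat set \<Rightarrow> real mat" where
  "O_mat X \<tau> \<Lambda> =
     col_proj ((1\<^sub>m (dim_row X) - hat_mat X (\<tau> - \<Lambda>)) * cols_at X (\<Lambda> \<inter> \<tau>))"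

text \<open>
  For \<open>card \<tau> < n\<close> the inner denominator \<open>r\<^sup>T (I - H\<^sub>\<tau>) r\<close> vanishes only on a Lebesgue null set of \<open>y\<close>,
  where division by zero gives the value \<open>0\<close>.
\<close>

definition T_stat :: "real mat \<Rightarrow> nat set \<Rightarrow> real vec \<Rightarrow> real vec \<Rightarrow> nat set \<Rightarrow> ereal" where
  "T_stat X \<Lambda> y b \<tau> =
     (if \<exists>i \<in> \<Lambda> - \<tau>. entry_at \<Lambda> b i \<noteq> 0 then \<infinity>
      else if \<Lambda> \<inter> \<tau> = {} then 0
      else
        (let n = dim_row X; r = y - cols_at X \<Lambda> *\<^sub>v b in
         ereal ((r \<bullet> (O_mat X \<tau> \<Lambda> *\<^sub>v r) / real (card (\<Lambda> \<inter> \<tau>)))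
           / (r \<bullet> ((1\<^sub>m n - hat_mat X \<tau>) *\<^sub>v r) / (real n - real (card \<tau>))))))"

text \<open>
  \<open>conv\<close> is the convention for models with at least \<open>n\<close> elements, for which there is no
  \<open>F\<close> distribution with \<open>n - card \<tau>\<close> degrees of freedom.
\<close>

definition B_set :: "(nat set \<Rightarrow> ereal set) \<Rightarrow> nat \<Rightarrow> real \<Rightarrow> nat set \<Rightarrow> nat set \<Rightarrow> ereal set" where
  "B_set conv n \<alpha> \<Lambda> \<tau> =
     (if \<Lambda> \<inter> \<tau> = {} then {0}
      else if card \<tau> < n then {0..ereal (quantile (F_distr (card (\<Lambda> \<inter> \<tau>)) (n - card \<tau>)) \<alpha>)}
      else conv \<tau>)"

definition conf_set ::
  "(nat set \<Rightarrow> ereal set) \<Rightarrow> real mat \<Rightarrow> real \<Rightarrow> nat set \<Rightarrow> nat set set \<Rightarrow> real vec \<Rightarrow> real vec set"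
where
  "conf_set conv X \<alpha> \<Lambda> S y =
     (\<Union>\<tau> \<in> S. {b \<in> carrier_vec (card \<Lambda>). T_stat X \<Lambda> y b \<tau> \<in> B_set conv (dim_row X) \<alpha> \<Lambda> \<tau>})"

section \<open>Probability\<close>

text \<open>The law \<open>N(0, I\<^sub>n)\<close>, on functions with index set \<open>{..<n}\<close>.\<close>

definition std_gauss :: "nat \<Rightarrow> (nat \<Rightarrow> real) measure" where
  "std_gauss n = (\<Pi>\<^sub>M i \<in> {..<n}. std_normal_distribution)"

text \<open>The \<open>\<sigma>\<close>-algebra on the probability space generated by the vectors \<open>W 1, \<dots>, W d\<close> of \<open>\<real>\<^sup>n\<close>.\<close>

definition generated_by ::
  "'w measure \<Rightarrow> nat \<Rightarrow> nat \<Rightarrow> (nat \<Rightarrow> 'w \<Rightarrow> nat \<Rightarrow> real) \<Rightarrow> 'w measure" where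
  "generated_by M n d W =
     vimage_algebra (space M) (\<lambda>\<omega>. \<lambda>b \<in> {1..d}. W b \<omega>)
       (\<Pi>\<^sub>M b \<in> {1..d}. \<Pi>\<^sub>M i \<in> {..<n}. (borel :: real measure))"

definition cond_probability :: "'w measure \<Rightarrow> 'w measure \<Rightarrow> 'w set \<Rightarrow> 'w \<Rightarrow> real" where
  "cond_probability M F A = real_cond_exp M F (indicator A)"

text \<open>\<open>R n = o\<^sub>p(a n)\<close>, where \<open>R n\<close> is a random variable on the probability space \<open>M n\<close> and \<open>a n > 0\<close>.\<close>

definition little_o_p ::
  "(nat \<Rightarrow> 'w measure) \<Rightarrow> (nat \<Rightarrow> 'w \<Rightarrow> real) \<Rightarrow> (nat \<Rightarrow> real) \<Rightarrow> bool" where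
  "little_o_p M R a \<longleftrightarrow>
     (\<forall>\<epsilon>>0. (\<lambda>n. measure (M n) {\<omega> \<in> space (M n). \<bar>R n \<omega> / a n\<bar> > \<epsilon>}) \<longlonglongrightarrow> 0)"

text \<open>
  The event that \<open>conf_set\<close> covers the true \<open>\<beta>\<^sub>0\<^sub>,\<^sub>\<Lambda>\<close>, for noise \<open>U\<close> and artificial
  noise \<open>Ustar 1, \<dots>, Ustar d\<close>.
\<close>

definition coverage_event ::
  "'w measure \<Rightarrow> (nat set set \<Rightarrow> nat set) \<Rightarrow> (nat set \<Rightarrow> ereal set) \<Rightarrow> real mat \<Rightarrow> nat set \<Rightarrow>
   real vec \<Rightarrow> real \<Rightarrow> real \<Rightarrow> real \<Rightarrow> nat set \<Rightarrow> nat \<Rightarrow>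
   ('w \<Rightarrow> nat \<Rightarrow> real) \<Rightarrow> (nat \<Rightarrow> 'w \<Rightarrow> nat \<Rightarrow> real) \<Rightarrow> 'w set" where
  "coverage_event M sel conv X \<tau>\<^sub>0 \<beta>\<^sub>0 \<sigma>\<^sub>0 lam \<alpha> \<Lambda> d U Ustar =
     {\<omega> \<in> space M.
        let n = dim_row X;
            y = response X \<tau>\<^sub>0 \<beta>\<^sub>0 \<sigma>\<^sub>0 (vec n (U \<omega>));
            S = candidate_set sel X lam y d (\<lambda>b. vec n (Ustar b \<omega>))
        in subvector (full_coef (dim_col X) \<tau>\<^sub>0 \<beta>\<^sub>0) \<Lambda> \<in> conf_set conv X \<alpha> \<Lambda> S y}"

end

theory Submission
  imports Defs "HOL-Real_Asymp.Real_Asymp"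
begin

text \<open>
  Only \<open>\<tau>\<^sub>0 \<in> S\<close> and the exact \<open>F\<close> law of the statistic for the model \<open>\<tau>\<^sub>0\<close> matter: the coverage is
  at least \<open>\<alpha>\<close> minus the probability that \<open>\<tau>\<^sub>0\<close> is not the model selected with the first artificial
  noise \<open>w\<close>, and the same holds conditionally because the statistic for \<open>\<tau>\<^sub>0\<close> depends on \<open>U\<close> only.
  By Markov's inequality it is enough that this probability is exponentially small.

  For a competitor \<open>\<tau>\<close> let \<open>\<nu>\<close> be the residual of the mean \<open>\<mu>\<close> on the span of \<open>X\<^sub>\<tau>\<close> and \<open>w\<close>. The
  criterion at \<open>\<tau>\<close> exceeds the one at \<open>\<tau>\<^sub>0\<close> by at least \<open>\<bar>\<nu>\<bar>\<^sup>2 + 2\<sigma>\<^sub>0 \<nu> \<bullet> U - \<sigma>\<^sub>0\<^sup>2 Q + \<lambda> (card \<tau> - card \<tau>\<^sub>0)\<close>,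
  where \<open>Q\<close> is the squared norm of a projection of \<open>U\<close> of rank at most \<open>card (\<tau> - \<tau>\<^sub>0)\<close>. If
  \<open>card \<tau> > card \<tau>\<^sub>0\<close>, the penalty beats \<open>Q\<close> by a Chernoff bound. Otherwise \<open>\<bar>\<nu>\<bar>\<^sup>2\<close> is at least a third of
  the squared distance of \<open>\<mu>\<close> from the span of \<open>X\<^sub>\<tau>\<close>, unless \<open>w\<close> is nearly aligned with \<open>\<mu>\<close> modulo
  that span; since there are at most \<open>(p + 1)\<^bsup>card \<tau>\<^sub>0\<^esup>\<close> such models, the union of these alignment
  events is exponentially small by \<open>card \<tau>\<^sub>0 log p < 0.23 n\<close>.
\<close>

section \<open>Orthonormal systems\<close>

text \<open>Underfitting competes on two exponents. Up to a factor 3, the models of size at most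
  \<open>s\<close> number \<open>p ^ s\<close>, hence at most exp (0.23 n), and each has an
  alignment probability of at most 2 * 2 powr (-(n - s)/2), which is below 2 exp (-n/4) because s
  \<le> n/4. The margin 0.25 - 0.23 is the rate n/50. The obstacle is that the residual \<nu> of a
  competitor depends on the artificial noise. All deviation bounds for \<open>U\<close> are
  therefore proved with \<open>w\<close> fixed, where \<nu> and the projection behind
  \<open>Q\<close> are deterministic, and Fubini joins the two sources of randomness. In the
  overfitted case the penalty has ln (p/2) in place of ln p. It beats the number of models only from
  p = 16 on; smaller p costs the factor 4^16, which is absorbed because a = n t /
  \<open>\<sigma>\<^sub>0\<^sup>2\<close> grows without bound. The F law is exact because
  identifiability makes the columns of \<open>\<tau>\<^sub>0\<close> linearly independent, so that
  ranks equal the cardinalities used as degrees of freedom. Halving the final rate turns the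
  exponential bound into a little-o and lets the quotient in Markov's inequality tend to 0.\<close>

definition orthonormal :: "'a::real_inner set \<Rightarrow> bool" where
  "orthonormal C \<longleftrightarrow> (\<forall>x\<in>C. \<forall>y\<in>C. inner x y = (if x = y then 1 else 0))"

definition oproj :: "'a::real_inner set \<Rightarrow> 'a \<Rightarrow> 'a" where
  "oproj C y = (\<Sum>c\<in>C. inner c y *\<^sub>R c)"

lemma orthonormal_subset: "orthonormal C \<Longrightarrow> D \<subseteq> C \<Longrightarrow> orthonormal D"
  by (auto simp: orthonormal_def subset_iff)

lemma orthonormal_empty [simp]: "orthonormal {}"
  by (simp add: orthonormal_def)

lemma orthonormal_independent:
  assumes "orthonormal C"
  shows "independent C"
proof (rule pairwise_orthogonal_independent)
  show "pairwise real_inner_class.orthogonal C"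
    using assms by (auto simp: pairwise_def real_inner_class.orthogonal_def orthonormal_def)
  show "0 \<notin> C"
    using assms unfolding orthonormal_def by (metis inner_zero_left zero_neq_one)
qed

lemma oproj_in_span: "oproj C y \<in> span C"
  unfolding oproj_def by (intro span_sum span_scale span_base)

lemma inner_oproj:
  assumes "orthonormal C" "finite C" "c \<in> C"
  shows "inner c (oproj C y) = inner c y"
proof -
  have "inner c (oproj C y) = (\<Sum>d\<in>C. inner d y * inner c d)"
    by (simp add: oproj_def inner_sum_right)
  also have "\<dots> = (\<Sum>d\<in>C. if d = c then inner c y else 0)"
    using assms by (intro sum.cong) (auto simp: orthonormal_def)
  finally show ?thesis
    using assms by simp
qed

lemma orthogonal_span:
  assumes "\<And>c. c \<in> C \<Longrightarrow> inner x c = 0" "v \<in> span C"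
  shows "inner x v = 0"
  using assms(2)
proof (induction rule: span_induct_alt)
  case base
  then show ?case by simp
next
  case (step c b a)
  then show ?case using assms(1) by (simp add: inner_add_right)
qed

lemma oproj_residual:
  assumes "orthonormal C" "finite C" "v \<in> span C"
  shows "inner (y - oproj C y) v = 0"
proof (rule orthogonal_span[OF _ assms(3)])
  fix c assume "c \<in> C"
  from inner_oproj[OF assms(1,2) this, of y] show "inner (y - oproj C y) c = 0"
    by (subst inner_commute) (simp add: inner_diff_right)
qed

text \<open>The difference of the two candidates lies in the span and is orthogonal to it, hence to
  itself.\<close>

lemma oproj_eqI:
  assumes "orthonormal C" "finite C" "v \<in> span C" "\<And>w. w \<in> span C \<Longrightarrow> inner (y - v) w = 0"
  shows "oproj C y = v"
proof -
  let ?d = "oproj C y - v"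
  have d: "?d \<in> span C"
    using assms(3) oproj_in_span by (intro real_vector.span_diff)
  have "inner ?d ?d = inner (y - v) ?d - inner (y - oproj C y) ?d"
    by (simp add: inner_diff_left)
  also have "\<dots> = 0"
    using assms d oproj_residual by simp
  finally show ?thesis by simp
qed

lemma oproj_id:
  assumes "orthonormal C" "finite C" "v \<in> span C"
  shows "oproj C v = v"
  using assms by (intro oproj_eqI) auto

lemma inner_oproj_oproj:
  assumes "orthonormal C" "finite C"
  shows "inner (oproj C y) (oproj C y) = (\<Sum>c\<in>C. (inner c y)\<^sup>2)"
proof -
  have "inner (oproj C y) (oproj C y) = (\<Sum>c\<in>C. inner c y * inner c (oproj C y))"
    by (subst oproj_def) (simp add: inner_sum_left)
  also have "\<dots> = (\<Sum>c\<in>C. (inner c y)\<^sup>2)"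
    using assms by (intro sum.cong) (simp_all add: inner_oproj power2_eq_square)
  finally show ?thesis .
qed

lemma inner_oproj_self:
  assumes "orthonormal C" "finite C"
  shows "inner y (oproj C y) = (\<Sum>c\<in>C. (inner c y)\<^sup>2)"
  by (simp add: oproj_def inner_sum_right power2_eq_square inner_commute)

lemma norm_residual_sq:
  assumes "orthonormal C" "finite C"
  shows "(norm (y - oproj C y))\<^sup>2 = inner y y - (\<Sum>c\<in>C. (inner c y)\<^sup>2)"
  using inner_oproj_oproj[OF assms, of y] inner_oproj_self[OF assms, of y]
  by (simp add: power2_norm_eq_inner inner_diff_left inner_diff_right inner_commute)

lemma norm_diff_span:
  assumes "orthonormal C" "finite C" "v \<in> span C"
  shows "(norm (y - v))\<^sup>2 = (norm (y - oproj C y))\<^sup>2 + (norm (oproj C y - v))\<^sup>2"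
proof -
  have "oproj C y - v \<in> span C"
    using assms(3) oproj_in_span by (intro real_vector.span_diff)
  then have "inner (y - oproj C y) (oproj C y - v) = 0"
    using assms oproj_residual by blast
  moreover have "y - v = (y - oproj C y) + (oproj C y - v)" by simp
  ultimately show ?thesis
    by (metis norm_add_Pythagorean real_inner_class.orthogonal_def)
qed

lemma orthonormal_Un_orthogonal:
  assumes "orthonormal (C \<union> D)" "C \<inter> D = {}" "d \<in> D" "v \<in> span C"
  shows "inner d v = 0"
proof (rule orthogonal_span[OF _ assms(4)])
  fix c assume "c \<in> C"
  with assms show "inner d c = 0" by (auto simp: orthonormal_def)
qed

text \<open>Gram-Schmidt applied to the residuals of \<open>B\<close> modulo \<open>C\<close>. The
  last conclusion identifies \<open>span D\<close> with the span of these residuals, which is the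
  column space that \<open>O_mat\<close> projects onto.\<close>

lemma orthonormal_extend:
  fixes B C :: "'a::real_inner set"
  assumes C: "orthonormal C" "finite C" and B: "finite B"
  obtains D where "finite D" "C \<inter> D = {}" "orthonormal (C \<union> D)" "card D \<le> card B"
    "span (C \<union> D) = span (C \<union> B)" "span D = span ((\<lambda>b. b - oproj C b) ` B)"
proof -
  let ?R = "(\<lambda>b. b - oproj C b) ` B"
  obtain D0 where D0: "finite D0" "card D0 \<le> card ?R" "span D0 = span ?R" "pairwise real_inner_class.orthogonal D0"
    using basis_orthogonal[of ?R] B by auto
  \<comment> \<open>The orthogonal set \<open>D0\<close> may contain 0, which cannot be normalised;
    discarding it leaves the span unchanged.\<close>
  define D where "D = (\<lambda>x. x /\<^sub>R norm x) ` (D0 - {0})"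
  have fin: "finite D" using D0 by (simp add: D_def)
  have card: "card D \<le> card B"
  proof -
    have "card D \<le> card (D0 - {0})" unfolding D_def using D0 by (intro card_image_le) auto
    also have "\<dots> \<le> card D0" using D0 by (intro card_mono) auto
    also have "\<dots> \<le> card ?R" by (rule D0)
    also have "\<dots> \<le> card B" using B by (rule card_image_le)
    finally show ?thesis .
  qed
  have span_D: "span D = span D0"
  proof (rule subset_antisym)
    show "span D \<subseteq> span D0"
      unfolding D_def by (intro span_minimal) (auto intro: span_scale span_base)
    show "span D0 \<subseteq> span D"
    proof (intro span_minimal subsetI)
      fix x assume x: "x \<in> D0"
      show "x \<in> span D"
      proof (cases "x = 0")
        case False
        then have "x /\<^sub>R norm x \<in> D" using x by (auto simp: D_def)
        then have "norm x *\<^sub>R (x /\<^sub>R norm x) \<in> span D" by (intro span_scale span_base)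
        then show ?thesis using False by simp
      qed (simp add: span_zero)
    qed simp
  qed
  have orth_C: "inner c d = 0" if "c \<in> C" "d \<in> span ?R" for c d
  proof (rule orthogonal_span[OF _ that(2)])
    fix r assume "r \<in> ?R"
    then show "inner c r = 0"
      using inner_oproj[OF C that(1)] by (auto simp: inner_diff_right)
  qed
  have D_sub: "D \<subseteq> span ?R" using span_D D0(3) span_superset[of D] by simp
  have on_D: "inner x y = (if x = y then 1 else 0)" if xy: "x \<in> D" "y \<in> D" for x y
  proof -
    obtain x' y' where x': "x' \<in> D0" "x' \<noteq> 0" "x = x' /\<^sub>R norm x'"
      and y': "y' \<in> D0" "y' \<noteq> 0" "y = y' /\<^sub>R norm y'"
      using xy by (auto simp: D_def)
    have nx: "inner x x = 1"
      using x' by (simp add: dot_square_norm power2_eq_square)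
    show ?thesis
    proof (cases "x' = y'")
      case True
      then show ?thesis using nx x' y' by simp
    next
      case False
      then have "inner x y = 0"
        using D0(4) x' y' by (simp add: pairwise_def real_inner_class.orthogonal_def)
      then show ?thesis using nx by auto
    qed
  qed
  have disj: "C \<inter> D = {}"
  proof -
    have False if "c \<in> C" "c \<in> D" for c
    proof -
      have "inner c c = 0" using orth_C[OF that(1), of c] that(2) D_sub by blast
      moreover have "inner c c = 1" using that(1) C(1) by (simp add: orthonormal_def)
      ultimately show False by simp
    qed
    then show ?thesis by blast
  qed
  have on: "orthonormal (C \<union> D)"
    unfolding orthonormal_def
  proof (intro ballI)
    fix x y assume "x \<in> C \<union> D" "y \<in> C \<union> D"
    then consider "x \<in> C" "y \<in> C" | "x \<in> D" "y \<in> D" | "x \<in> C" "y \<in> D" "x \<noteq> y" | "x \<in> D" "y \<in> C" "x \<noteq> y"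
      using disj by blast
    then show "inner x y = (if x = y then 1 else 0)"
    proof cases
      case 1
      then show ?thesis using C(1) by (simp add: orthonormal_def)
    next
      case 2
      then show ?thesis by (rule on_D)
    next
      case 3
      then show ?thesis using orth_C[of x y] D_sub by auto
    next
      case 4
      then show ?thesis using orth_C[of y x] D_sub by (auto simp: inner_commute[of x y])
    qed
  qed
  have "span (C \<union> D) = span (C \<union> B)"
  proof (rule subset_antisym)
    have "oproj C b \<in> span (C \<union> B)" for b
      using oproj_in_span[of C b] span_mono[of C "C \<union> B"] by auto
    then have "b - oproj C b \<in> span (C \<union> B)" if "b \<in> B" for b
      using that by (intro real_vector.span_diff) (simp_all add: span_base)
    then have "?R \<subseteq> span (C \<union> B)" by blast
    then have "span ?R \<subseteq> span (C \<union> B)" by (simp add: span_minimal)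
    then have "D \<subseteq> span (C \<union> B)" using D_sub by blast
    moreover have "C \<subseteq> span (C \<union> B)" using span_superset[of "C \<union> B"] by blast
    ultimately show "span (C \<union> D) \<subseteq> span (C \<union> B)"
      by (intro span_minimal) simp_all
    have "b \<in> span (C \<union> D)" if "b \<in> B" for b
    proof -
      have "b - oproj C b \<in> span D"
        using that span_D D0(3) by (auto intro: span_base)
      then have "b - oproj C b \<in> span (C \<union> D)" using span_mono[of D "C \<union> D"] by auto
      moreover have "oproj C b \<in> span (C \<union> D)"
        using oproj_in_span[of C b] span_mono[of C "C \<union> D"] by auto
      ultimately have "(b - oproj C b) + oproj C b \<in> span (C \<union> D)" by (rule span_add)
      then show ?thesis by simp
    qed
    moreover have "C \<subseteq> span (C \<union> D)" using span_superset[of "C \<union> D"] by blast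
    ultimately show "span (C \<union> B) \<subseteq> span (C \<union> D)"
      by (intro span_minimal) auto
  qed
  moreover have "span D = span ?R" using span_D D0(3) by (rule trans)
  ultimately show ?thesis using that[OF fin disj on card] by blast
qed

lemma orthonormal_basis_exists:
  fixes B :: "'a::real_inner set"
  assumes "finite B"
  obtains C where "finite C" "orthonormal C" "card C \<le> card B" "span C = span B"
proof (rule orthonormal_extend[OF orthonormal_empty finite.emptyI assms])
  fix D :: "'a set"
  assume D: "finite D" "orthonormal ({} \<union> D)" "card D \<le> card B" "span ({} \<union> D) = span ({} \<union> B)"
  show thesis
    by (rule that[of D]) (use D in simp_all)
qed

lemma card_orthonormal_le:
  assumes "orthonormal C" "C \<subseteq> span B" "finite B"
  shows "finite C" "card C \<le> card B"
  using independent_span_bound[OF assms(3) orthonormal_independent[OF assms(1)] assms(2)] by auto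

section \<open>Finitely supported sequences as an inner product space\<close>

text \<open>
  All \<open>\<real>\<^sup>n\<close> live in one type, so that the library of real inner product spaces applies although
  the dimension varies.
\<close>

typedef fvec = "{f :: nat \<Rightarrow> real. finite {i. f i \<noteq> 0}}"
  morphisms coord Abs_fvec
  by (rule exI[of _ "\<lambda>_. 0"]) simp

setup_lifting type_definition_fvec

lemma finite_support: "finite {i. coord x i \<noteq> 0}"
  using coord by simp

instantiation fvec :: real_inner
begin

lift_definition zero_fvec :: fvec is "\<lambda>_. 0" by simp

lift_definition plus_fvec :: "fvec \<Rightarrow> fvec \<Rightarrow> fvec" is "\<lambda>f g i. f i + g i"
proof -
  fix f g :: "nat \<Rightarrow> real"
  assume "finite {i. f i \<noteq> 0}" "finite {i. g i \<noteq> 0}"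
  then show "finite {i. f i + g i \<noteq> 0}"
    by (rule_tac finite_subset[of _ "{i. f i \<noteq> 0} \<union> {i. g i \<noteq> 0}"]) auto
qed

lift_definition minus_fvec :: "fvec \<Rightarrow> fvec \<Rightarrow> fvec" is "\<lambda>f g i. f i - g i"
proof -
  fix f g :: "nat \<Rightarrow> real"
  assume "finite {i. f i \<noteq> 0}" "finite {i. g i \<noteq> 0}"
  then show "finite {i. f i - g i \<noteq> 0}"
    by (rule_tac finite_subset[of _ "{i. f i \<noteq> 0} \<union> {i. g i \<noteq> 0}"]) auto
qed

lift_definition uminus_fvec :: "fvec \<Rightarrow> fvec" is "\<lambda>f i. - f i" by simp

lift_definition scaleR_fvec :: "real \<Rightarrow> fvec \<Rightarrow> fvec" is "\<lambda>c f i. c * f i" by simp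

definition inner_fvec :: "fvec \<Rightarrow> fvec \<Rightarrow> real" where
  "inner_fvec x y = (\<Sum>i | coord x i \<noteq> 0. coord x i * coord y i)"

definition norm_fvec :: "fvec \<Rightarrow> real" where
  "norm_fvec x = sqrt (inner x x)"

definition sgn_fvec :: "fvec \<Rightarrow> fvec" where
  "sgn_fvec x = inverse (norm x) *\<^sub>R x"

definition dist_fvec :: "fvec \<Rightarrow> fvec \<Rightarrow> real" where
  "dist_fvec x y = norm (x - y)"

definition uniformity_fvec :: "(fvec \<times> fvec) filter" where
  "uniformity_fvec = (INF e\<in>{0<..}. principal {(x, y). dist x y < e})"

definition open_fvec :: "fvec set \<Rightarrow> bool" where
  "open_fvec S \<longleftrightarrow> (\<forall>x\<in>S. \<forall>\<^sub>F (x', y) in uniformity. x' = x \<longrightarrow> y \<in> S)"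

lemma inner_fvec_superset:
  assumes "finite A" "\<And>i. coord x i \<noteq> 0 \<Longrightarrow> i \<in> A"
  shows "inner x y = (\<Sum>i\<in>A. coord x i * coord y i)"
  unfolding inner_fvec_def using assms by (intro sum.mono_neutral_left) auto

lemma coord_simps [simp]:
  "coord 0 i = 0" "coord (x + y) i = coord x i + coord y i" "coord (x - y) i = coord x i - coord y i"
  "coord (- x) i = - coord x i" "coord (c *\<^sub>R x) i = c * coord x i"
  by (transfer; simp)+

lemma fvec_eqI: "(\<And>i. coord x i = coord y i) \<Longrightarrow> x = y"
  by (simp add: coord_inject[symmetric] fun_eq_iff)

instance
proof
  fix x y z :: fvec and a b :: real
  show "x + y + z = x + (y + z)"
    by (rule fvec_eqI) (simp add: algebra_simps)
  show "x + y = y + x"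
    by (rule fvec_eqI) (simp add: algebra_simps)
  show "0 + x = x"
    by (rule fvec_eqI) (simp add: algebra_simps)
  show "- x + x = 0"
    by (rule fvec_eqI) (simp add: algebra_simps)
  show "x - y = x + - y"
    by (rule fvec_eqI) (simp add: algebra_simps)
  show "a *\<^sub>R (x + y) = a *\<^sub>R x + a *\<^sub>R y"
    by (rule fvec_eqI) (simp add: algebra_simps)
  show "(a + b) *\<^sub>R x = a *\<^sub>R x + b *\<^sub>R x"
    by (rule fvec_eqI) (simp add: algebra_simps)
  show "a *\<^sub>R b *\<^sub>R x = (a * b) *\<^sub>R x"
    by (rule fvec_eqI) (simp add: algebra_simps)
  show "1 *\<^sub>R x = x"
    by (rule fvec_eqI) (simp add: algebra_simps)
  show "sgn x = inverse (norm x) *\<^sub>R x" by (rule sgn_fvec_def)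
  show "dist x y = norm (x - y)" by (rule dist_fvec_def)
  show "norm x = sqrt (inner x x)" by (rule norm_fvec_def)
  show "uniformity = (INF e\<in>{0<..}. principal {(x::fvec, y). dist x y < e})"
    by (rule uniformity_fvec_def)
  show "open S \<longleftrightarrow> (\<forall>x\<in>S. \<forall>\<^sub>F (x', y) in uniformity. x' = x \<longrightarrow> y \<in> S)" for S :: "fvec set"
    by (rule open_fvec_def)
  let ?A = "{i. coord x i \<noteq> 0} \<union> {i. coord y i \<noteq> 0} \<union> {i. coord z i \<noteq> 0}"
  have fin: "finite ?A" using finite_support by simp
  have sub: "coord x i \<noteq> 0 \<Longrightarrow> i \<in> ?A" "coord y i \<noteq> 0 \<Longrightarrow> i \<in> ?A"
    "coord (x + y) i \<noteq> 0 \<Longrightarrow> i \<in> ?A" "coord (a *\<^sub>R x) i \<noteq> 0 \<Longrightarrow> i \<in> ?A" for i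
    by auto
  have expand: "inner x w = (\<Sum>i\<in>?A. coord x i * coord w i)"
    "inner y w = (\<Sum>i\<in>?A. coord y i * coord w i)"
    "inner (x + y) w = (\<Sum>i\<in>?A. coord (x + y) i * coord w i)"
    "inner (a *\<^sub>R x) w = (\<Sum>i\<in>?A. coord (a *\<^sub>R x) i * coord w i)" for w
    by (intro inner_fvec_superset fin sub; assumption)+
  show "inner x y = inner y x"
    by (simp only: expand mult.commute)
  show "inner (x + y) z = inner x z + inner y z"
    by (simp only: expand coord_simps distrib_right sum.distrib)
  show "inner (a *\<^sub>R x) y = a * inner x y"
    by (simp only: expand coord_simps sum_distrib_left mult.assoc)
  show "0 \<le> inner x x"
    by (simp add: inner_fvec_def sum_nonneg)
  show "inner x x = 0 \<longleftrightarrow> x = 0"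
    by (auto simp: inner_fvec_def sum_nonneg_eq_0_iff finite_support intro!: fvec_eqI)
qed

end

lemma coord_sum [simp]: "coord (\<Sum>i\<in>A. f i) j = (\<Sum>i\<in>A. coord (f i) j)"
  by (induction A rule: infinite_finite_induct) auto

text \<open>Elements of a product space over \<open>{..<n}\<close> are \<open>undefined\<close> from
  index n on, so these coordinates are replaced by 0.\<close>

lift_definition emb :: "nat \<Rightarrow> (nat \<Rightarrow> real) \<Rightarrow> fvec" is "\<lambda>n u i. if i < n then u i else 0"
proof -
  fix n and u :: "nat \<Rightarrow> real"
  show "finite {i. (if i < n then u i else 0) \<noteq> 0}"
    by (rule finite_subset[of _ "{..<n}"]) auto
qed

lemma coord_emb [simp]: "coord (emb n u) i = (if i < n then u i else 0)"
  by transfer simp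

section \<open>The spaces R^n as coordinate subspaces, and their orthonormal bases\<close>

definition eucl :: "nat \<Rightarrow> fvec set" where
  "eucl n = {x. \<forall>i\<ge>n. coord x i = 0}"

lemma subspace_eucl: "Real_Vector_Spaces.subspace (eucl n)"
  by (auto simp: real_vector.subspace_def eucl_def)

lemma span_eucl: "span (eucl n) = eucl n"
  by (rule real_vector.span_eq_iff[THEN iffD2, OF subspace_eucl])

lemma emb_in_eucl [simp]: "emb n u \<in> eucl n"
  by (simp add: eucl_def)

lemma span_subset_eucl: "B \<subseteq> eucl n \<Longrightarrow> span B \<subseteq> eucl n"
  by (simp add: span_minimal subspace_eucl)

lemma inner_eucl:
  assumes "x \<in> eucl n"
  shows "inner x y = (\<Sum>i<n. coord x i * coord y i)"
  using assms by (intro inner_fvec_superset) (auto simp: eucl_def not_le[symmetric])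

lemma inner_emb_right: "inner x (emb n u) = (\<Sum>i<n. coord x i * u i)"
proof -
  have "inner x (emb n u) = inner (emb n u) x" by (rule inner_commute)
  also have "\<dots> = (\<Sum>i<n. coord x i * u i)"
    by (subst inner_eucl[of _ n]) (auto simp: mult.commute)
  finally show ?thesis .
qed

definition axis_vec :: "nat \<Rightarrow> fvec" where
  "axis_vec k = emb (Suc k) (\<lambda>i. if i = k then 1 else 0)"

lemma coord_axis_vec [simp]: "coord (axis_vec k) i = (if i = k then 1 else 0)"
  by (simp add: axis_vec_def)

lemma axis_vec_in_eucl: "k < n \<Longrightarrow> axis_vec k \<in> eucl n"
  by (simp add: eucl_def)

lemma inner_axis_vec [simp]: "inner (axis_vec k) x = coord x k"
  by (subst inner_fvec_superset[of "{k}"]) (auto split: if_splits)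

lemma inner_axis_vec' [simp]: "inner x (axis_vec k) = coord x k"
  by (subst inner_commute) simp

lemma inj_axis_vec: "inj axis_vec"
  by (rule injI) (metis coord_axis_vec zero_neq_one)

lemma orthonormal_axis: "orthonormal (axis_vec ` K)"
  unfolding orthonormal_def by (auto simp: inj_eq[OF inj_axis_vec])

lemma span_axis: "span (axis_vec ` {..<n}) = eucl n"
proof (rule subset_antisym)
  show "span (axis_vec ` {..<n}) \<subseteq> eucl n"
    by (intro span_minimal subspace_eucl) (auto intro: axis_vec_in_eucl)
  show "eucl n \<subseteq> span (axis_vec ` {..<n})"
  proof
    fix x assume x: "x \<in> eucl n"
    have "x = (\<Sum>k<n. coord x k *\<^sub>R axis_vec k)"
      using x by (intro fvec_eqI) (auto simp: eucl_def if_distrib sum.delta cong: if_cong)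
    then show "x \<in> span (axis_vec ` {..<n})"
      by (metis (no_types, lifting) span_sum span_scale span_base imageI lessThan_iff)
  qed
qed

lemma orthonormal_eucl:
  assumes "orthonormal C" "C \<subseteq> eucl n"
  shows "finite C" "card C \<le> n"
  using card_orthonormal_le[of C "axis_vec ` {..<n}"] assms span_axis[of n]
    card_image[OF inj_on_subset[OF inj_axis_vec], of "{..<n}"] by simp_all

text \<open>Extending by the axis vectors fills \<open>eucl n\<close>; comparing the result with the
  axis basis of the same space gives the size of \<open>G\<close>.\<close>

lemma orthonormal_complete:
  assumes "orthonormal C" "C \<subseteq> eucl n"
  obtains G where "finite G" "C \<inter> G = {}" "orthonormal (C \<union> G)" "span (C \<union> G) = eucl n"
    "G \<subseteq> eucl n" "card G = n - card C"
proof -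
  have fin: "finite C" using assms orthonormal_eucl by blast
  show thesis
  proof (rule orthonormal_extend[OF assms(1) fin])
    show "finite (axis_vec ` {..<n})" by simp
  next
    fix G
    assume G: "finite G" "C \<inter> G = {}" "orthonormal (C \<union> G)"
      "span (C \<union> G) = span (C \<union> axis_vec ` {..<n})"
    have "axis_vec ` {..<n} \<subseteq> eucl n"
      by (auto intro: axis_vec_in_eucl)
    then have "span (C \<union> axis_vec ` {..<n}) \<subseteq> eucl n"
      using assms(2) by (intro span_subset_eucl) blast
    moreover have "eucl n \<subseteq> span (C \<union> axis_vec ` {..<n})"
      unfolding span_axis[symmetric] by (rule span_mono) blast
    ultimately have spn: "span (C \<union> G) = eucl n" using G(4) by blast
    have sub: "G \<subseteq> eucl n" using spn span_superset[of "C \<union> G"] by blast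
    have "span (C \<union> G) = span (eucl n)"
      unfolding spn span_eucl ..
    then have "card (C \<union> G) = dim (eucl n)"
      by (rule dim_eq_card[symmetric, OF _ orthonormal_independent[OF G(3)]])
    also have "span (axis_vec ` {..<n}) = span (eucl n)"
      unfolding span_axis span_eucl ..
    then have "dim (eucl n) = card (axis_vec ` {..<n})"
      by (rule dim_eq_card[OF _ orthonormal_independent[OF orthonormal_axis]])
    also have "\<dots> = n"
      using card_image[OF inj_on_subset[OF inj_axis_vec], of "{..<n}"] by simp
    finally have "card C + card G = n"
      using card_Un_disjoint[OF fin G(1,2)] by simp
    then have "card G = n - card C" by simp
    then show thesis
      by (rule that[OF G(1-3) spn sub])
  qed
qed

section \<open>Rotation invariance of the standard Gaussian law\<close>

text \<open>Fubini isolates coordinate \<open>l\<close>. Since \<open>f\<close> ignores it, the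
  inner integral is a one-dimensional affine substitution with Jacobian
  \<open>\<bar>a\<bar>\<close>.\<close>

lemma nn_integral_affine_update:
  fixes h :: "(nat \<Rightarrow> real) \<Rightarrow> ennreal"
  assumes l: "l < n" and a: "a \<noteq> 0"
    and [measurable]: "h \<in> borel_measurable (Pi\<^sub>M {..<n} (\<lambda>_. lborel))"
    and [measurable]: "f \<in> borel_measurable (Pi\<^sub>M {..<n} (\<lambda>_. lborel))"
    and f: "\<And>x y. f (x(l := y)) = f x"
  shows "ennreal \<bar>a\<bar> * (\<integral>\<^sup>+x. h (x(l := a * x l + f x)) \<partial>Pi\<^sub>M {..<n} (\<lambda>_. lborel))
    = (\<integral>\<^sup>+x. h x \<partial>Pi\<^sub>M {..<n} (\<lambda>_. lborel))"
proof -
  interpret product_sigma_finite "\<lambda>_::nat. lborel :: real measure" ..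
  let ?I = "{..<n} - {l}"
  have I: "finite ?I" "l \<notin> ?I" and ins: "insert l ?I = {..<n}" using l by auto
  have [measurable]: "(\<lambda>x. x(l := a * x l + f x)) \<in> Pi\<^sub>M {..<n} (\<lambda>_. lborel) \<rightarrow>\<^sub>M Pi\<^sub>M {..<n} (\<lambda>_. lborel)"
    using l by (intro measurable_fun_upd[where J="{..<n}"]) auto
  have sec: "(\<lambda>y. h (x(l := y))) \<in> borel_measurable borel" if "x \<in> space (Pi\<^sub>M ?I (\<lambda>_. lborel))" for x
  proof -
    have "(\<lambda>y. x(l := y)) \<in> borel \<rightarrow>\<^sub>M Pi\<^sub>M {..<n} (\<lambda>_. lborel)"
      using that ins by (intro measurable_fun_upd[where J="?I"]) auto
    from measurable_compose[OF this assms(3)] show ?thesis .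
  qed
  have "(\<integral>\<^sup>+x. h (x(l := a * x l + f x)) \<partial>Pi\<^sub>M (insert l ?I) (\<lambda>_. lborel))
      = (\<integral>\<^sup>+x. (\<integral>\<^sup>+y. h ((x(l := y))(l := a * (x(l := y)) l + f (x(l := y)))) \<partial>lborel) \<partial>Pi\<^sub>M ?I (\<lambda>_. lborel))"
    by (rule product_nn_integral_insert[OF I]) (unfold ins, measurable)
  also have "\<dots> = (\<integral>\<^sup>+x. (\<integral>\<^sup>+y. h (x(l := f x + a * y)) \<partial>lborel) \<partial>Pi\<^sub>M ?I (\<lambda>_. lborel))"
    by (simp add: f add.commute)
  finally have "ennreal \<bar>a\<bar> * (\<integral>\<^sup>+x. h (x(l := a * x l + f x)) \<partial>Pi\<^sub>M {..<n} (\<lambda>_. lborel))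
      = ennreal \<bar>a\<bar> * (\<integral>\<^sup>+x. (\<integral>\<^sup>+y. h (x(l := f x + a * y)) \<partial>lborel) \<partial>Pi\<^sub>M ?I (\<lambda>_. lborel))"
    unfolding ins by simp
  also have "\<dots> = (\<integral>\<^sup>+x. ennreal \<bar>a\<bar> * (\<integral>\<^sup>+y. h (x(l := f x + a * y)) \<partial>lborel) \<partial>Pi\<^sub>M ?I (\<lambda>_. lborel))"
  proof (rule nn_integral_cmult[symmetric])
    \<comment> \<open>As \<open>f\<close> ignores coordinate \<open>l\<close>, it may be evaluated
      with that coordinate set to 0, which makes it measurable in the remaining coordinates
      alone.\<close>
    have [measurable]: "(\<lambda>x. x(l := 0)) \<in> Pi\<^sub>M ?I (\<lambda>_. lborel) \<rightarrow>\<^sub>M Pi\<^sub>M {..<n} (\<lambda>_. lborel)"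
      using ins by (intro measurable_fun_upd[where J="?I"]) auto
    have [measurable]: "(\<lambda>x. f (x(l := 0))) \<in> borel_measurable (Pi\<^sub>M ?I (\<lambda>_. lborel))"
      by measurable
    then have [measurable]: "f \<in> borel_measurable (Pi\<^sub>M ?I (\<lambda>_. lborel))"
      by (simp add: f)
    have [measurable]: "(\<lambda>z. (fst z)(l := f (fst z) + a * snd z))
        \<in> Pi\<^sub>M ?I (\<lambda>_. lborel) \<Otimes>\<^sub>M lborel \<rightarrow>\<^sub>M Pi\<^sub>M {..<n} (\<lambda>_. lborel)"
      using ins by (intro measurable_fun_upd[where J="?I"]) auto
    have "(\<lambda>z. h ((fst z)(l := f (fst z) + a * snd z)))
        \<in> borel_measurable (Pi\<^sub>M ?I (\<lambda>_. lborel) \<Otimes>\<^sub>M lborel)"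
      by measurable
    then show "(\<lambda>x. \<integral>\<^sup>+y. h (x(l := f x + a * y)) \<partial>lborel) \<in> borel_measurable (Pi\<^sub>M ?I (\<lambda>_. lborel))"
      by (intro lborel.borel_measurable_nn_integral) (simp add: case_prod_beta')
  qed
  also have "\<dots> = (\<integral>\<^sup>+x. (\<integral>\<^sup>+y. h (x(l := y)) \<partial>lborel) \<partial>Pi\<^sub>M ?I (\<lambda>_. lborel))"
    by (intro nn_integral_cong nn_integral_real_affine[symmetric] sec a)
  also have "\<dots> = (\<integral>\<^sup>+x. h x \<partial>Pi\<^sub>M (insert l ?I) (\<lambda>_. lborel))"
    by (rule product_nn_integral_insert[OF I, symmetric]) (unfold ins, measurable)
  finally show ?thesis unfolding ins .
qed

lemma measurable_shears:
  assumes "l < n" "l \<notin> S" "S \<subseteq> {..<n}"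
  shows "(\<lambda>x i. if i \<in> S then x i - c i * x l else x i :: real)
    \<in> Pi\<^sub>M {..<n} (\<lambda>_. lborel) \<rightarrow>\<^sub>M Pi\<^sub>M {..<n} (\<lambda>_. lborel)"
proof (rule measurable_PiM_single')
  fix i assume "i \<in> {..<n}"
  then show "(\<lambda>x. if i \<in> S then x i - c i * x l else x i) \<in> Pi\<^sub>M {..<n} (\<lambda>_. lborel) \<rightarrow>\<^sub>M lborel"
    using assms(1) by (cases "i \<in> S") auto
qed (use assms in \<open>auto simp: space_PiM PiE_def extensional_def\<close>)

text \<open>Each shear has Jacobian 1 and reads only coordinate \<open>l\<close>, which no shear
  alters, so the shears can be peeled off one coordinate at a time.\<close>

lemma nn_integral_shears:
  fixes h :: "(nat \<Rightarrow> real) \<Rightarrow> ennreal"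
  assumes "finite S" "S \<subseteq> {..<n}" "l < n" "l \<notin> S"
    and "h \<in> borel_measurable (Pi\<^sub>M {..<n} (\<lambda>_. lborel))"
  shows "(\<integral>\<^sup>+x. h (\<lambda>i. if i \<in> S then x i - c i * x l else x i) \<partial>Pi\<^sub>M {..<n} (\<lambda>_. lborel))
      = (\<integral>\<^sup>+x. h x \<partial>Pi\<^sub>M {..<n} (\<lambda>_. lborel :: real measure))"
  using assms
proof (induction S arbitrary: h rule: finite_induct)
  case empty
  then show ?case by simp
next
  case (insert j S)
  let ?L = "Pi\<^sub>M {..<n} (\<lambda>_. lborel :: real measure)"
  let ?B = "\<lambda>S x i. if i \<in> S then x i - c i * x l else x i :: real"
  have jl: "j \<noteq> l" "j < n" "l < n" "l \<notin> S" "S \<subseteq> {..<n}" using insert.prems by auto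
  have [measurable]: "h \<in> borel_measurable ?L" by fact
  have eq: "?B (insert j S) x = (?B S x)(j := 1 * ?B S x j + - c j * ?B S x l)" for x
    using jl insert.hyps by (auto simp: fun_eq_iff)
  have upd[measurable]: "(\<lambda>z. z(j := 1 * z j + - c j * z l)) \<in> ?L \<rightarrow>\<^sub>M ?L"
    using jl by (intro measurable_fun_upd[where J="{..<n}"]) auto
  have "(\<integral>\<^sup>+x. h (?B (insert j S) x) \<partial>?L)
      = (\<integral>\<^sup>+x. (\<lambda>z. h (z(j := 1 * z j + - c j * z l))) (?B S x) \<partial>?L)"
    unfolding eq ..
  also have "\<dots> = (\<integral>\<^sup>+z. h (z(j := 1 * z j + - c j * z l)) \<partial>?L)"
    by (rule insert.IH[OF jl(5,3,4)]) measurable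
  also have "\<dots> = (\<integral>\<^sup>+z. h z \<partial>?L)"
    using nn_integral_affine_update[of j n 1 h "\<lambda>z. - c j * z l"] jl by simp
  finally show ?case .
qed

text \<open>The Householder reflection along a unit vector \<open>v\<close>; the restriction to
  \<open>{..<n}\<close> keeps the image in the space of the product measure.\<close>

definition reflect :: "nat \<Rightarrow> fvec \<Rightarrow> (nat \<Rightarrow> real) \<Rightarrow> (nat \<Rightarrow> real)" where
  "reflect n v x = (\<lambda>i\<in>{..<n}. x i - 2 * inner v (emb n x) * coord v i)"

lemma measurable_reflect [measurable]:
  "reflect n v \<in> Pi\<^sub>M {..<n} (\<lambda>_. borel) \<rightarrow>\<^sub>M Pi\<^sub>M {..<n} (\<lambda>_. borel)"
  unfolding reflect_def inner_emb_right by measurable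

lemma emb_reflect:
  assumes "v \<in> eucl n"
  shows "emb n (reflect n v x) = emb n x - (2 * inner v (emb n x)) *\<^sub>R v"
  using assms by (intro fvec_eqI) (auto simp: reflect_def eucl_def)

text \<open>
  A reflection is a composition of an affine update of one coordinate \<open>l\<close> to \<open>v \<bullet> x\<close>, shears of
  the other coordinates, and an affine update of \<open>l\<close> to its final value.
\<close>

lemma nn_integral_reflect_lborel:
  fixes h :: "(nat \<Rightarrow> real) \<Rightarrow> ennreal"
  assumes v: "v \<in> eucl n" "norm v = 1"
    and h[measurable]: "h \<in> borel_measurable (Pi\<^sub>M {..<n} (\<lambda>_. lborel))"
  shows "(\<integral>\<^sup>+x. h (reflect n v x) \<partial>Pi\<^sub>M {..<n} (\<lambda>_. lborel)) = (\<integral>\<^sup>+x. h x \<partial>Pi\<^sub>M {..<n} (\<lambda>_. lborel))"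
proof -
  let ?L = "Pi\<^sub>M {..<n} (\<lambda>_. lborel :: real measure)"
  have vv: "(\<Sum>i<n. (coord v i)\<^sup>2) = 1"
    using v inner_eucl[of v n v] by (simp add: dot_square_norm power2_eq_square)
  then obtain l where l: "l < n" "coord v l \<noteq> 0"
    by (metis (no_types, lifting) lessThan_iff power_zero_numeral sum.neutral zero_neq_one)
  let ?I = "{..<n} - {l}"
  define A where "A = (\<lambda>x. x(l := coord v l * x l + (\<Sum>k\<in>?I. coord v k * x k)))"
  define B where "B = (\<lambda>x i. if i \<in> ?I then x i - (2 * coord v i) * x l else x i :: real)"
  \<comment> \<open>The reflected vector has inner product -(v \<bullet> x) with \<open>v\<close>.
    Solving this equation for its coordinate \<open>l\<close>, when the other coordinates are
    already final and coordinate \<open>l\<close> holds v \<bullet> x, gives this update.\<close>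
  define C where "C = (\<lambda>x. x(l := (- 1 / coord v l) * x l + - (\<Sum>k\<in>?I. coord v k * x k) / coord v l))"
  have Am[measurable]: "A \<in> ?L \<rightarrow>\<^sub>M ?L" and Cm[measurable]: "C \<in> ?L \<rightarrow>\<^sub>M ?L"
    unfolding A_def C_def using l by (intro measurable_fun_upd[where J="{..<n}"]; auto)+
  have Bm[measurable]: "B \<in> ?L \<rightarrow>\<^sub>M ?L"
    unfolding B_def using l by (intro measurable_shears) auto
  have split: "(\<Sum>k<n. f k) = f l + (\<Sum>k\<in>?I. f k)" for f :: "nat \<Rightarrow> real"
    using l by (intro sum.remove) auto
  have refl: "reflect n v x = C (B (A x))" if "x \<in> space ?L" for x
  proof
    fix i
    have ext: "i \<ge> n \<Longrightarrow> x i = undefined"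
      using that by (auto simp: space_PiM PiE_def extensional_def)
    define w where "w = inner v (emb n x)"
    have w: "w = coord v l * x l + (\<Sum>k\<in>?I. coord v k * x k)"
      unfolding w_def inner_emb_right split ..
    have BA: "B (A x) j = (if j = l then w else if j < n then x j - 2 * coord v j * w else x j)" for j
      using l by (auto simp: A_def B_def w)
    have "(\<Sum>k\<in>?I. coord v k * B (A x) k) = (\<Sum>k\<in>?I. coord v k * x k - 2 * w * (coord v k)\<^sup>2)"
      by (intro sum.cong) (auto simp: BA power2_eq_square algebra_simps)
    also have "\<dots> = (w - coord v l * x l) - 2 * w * (1 - (coord v l)\<^sup>2)"
      using vv unfolding split[of "\<lambda>i. (coord v i)\<^sup>2"] w
      by (simp add: sum_subtractf sum_distrib_left[symmetric])
    finally have sm: "(\<Sum>k\<in>?I. coord v k * B (A x) k) = (w - coord v l * x l) - 2 * w * (1 - (coord v l)\<^sup>2)" .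
    have "C (B (A x)) l = x l - 2 * w * coord v l"
      using l(2) unfolding C_def fun_upd_same BA[of l] sm by (simp add: field_simps power2_eq_square)
    moreover have "C (B (A x)) i = B (A x) i" if "i \<noteq> l"
      using that by (simp add: C_def)
    ultimately show "reflect n v x i = C (B (A x)) i"
      using l ext BA[of i] unfolding reflect_def w_def[symmetric] by (cases "i = l") auto
  qed
  have sum_upd: "(\<Sum>k\<in>?I. coord v k * (x(l := y)) k) = (\<Sum>k\<in>?I. coord v k * x k)" for x y
    by (intro sum.cong) auto
  have hA: "ennreal \<bar>coord v l\<bar> * (\<integral>\<^sup>+x. g (A x) \<partial>?L) = (\<integral>\<^sup>+x. g x \<partial>?L)"
    if [measurable]: "g \<in> borel_measurable ?L" for g :: "(nat \<Rightarrow> real) \<Rightarrow> ennreal"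
    unfolding A_def using l by (intro nn_integral_affine_update sum_upd) measurable
  have hC: "ennreal \<bar>- 1 / coord v l\<bar> * (\<integral>\<^sup>+x. h (C x) \<partial>?L) = (\<integral>\<^sup>+x. h x \<partial>?L)"
    unfolding C_def using l by (intro nn_integral_affine_update) (auto simp del: fun_upd_apply simp: sum_upd)
  have "(\<integral>\<^sup>+x. h (reflect n v x) \<partial>?L) = (\<integral>\<^sup>+x. h (C (B (A x))) \<partial>?L)"
    by (intro nn_integral_cong) (simp add: refl)
  \<comment> \<open>The Jacobians of \<open>A\<close> and \<open>C\<close> are reciprocal, so both
    factors may be inserted at once.\<close>
  also have "\<dots> = ennreal \<bar>- 1 / coord v l\<bar> * (ennreal \<bar>coord v l\<bar> * (\<integral>\<^sup>+x. h (C (B (A x))) \<partial>?L))"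
    using l by (simp add: mult.assoc[symmetric] ennreal_mult[symmetric] abs_mult[symmetric])
  also have "ennreal \<bar>coord v l\<bar> * (\<integral>\<^sup>+x. h (C (B (A x))) \<partial>?L) = (\<integral>\<^sup>+x. h (C (B x)) \<partial>?L)"
    by (rule hA) measurable
  also have "\<dots> = (\<integral>\<^sup>+x. h (C x) \<partial>?L)"
    unfolding B_def using l by (intro nn_integral_shears) auto
  also note hC
  finally show ?thesis .
qed

section \<open>The Gaussian law under reflections and in orthonormal frames\<close>

lemma sets_std_gauss [measurable_cong]: "sets (std_gauss n) = sets (Pi\<^sub>M {..<n} (\<lambda>_. borel))"
  unfolding std_gauss_def by (intro sets_PiM_cong) auto

lemma prob_space_std_normal: "prob_space std_normal_distribution"
  by (rule prob_space_normal_density) simp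

lemma prob_space_std_gauss: "prob_space (std_gauss n)"
  unfolding std_gauss_def by (intro prob_space_PiM prob_space_std_normal)

text \<open>Written through the squared norm alone, the density is visibly unchanged by reflections.
  The two measures agree on boxes by Fubini.\<close>

lemma std_gauss_density:
  "std_gauss n = density (Pi\<^sub>M {..<n} (\<lambda>_. lborel))
     (\<lambda>x. ennreal ((1 / sqrt (2 * pi)) ^ n * exp (- (\<Sum>i<n. (x i)\<^sup>2) / 2)))"
proof -
  interpret L: product_sigma_finite "\<lambda>_::nat. lborel :: real measure" ..
  have P: "product_sigma_finite (\<lambda>_::nat. std_normal_distribution)"
    unfolding product_sigma_finite_def
    using prob_space_std_normal prob_space.axioms(1) finite_measure.axioms(1) by blast
  have dens: "(1 / sqrt (2 * pi)) ^ n * exp (- (\<Sum>i<n. (x i)\<^sup>2) / 2) = (\<Prod>i<n. std_normal_density (x i))"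
    for x :: "nat \<Rightarrow> real"
  proof -
    have "(\<Prod>i<n. std_normal_density (x i)) = (\<Prod>i<n. (1 / sqrt (2 * pi)) * exp (- (x i)\<^sup>2 / 2))"
      by (intro prod.cong refl) (simp add: normal_density_def)
    also have "\<dots> = (1 / sqrt (2 * pi)) ^ n * exp (\<Sum>i<n. - (x i)\<^sup>2 / 2)"
      by (simp only: prod.distrib prod_constant card_lessThan exp_sum finite_lessThan)
    also have "(\<Sum>i<n. - (x i)\<^sup>2 / 2) = - (\<Sum>i<n. (x i)\<^sup>2) / 2"
      by (simp add: sum_negf sum_divide_distrib)
    finally show ?thesis by simp
  qed
  show ?thesis
    unfolding std_gauss_def dens
  proof (rule product_sigma_finite.PiM_eqI[OF P, symmetric])
    show "finite {..<n}" by simp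
    show "sets (density (Pi\<^sub>M {..<n} (\<lambda>_. lborel)) (\<lambda>x. ennreal (\<Prod>i<n. std_normal_density (x i))))
      = sets (Pi\<^sub>M {..<n} (\<lambda>_. std_normal_distribution))"
      by (simp, intro sets_PiM_cong) auto
    fix A :: "nat \<Rightarrow> real set" assume "\<And>i. i \<in> {..<n} \<Longrightarrow> A i \<in> sets std_normal_distribution"
    then have A[measurable]: "i < n \<Longrightarrow> A i \<in> sets borel" for i by simp
    have "emeasure (density (Pi\<^sub>M {..<n} (\<lambda>_. lborel)) (\<lambda>x. ennreal (\<Prod>i<n. std_normal_density (x i)))) (Pi\<^sub>E {..<n} A)
      = (\<integral>\<^sup>+x. ennreal (\<Prod>i<n. std_normal_density (x i)) * indicator (Pi\<^sub>E {..<n} A) x \<partial>Pi\<^sub>M {..<n} (\<lambda>_. lborel))"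
      by (intro emeasure_density) (auto intro!: sets_PiM_I_finite)
    also have "\<dots> = (\<integral>\<^sup>+x. (\<Prod>i<n. ennreal (std_normal_density (x i)) * indicator (A i) (x i)) \<partial>Pi\<^sub>M {..<n} (\<lambda>_. lborel))"
    proof (intro nn_integral_cong)
      fix x assume "x \<in> space (Pi\<^sub>M {..<n} (\<lambda>_. lborel :: real measure))"
      then have "(indicator (Pi\<^sub>E {..<n} A) x :: ennreal) = (\<Prod>i<n. indicator (A i) (x i))"
        by (auto simp: indicator_def space_PiM PiE_iff prod_zero_iff)
      then show "ennreal (\<Prod>i<n. std_normal_density (x i)) * indicator (Pi\<^sub>E {..<n} A) x
          = (\<Prod>i<n. ennreal (std_normal_density (x i)) * indicator (A i) (x i))"
        by (simp add: prod.distrib prod_ennreal)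
    qed
    also have "\<dots> = (\<Prod>i<n. \<integral>\<^sup>+x. ennreal (std_normal_density x) * indicator (A i) x \<partial>lborel)"
      by (rule L.product_nn_integral_prod) (auto intro!: borel_measurable_times_ennreal borel_measurable_indicator)
    also have "\<dots> = (\<Prod>i<n. emeasure std_normal_distribution (A i))"
      by (intro prod.cong refl emeasure_density[symmetric]) auto
    finally show "emeasure (density (Pi\<^sub>M {..<n} (\<lambda>_. lborel)) (\<lambda>x. ennreal (\<Prod>i<n. std_normal_density (x i)))) (Pi\<^sub>E {..<n} A)
      = (\<Prod>i\<in>{..<n}. emeasure std_normal_distribution (A i))" .
  qed
qed

lemma distr_reflect:
  assumes v: "v \<in> eucl n" "norm v = 1"
  shows "distr (std_gauss n) (Pi\<^sub>M {..<n} (\<lambda>_. borel)) (reflect n v) = std_gauss n"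
proof (rule measure_eqI)
  show "sets (distr (std_gauss n) (Pi\<^sub>M {..<n} (\<lambda>_. borel)) (reflect n v)) = sets (std_gauss n)"
    by (simp add: sets_std_gauss)
  fix S assume "S \<in> sets (distr (std_gauss n) (Pi\<^sub>M {..<n} (\<lambda>_. borel)) (reflect n v))"
  then have S[measurable]: "S \<in> sets (Pi\<^sub>M {..<n} (\<lambda>_. borel :: real measure))" by simp
  let ?L = "Pi\<^sub>M {..<n} (\<lambda>_. lborel :: real measure)"
  let ?d = "\<lambda>x. ennreal ((1 / sqrt (2 * pi)) ^ n * exp (- (\<Sum>i<n. (x i)\<^sup>2) / 2))"
  have sq: "(\<Sum>i<n. (x i)\<^sup>2) = (norm (emb n x))\<^sup>2" for x
    by (simp add: power2_norm_eq_inner inner_emb_right) (simp add: power2_eq_square)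
  have "inner (emb n x - (2 * inner v (emb n x)) *\<^sub>R v) (emb n x - (2 * inner v (emb n x)) *\<^sub>R v) = inner (emb n x) (emb n x)" for x
  proof -
    have "inner v v = 1" using v(2) by (simp add: dot_square_norm)
    then show ?thesis by (simp add: inner_diff_left inner_diff_right inner_commute)
  qed
  then have inv: "(\<Sum>i<n. (reflect n v x i)\<^sup>2) = (\<Sum>i<n. (x i)\<^sup>2)" for x
    unfolding sq power2_norm_eq_inner emb_reflect[OF v(1)] .
  have "emeasure (distr (std_gauss n) (Pi\<^sub>M {..<n} (\<lambda>_. borel)) (reflect n v)) S
    = (\<integral>\<^sup>+x. indicator S (reflect n v x) \<partial>std_gauss n)"
    by (subst nn_integral_distr[of _ _ "Pi\<^sub>M {..<n} (\<lambda>_. borel)" "indicator S", symmetric]) simp_all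
  also have "\<dots> = (\<integral>\<^sup>+x. ?d x * indicator S (reflect n v x) \<partial>?L)"
    unfolding std_gauss_density by (rule nn_integral_density) measurable
  also have "\<dots> = (\<integral>\<^sup>+x. (\<lambda>y. ?d y * indicator S y) (reflect n v x) \<partial>?L)"
    by (simp add: inv)
  also have "\<dots> = (\<integral>\<^sup>+x. ?d x * indicator S x \<partial>?L)"
    by (rule nn_integral_reflect_lborel[OF v]) measurable
  also have "\<dots> = emeasure (std_gauss n) S"
    unfolding std_gauss_density by (rule emeasure_density[symmetric]) measurable
  finally show "emeasure (distr (std_gauss n) (Pi\<^sub>M {..<n} (\<lambda>_. borel)) (reflect n v)) S = emeasure (std_gauss n) S" .
qed

lemma measurable_inner_emb [measurable]:
  "(\<lambda>u. inner v (emb n u)) \<in> borel_measurable (Pi\<^sub>M {..<n} (\<lambda>_. borel))"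
  unfolding inner_emb_right by measurable

text \<open>Induction on the number of frame vectors not yet straightened: one reflection turns one
  more of them into an axis vector and keeps the law. A frame of axis vectors merely reads off
  coordinates.\<close>

lemma distr_inner_frame_aux:
  fixes e :: "nat \<Rightarrow> fvec"
  assumes "\<And>i. i < k \<Longrightarrow> e i \<in> eucl n"
    and "\<And>i j. i < k \<Longrightarrow> j < k \<Longrightarrow> inner (e i) (e j) = (if i = j then 1 else 0)"
    and "m \<le> k" "\<And>j. j < m \<Longrightarrow> e j = axis_vec j"
  shows "distr (std_gauss n) (Pi\<^sub>M {..<k} (\<lambda>_. borel)) (\<lambda>u. \<lambda>i\<in>{..<k}. inner (e i) (emb n u)) = std_gauss k"
  using assms
proof (induction "k - m" arbitrary: m e)
  case 0
  have inj: "inj_on e {..<k}"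
  proof (rule inj_onI)
    fix i j assume ij: "i \<in> {..<k}" "j \<in> {..<k}" "e i = e j"
    then have "inner (e i) (e j) = 1" using 0(3)[of i i] by simp
    then show "i = j" using 0(3)[of i j] ij by (simp split: if_splits)
  qed
  have "orthonormal (e ` {..<k})" "e ` {..<k} \<subseteq> eucl n"
    using 0(2,3) by (auto simp: orthonormal_def inj_on_eq_iff[OF inj])
  then have kn: "k \<le> n"
    using orthonormal_eucl(2)[of "e ` {..<k}" n] card_image[OF inj] by simp
  have "k = m" using 0 by simp
  then have e: "e i = axis_vec i" if "i < k" for i using 0(5) that by blast
  have "distr (std_gauss n) (Pi\<^sub>M {..<k} (\<lambda>_. borel)) (\<lambda>u. \<lambda>i\<in>{..<k}. inner (e i) (emb n u))
    = distr (std_gauss n) (Pi\<^sub>M {..<k} (\<lambda>_. std_normal_distribution)) (\<lambda>u. \<lambda>i\<in>{..<k}. u i)"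
    using e kn by (intro distr_cong refl sets_PiM_cong) (auto simp: fun_eq_iff)
  also have "\<dots> = std_gauss k"
    unfolding std_gauss_def using kn prob_space_std_normal
    by (intro distr_PiM_reindex[where f="\<lambda>i. i" and M="\<lambda>_. std_normal_distribution"]) auto
  finally show ?case .
next
  case (Suc r)
  have mk: "m < k" using Suc(2) by simp
  have inj: "inj_on e {..<k}"
  proof (rule inj_onI)
    fix i j assume ij: "i \<in> {..<k}" "j \<in> {..<k}" "e i = e j"
    then have "inner (e i) (e j) = 1" using Suc(4)[of i i] by simp
    then show "i = j" using Suc(4)[of i j] ij by (simp split: if_splits)
  qed
  have "orthonormal (e ` {..<k})" "e ` {..<k} \<subseteq> eucl n"
    using Suc(3,4) by (auto simp: orthonormal_def inj_on_eq_iff[OF inj])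
  then have kn: "k \<le> n"
    using orthonormal_eucl(2)[of "e ` {..<k}" n] card_image[OF inj] by simp
  show ?case
  proof (cases "e m = axis_vec m")
    case True
    show ?thesis
    proof (rule Suc(1)[of "Suc m" e])
      show "r = k - Suc m" "Suc m \<le> k" using Suc(2) by auto
      show "e j = axis_vec j" if "j < Suc m" for j
        using that Suc(6)[of j] True by (auto simp: less_Suc_eq)
    qed (use Suc in auto)
  next
    case False
    \<comment> \<open>The reflection along \<open>d\<close> exchanges the unit vectors
      \<open>e m\<close> and \<open>axis_vec m\<close>. It fixes the earlier axis vectors because
      both of these are orthogonal to them.\<close>
    define d where "d = e m - axis_vec m"
    define v where "v = (1 / norm d) *\<^sub>R d"
    define e' where "e' = (\<lambda>j. e j - (2 * inner v (e j)) *\<^sub>R v)"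
    have d0: "norm d \<noteq> 0" using False by (simp add: d_def)
    have v: "norm v = 1" using d0 by (simp add: v_def)
    have em: "e m \<in> eucl n" using Suc(3) mk by blast
    have axm: "axis_vec m \<in> eucl n" using mk kn by (intro axis_vec_in_eucl) simp
    have de: "d \<in> eucl n"
      unfolding d_def using em axm by (rule real_vector.subspace_diff[OF subspace_eucl])
    have ve: "v \<in> eucl n"
      unfolding v_def by (rule real_vector.subspace_scale[OF subspace_eucl de])
    have vv: "inner v v = 1" using v by (simp add: dot_square_norm)
    have emm: "inner (e m) (e m) = 1" using Suc(4) mk by simp
    have dd: "inner d d = 2 * inner d (e m)"
      using emm by (simp add: d_def inner_diff_left inner_diff_right inner_commute)
    have e'm: "e' m = axis_vec m"
    proof -
      have "2 * inner v (e m) = norm d"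
        using dd d0 by (simp add: v_def dot_square_norm power2_eq_square field_simps)
      then have "e' m = e m - norm d *\<^sub>R v" by (simp add: e'_def)
      also have "\<dots> = e m - d" using d0 by (simp add: v_def)
      finally show ?thesis by (simp add: d_def)
    qed
    have e'j: "e' j = axis_vec j" if "j < m" for j
    proof -
      have "inner d (e j) = inner (e m) (e j) - inner (axis_vec m) (axis_vec j)"
        using Suc(6)[OF that] by (simp only: d_def inner_diff_left)
      also have "\<dots> = 0" using Suc(4)[of m j] that mk by simp
      finally show ?thesis using Suc(6)[OF that] by (simp add: e'_def v_def)
    qed
    have on': "inner (e' i) (e' j) = inner (e i) (e j)" for i j
      using vv by (simp add: e'_def inner_diff_left inner_diff_right inner_commute)
    have "distr (std_gauss n) (Pi\<^sub>M {..<k} (\<lambda>_. borel)) (\<lambda>u. \<lambda>i\<in>{..<k}. inner (e i) (emb n u))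
      = distr (distr (std_gauss n) (Pi\<^sub>M {..<n} (\<lambda>_. borel)) (reflect n v)) (Pi\<^sub>M {..<k} (\<lambda>_. borel))
          (\<lambda>u. \<lambda>i\<in>{..<k}. inner (e i) (emb n u))"
      by (simp only: distr_reflect[OF ve v])
    also have "\<dots> = distr (std_gauss n) (Pi\<^sub>M {..<k} (\<lambda>_. borel))
          ((\<lambda>u. \<lambda>i\<in>{..<k}. inner (e i) (emb n u)) \<circ> reflect n v)"
      by (rule distr_distr) measurable
    also have "(\<lambda>u. \<lambda>i\<in>{..<k}. inner (e i) (emb n u)) \<circ> reflect n v
        = (\<lambda>u. \<lambda>i\<in>{..<k}. inner (e' i) (emb n u))"
      by (intro ext) (simp add: emb_reflect[OF ve] e'_def inner_diff_left inner_diff_right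
          inner_commute[of _ v] o_def restrict_def)
    also have "distr (std_gauss n) (Pi\<^sub>M {..<k} (\<lambda>_. borel)) (\<lambda>u. \<lambda>i\<in>{..<k}. inner (e' i) (emb n u)) = std_gauss k"
    proof (rule Suc(1)[of "Suc m" e'])
      show "r = k - Suc m" "Suc m \<le> k" using Suc(2) by auto
      show "e' j = axis_vec j" if "j < Suc m" for j
        using that e'm e'j by (auto simp: less_Suc_eq)
      show "e' i \<in> eucl n" if "i < k" for i
        unfolding e'_def using Suc(3)[OF that] ve
        by (intro real_vector.subspace_diff[OF subspace_eucl] real_vector.subspace_scale[OF subspace_eucl])
      show "inner (e' i) (e' j) = (if i = j then 1 else 0)" if "i < k" "j < k" for i j
        using Suc(4)[OF that] on' by simp
    qed
    finally show ?thesis .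
  qed
qed

text \<open>The coordinates are indexed by the orthonormal set itself, so that disjoint parts of one
  basis give independent blocks without an enumeration.\<close>

lemma distr_inner_orthonormal:
  assumes "orthonormal D" "D \<subseteq> eucl n"
  shows "distr (std_gauss n) (Pi\<^sub>M D (\<lambda>_. borel)) (\<lambda>u. \<lambda>d\<in>D. inner d (emb n u))
    = Pi\<^sub>M D (\<lambda>_. std_normal_distribution)"
proof -
  have fin: "finite D" using assms orthonormal_eucl by blast
  obtain e where e: "bij_betw e {..<card D} D"
    using ex_bij_betw_nat_finite[OF fin] by (auto simp: atLeast0LessThan)
  define f where "f = the_inv_into {..<card D} e"
  have f: "bij_betw f D {..<card D}"
    unfolding f_def by (rule bij_betw_the_inv_into[OF e])
  have ef: "e (f d) = d" if "d \<in> D" for d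
    unfolding f_def using e that by (intro f_the_inv_into_f_bij_betw) auto
  have eD: "i < card D \<Longrightarrow> e i \<in> D" for i using e by (auto simp: bij_betw_def)
  have on: "inner (e i) (e j) = (if i = j then 1 else 0)" if "i < card D" "j < card D" for i j
    using assms(1) eD[OF that(1)] eD[OF that(2)] bij_betw_imp_inj_on[OF e] that
    by (auto simp: orthonormal_def inj_on_def)
  have fD: "d \<in> D \<Longrightarrow> f d < card D" for d using f by (auto simp: bij_betw_def)
  have law: "distr (std_gauss n) (Pi\<^sub>M {..<card D} (\<lambda>_. borel)) (\<lambda>u. \<lambda>i\<in>{..<card D}. inner (e i) (emb n u))
      = std_gauss (card D)"
    using assms(2) eD on by (intro distr_inner_frame_aux[where m=0]) auto
  have [measurable]: "(\<lambda>z. \<lambda>d\<in>D. z (f d)) \<in> Pi\<^sub>M {..<card D} (\<lambda>_. borel) \<rightarrow>\<^sub>M Pi\<^sub>M D (\<lambda>_. borel :: real measure)"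
    using fD by (intro measurable_restrict measurable_component_singleton) auto
  have "Pi\<^sub>M D (\<lambda>_. std_normal_distribution)
      = distr (std_gauss (card D)) (Pi\<^sub>M D (\<lambda>_. std_normal_distribution)) (\<lambda>z. \<lambda>d\<in>D. z (f d))"
    unfolding std_gauss_def using f prob_space_std_normal
    by (intro distr_PiM_reindex[where M="\<lambda>_. std_normal_distribution", symmetric]) (auto simp: bij_betw_def)
  also have "\<dots> = distr (std_gauss (card D)) (Pi\<^sub>M D (\<lambda>_. borel)) (\<lambda>z. \<lambda>d\<in>D. z (f d))"
    by (intro distr_cong refl sets_PiM_cong) auto
  also have "\<dots> = distr (std_gauss n) (Pi\<^sub>M D (\<lambda>_. borel))
      ((\<lambda>z. \<lambda>d\<in>D. z (f d)) \<circ> (\<lambda>u. \<lambda>i\<in>{..<card D}. inner (e i) (emb n u)))"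
    unfolding law[symmetric] by (rule distr_distr) measurable
  also have "(\<lambda>z. \<lambda>d\<in>D. z (f d)) \<circ> (\<lambda>u. \<lambda>i\<in>{..<card D}. inner (e i) (emb n u))
      = (\<lambda>u. \<lambda>d\<in>D. inner d (emb n u))"
    using ef fD by (auto simp: fun_eq_iff)
  finally show ?thesis ..
qed

section \<open>Gaussian tail bounds\<close>

lemma nn_integral_orthonormal_prod:
  assumes D: "orthonormal D" "D \<subseteq> eucl n"
    and [measurable]: "\<And>d. d \<in> D \<Longrightarrow> \<phi> d \<in> borel_measurable borel"
  shows "(\<integral>\<^sup>+u. (\<Prod>d\<in>D. \<phi> d (inner d (emb n u))) \<partial>std_gauss n)
    = (\<Prod>d\<in>D. \<integral>\<^sup>+z. \<phi> d z \<partial>std_normal_distribution)"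
proof -
  have fin: "finite D" using D orthonormal_eucl by blast
  have P: "product_sigma_finite (\<lambda>_::fvec. std_normal_distribution)"
    unfolding product_sigma_finite_def
    using prob_space_std_normal prob_space.axioms(1) finite_measure.axioms(1) by blast
  have [measurable]: "(\<lambda>z. \<Prod>d\<in>D. \<phi> d (z d)) \<in> borel_measurable (Pi\<^sub>M D (\<lambda>_. borel))"
    by measurable
  have [measurable]: "(\<lambda>u. \<lambda>d\<in>D. inner d (emb n u)) \<in> std_gauss n \<rightarrow>\<^sub>M Pi\<^sub>M D (\<lambda>_. borel)"
    by measurable
  have "(\<integral>\<^sup>+u. (\<Prod>d\<in>D. \<phi> d (inner d (emb n u))) \<partial>std_gauss n)
      = (\<integral>\<^sup>+u. (\<lambda>z. \<Prod>d\<in>D. \<phi> d (z d)) (\<lambda>d\<in>D. inner d (emb n u)) \<partial>std_gauss n)"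
    by (intro nn_integral_cong prod.cong) auto
  also have "\<dots> = (\<integral>\<^sup>+z. (\<Prod>d\<in>D. \<phi> d (z d)) \<partial>Pi\<^sub>M D (\<lambda>_. std_normal_distribution))"
    unfolding distr_inner_orthonormal[OF D, symmetric]
    by (rule nn_integral_distr[symmetric]) measurable
  also have "\<dots> = (\<Prod>d\<in>D. \<integral>\<^sup>+z. \<phi> d z \<partial>std_normal_distribution)"
    by (rule product_sigma_finite.product_nn_integral_prod[OF P fin]) simp
  finally show ?thesis .
qed

text \<open>The tilted density is a multiple of the centred normal density with variance 1/(1 -
  2c).\<close>

lemma nn_integral_exp_square:
  assumes "2 * c < 1"
  shows "(\<integral>\<^sup>+z. ennreal (exp (c * z\<^sup>2)) \<partial>std_normal_distribution) = ennreal (1 / sqrt (1 - 2 * c))"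
proof -
  define s where "s = 1 / sqrt (1 - 2 * c)"
  have s: "s > 0" "s\<^sup>2 = 1 / (1 - 2 * c)" using assms by (auto simp: s_def power_divide)
  have eq: "std_normal_density z * exp (c * z\<^sup>2) = s * normal_density 0 s z" for z
  proof -
    have "sqrt (2 * pi * s\<^sup>2) = sqrt (2 * pi) * s" using s(1) by (simp add: real_sqrt_mult)
    moreover have "- z\<^sup>2 / 2 + c * z\<^sup>2 = - z\<^sup>2 / (2 * s\<^sup>2)"
      using assms unfolding s(2) by (simp add: field_simps)
    ultimately show ?thesis
      using s(1) by (simp add: normal_density_def exp_add[symmetric])
  qed
  have "(\<integral>\<^sup>+z. ennreal (exp (c * z\<^sup>2)) \<partial>std_normal_distribution)
      = (\<integral>\<^sup>+z. ennreal (std_normal_density z * exp (c * z\<^sup>2)) \<partial>lborel)"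
    by (subst nn_integral_density) (auto simp: ennreal_mult intro!: nn_integral_cong)
  also have "\<dots> = (\<integral>\<^sup>+z. ennreal s * ennreal (normal_density 0 s z) \<partial>lborel)"
    unfolding eq using s by (intro nn_integral_cong) (simp add: ennreal_mult)
  also have "\<dots> = ennreal s * (\<integral>\<^sup>+z. ennreal (normal_density 0 s z) \<partial>lborel)"
    by (rule nn_integral_cmult) simp
  also have "(\<integral>\<^sup>+z. ennreal (normal_density 0 s z) \<partial>lborel) = 1"
    using s(1) by (simp add: nn_integral_eq_integral integral_normal_density integrable_normal_density)
  finally show ?thesis by (simp add: s_def)
qed

text \<open>Completing the square: tilting by c z moves the mean to c.\<close>

lemma nn_integral_exp_linear:
  "(\<integral>\<^sup>+z. ennreal (exp (c * z)) \<partial>std_normal_distribution) = ennreal (exp (c\<^sup>2 / 2))"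
proof -
  have eq: "std_normal_density z * exp (c * z) = exp (c\<^sup>2 / 2) * normal_density c 1 z" for z
  proof -
    have "- z\<^sup>2 / 2 + c * z = c\<^sup>2 / 2 - (z - c)\<^sup>2 / 2"
      by (simp add: power2_eq_square field_simps)
    then show ?thesis
      by (simp add: normal_density_def exp_add[symmetric])
  qed
  have "(\<integral>\<^sup>+z. ennreal (exp (c * z)) \<partial>std_normal_distribution)
      = (\<integral>\<^sup>+z. ennreal (std_normal_density z * exp (c * z)) \<partial>lborel)"
    by (subst nn_integral_density) (auto simp: ennreal_mult intro!: nn_integral_cong)
  also have "\<dots> = (\<integral>\<^sup>+z. ennreal (exp (c\<^sup>2 / 2)) * ennreal (normal_density c 1 z) \<partial>lborel)"
    unfolding eq by (intro nn_integral_cong) (simp add: ennreal_mult)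
  also have "\<dots> = ennreal (exp (c\<^sup>2 / 2)) * (\<integral>\<^sup>+z. ennreal (normal_density c 1 z) \<partial>lborel)"
    by (rule nn_integral_cmult) simp
  also have "(\<integral>\<^sup>+z. ennreal (normal_density c 1 z) \<partial>lborel) = 1"
    by (simp add: nn_integral_eq_integral integral_normal_density integrable_normal_density)
  finally show ?thesis by simp
qed

text \<open>Markov's inequality at level 1, since exp (f x) is at least 1 on \<open>S\<close>.
  Chernoff exponents and thresholds are folded into \<open>f\<close>.\<close>

lemma (in prob_space) prob_le_exp:
  assumes [measurable]: "f \<in> borel_measurable M"
    and "(\<integral>\<^sup>+x. ennreal (exp (f x)) \<partial>M) = ennreal B" "0 \<le> B"
    and S: "\<And>x. x \<in> S \<Longrightarrow> x \<in> space M \<and> 0 \<le> f x"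
  shows "prob S \<le> B"
proof -
  have "prob S \<le> prob {x \<in> space M. 0 \<le> f x}"
    using S by (intro finite_measure_mono) auto
  moreover have "emeasure M {x \<in> space M. 0 \<le> f x} = (\<integral>\<^sup>+x. indicator {x \<in> space M. 0 \<le> f x} x \<partial>M)"
    by simp
  moreover have "\<dots> \<le> (\<integral>\<^sup>+x. ennreal (exp (f x)) \<partial>M)"
    by (intro nn_integral_mono) (auto simp: indicator_def)
  ultimately show ?thesis
    using assms(2,3) by (simp add: emeasure_eq_measure)
qed

text \<open>Chernoff bound with exponent 1/4, for which every squared coordinate contributes the
  factor sqrt 2.\<close>

lemma gauss_tail_sum_squares:
  assumes D: "orthonormal D" "D \<subseteq> eucl n"
  shows "measure (std_gauss n) {u \<in> space (std_gauss n). x \<le> (\<Sum>d\<in>D. (inner d (emb n u))\<^sup>2)}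
    \<le> sqrt 2 ^ card D * exp (- x / 4)"
proof -
  interpret prob_space "std_gauss n" by (rule prob_space_std_gauss)
  have fin: "finite D" using D orthonormal_eucl by blast
  have "(\<integral>\<^sup>+u. ennreal (exp (((\<Sum>d\<in>D. (inner d (emb n u))\<^sup>2) - x) / 4)) \<partial>std_gauss n)
      = (\<integral>\<^sup>+u. ennreal (exp (- x / 4)) * (\<Prod>d\<in>D. ennreal (exp (1 / 4 * (inner d (emb n u))\<^sup>2))) \<partial>std_gauss n)"
    using fin by (intro nn_integral_cong)
      (simp add: prod_ennreal ennreal_mult[symmetric] exp_sum[symmetric] exp_add[symmetric]
        sum_divide_distrib[symmetric] diff_divide_distrib)
  also have "\<dots> = ennreal (exp (- x / 4)) * (\<Prod>d\<in>D. \<integral>\<^sup>+z. ennreal (exp (1 / 4 * z\<^sup>2)) \<partial>std_normal_distribution)"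
    by (subst nn_integral_cmult) (simp_all add: nn_integral_orthonormal_prod[OF D, of "\<lambda>_ z. ennreal (exp (1 / 4 * z\<^sup>2))", simplified])
  also have "\<dots> = ennreal (exp (- x / 4)) * (\<Prod>d\<in>D. ennreal (sqrt 2))"
    by (subst nn_integral_exp_square) (simp_all add: real_sqrt_divide real_div_sqrt)
  also have "\<dots> = ennreal (sqrt 2 ^ card D * exp (- x / 4))"
    by (simp add: ennreal_power ennreal_mult[symmetric] mult.commute)
  finally have eq: "(\<integral>\<^sup>+u. ennreal (exp (((\<Sum>d\<in>D. (inner d (emb n u))\<^sup>2) - x) / 4)) \<partial>std_gauss n)
      = ennreal (sqrt 2 ^ card D * exp (- x / 4))" .
  have meas: "(\<lambda>u. ((\<Sum>d\<in>D. (inner d (emb n u))\<^sup>2) - x) / 4) \<in> borel_measurable (std_gauss n)"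
    by measurable
  show ?thesis
    by (rule prob_le_exp[OF meas eq]) simp_all
qed

text \<open>Chernoff bound with the optimal exponent \<open>z\<close>. The strict inequality makes
  the event empty when \<open>v\<close> is 0.\<close>

lemma gauss_tail_inner:
  assumes v: "v \<in> eucl n" and z: "0 < z"
  shows "measure (std_gauss n) {u \<in> space (std_gauss n). inner v (emb n u) < - z * norm v} \<le> exp (- z\<^sup>2 / 2)"
proof (cases "v = 0")
  case False
  interpret prob_space "std_gauss n" by (rule prob_space_std_gauss)
  define w where "w = (1 / norm v) *\<^sub>R v"
  have nw: "norm w = 1" using False by (simp add: w_def)
  have D: "orthonormal {w}" "{w} \<subseteq> eucl n"
    using nw real_vector.subspace_scale[OF subspace_eucl v] by (auto simp: orthonormal_def dot_square_norm w_def)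
  have "(\<integral>\<^sup>+u. ennreal (exp (- z\<^sup>2 + (- z) * inner w (emb n u))) \<partial>std_gauss n)
      = (\<integral>\<^sup>+u. ennreal (exp (- z\<^sup>2)) * (\<Prod>d\<in>{w}. ennreal (exp ((- z) * inner d (emb n u)))) \<partial>std_gauss n)"
    by (intro nn_integral_cong) (simp add: ennreal_mult[symmetric] exp_add[symmetric])
  also have "\<dots> = ennreal (exp (- z\<^sup>2)) * (\<Prod>d\<in>{w}. \<integral>\<^sup>+y. ennreal (exp ((- z) * y)) \<partial>std_normal_distribution)"
    by (subst nn_integral_orthonormal_prod[OF D, symmetric]) (simp_all add: nn_integral_cmult)
  also have "\<dots> = ennreal (exp (- z\<^sup>2) * exp (z\<^sup>2 / 2))"
    unfolding nn_integral_exp_linear by (simp add: ennreal_mult)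
  also have "exp (- z\<^sup>2) * exp (z\<^sup>2 / 2) = exp (- z\<^sup>2 / 2)"
    by (simp add: exp_add[symmetric])
  finally have eq: "(\<integral>\<^sup>+u. ennreal (exp (- z\<^sup>2 + (- z) * inner w (emb n u))) \<partial>std_gauss n) = ennreal (exp (- z\<^sup>2 / 2))" .
  have meas: "(\<lambda>u. - z\<^sup>2 + (- z) * inner w (emb n u)) \<in> borel_measurable (std_gauss n)"
    by measurable
  have "0 \<le> - z\<^sup>2 + (- z) * inner w (emb n u)" if "inner v (emb n u) < - z * norm v" for u
  proof -
    have "inner w (emb n u) < - z"
      using False that by (simp add: w_def divide_less_eq)
    then have "z * (inner w (emb n u) + z) \<le> 0"
      using z by (intro mult_nonneg_nonpos) simp_all
    then show ?thesis by (simp add: power2_eq_square algebra_simps)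
  qed
  then show ?thesis
    by (intro prob_le_exp[OF meas eq]) simp_all
qed simp

text \<open>Chernoff bound with exponent 1/4: the square along \<open>e\<close> contributes sqrt 2,
  each doubled square along \<open>G\<close> contributes 1/sqrt 2. A Gaussian vector is thus rarely
  concentrated on \<open>e\<close>, exponentially in the number of competing directions.\<close>

lemma gauss_small_residual:
  assumes D: "orthonormal (insert e G)" "insert e G \<subseteq> eucl n" "e \<notin> G"
  shows "measure (std_gauss n) {u \<in> space (std_gauss n).
      (inner e (emb n u))\<^sup>2 > 2 * (\<Sum>g\<in>G. (inner g (emb n u))\<^sup>2)} \<le> sqrt 2 * (1 / sqrt 2) ^ card G"
proof -
  interpret prob_space "std_gauss n" by (rule prob_space_std_gauss)
  have fin: "finite G" using orthonormal_eucl(1)[OF D(1,2)] by simp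
  let ?f = "\<lambda>u. ((inner e (emb n u))\<^sup>2 - 2 * (\<Sum>g\<in>G. (inner g (emb n u))\<^sup>2)) / 4"
  define c where "c = (\<lambda>d. if d = e then 1 / 4 else - 1 / 2 :: real)"
  have cG: "(\<Sum>d\<in>insert e G. c d * (h d)\<^sup>2) = ((h e)\<^sup>2 - 2 * (\<Sum>g\<in>G. (h g)\<^sup>2)) / 4" for h :: "fvec \<Rightarrow> real"
  proof -
    have "(\<Sum>g\<in>G. c g * (h g)\<^sup>2) = (\<Sum>g\<in>G. (- 1 / 2) * (h g)\<^sup>2)"
      using D(3) by (intro sum.cong) (auto simp: c_def)
    also have "\<dots> = (- 1 / 2) * (\<Sum>g\<in>G. (h g)\<^sup>2)"
      by (rule sum_distrib_left[symmetric])
    finally have "(\<Sum>d\<in>insert e G. c d * (h d)\<^sup>2) = c e * (h e)\<^sup>2 + (- 1 / 2) * (\<Sum>g\<in>G. (h g)\<^sup>2)"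
      by (simp only: sum.insert[OF fin D(3)])
    moreover have "c e = 1 / 4" by (simp add: c_def)
    ultimately show ?thesis by (simp only: diff_divide_distrib)
  qed
  have "(\<integral>\<^sup>+u. ennreal (exp (?f u)) \<partial>std_gauss n)
      = (\<integral>\<^sup>+u. (\<Prod>d\<in>insert e G. ennreal (exp (c d * (inner d (emb n u))\<^sup>2))) \<partial>std_gauss n)"
  proof (intro nn_integral_cong)
    fix u
    have "exp (?f u) = (\<Prod>d\<in>insert e G. exp (c d * (inner d (emb n u))\<^sup>2))"
      unfolding cG[of "\<lambda>d. inner d (emb n u)", symmetric] using fin by (intro exp_sum finite.insertI)
    then show "ennreal (exp (?f u)) = (\<Prod>d\<in>insert e G. ennreal (exp (c d * (inner d (emb n u))\<^sup>2)))"
      by (simp only: prod_ennreal exp_ge_zero)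
  qed
  also have "\<dots> = (\<Prod>d\<in>insert e G. \<integral>\<^sup>+z. ennreal (exp (c d * z\<^sup>2)) \<partial>std_normal_distribution)"
    by (rule nn_integral_orthonormal_prod[OF D(1,2)]) measurable
  also have "\<dots> = (\<Prod>d\<in>insert e G. ennreal (if d = e then sqrt 2 else 1 / sqrt 2))"
  proof (intro prod.cong refl)
    fix d
    have "2 * c d < 1" by (simp add: c_def)
    from nn_integral_exp_square[OF this]
    show "(\<integral>\<^sup>+z. ennreal (exp (c d * z\<^sup>2)) \<partial>std_normal_distribution) = ennreal (if d = e then sqrt 2 else 1 / sqrt 2)"
      by (simp add: c_def real_sqrt_divide split: if_splits)
  qed
  also have "\<dots> = ennreal (sqrt 2) * (\<Prod>d\<in>G. ennreal (1 / sqrt 2))"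
  proof -
    have "(\<Prod>d\<in>G. ennreal (if d = e then sqrt 2 else 1 / sqrt 2)) = (\<Prod>d\<in>G. ennreal (1 / sqrt 2))"
      using D(3) by (intro prod.cong) auto
    then show ?thesis using D(3) fin by (subst prod.insert) simp_all
  qed
  also have "\<dots> = ennreal (sqrt 2 * (1 / sqrt 2) ^ card G)"
    by (simp add: ennreal_power ennreal_mult)
  finally have eq: "(\<integral>\<^sup>+u. ennreal (exp (?f u)) \<partial>std_gauss n) = ennreal (sqrt 2 * (1 / sqrt 2) ^ card G)" .
  have meas: "(?f) \<in> borel_measurable (std_gauss n)"
    by measurable
  show ?thesis
    by (rule prob_le_exp[OF meas eq]) simp_all
qed

section \<open>Matrices and models in terms of finitely supported sequences\<close>

lemma span_image_eq:
  fixes f :: "'i \<Rightarrow> 'a::real_vector"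
  assumes "finite I"
  shows "span (f ` I) = range (\<lambda>c. \<Sum>i\<in>I. c i *\<^sub>R f i)"
proof (rule subset_antisym)
  show "range (\<lambda>c. \<Sum>i\<in>I. c i *\<^sub>R f i) \<subseteq> span (f ` I)"
    by (auto intro!: span_sum span_scale intro: span_base)
  show "span (f ` I) \<subseteq> range (\<lambda>c. \<Sum>i\<in>I. c i *\<^sub>R f i)"
  proof (rule span_minimal)
    show "f ` I \<subseteq> range (\<lambda>c. \<Sum>i\<in>I. c i *\<^sub>R f i)"
    proof
      fix y assume "y \<in> f ` I"
      then obtain j where j: "j \<in> I" "y = f j" by blast
      have "y = (\<Sum>i\<in>I. (if i = j then 1 else 0) *\<^sub>R f i)"
        using assms j by (simp add: if_distrib[of "\<lambda>c. c *\<^sub>R f _"] cong: if_cong)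
      then show "y \<in> range (\<lambda>c. \<Sum>i\<in>I. c i *\<^sub>R f i)"
        by (rule range_eqI[of _ _ "\<lambda>i. if i = j then 1 else 0"])
    qed
    show "Real_Vector_Spaces.subspace (range (\<lambda>c. \<Sum>i\<in>I. c i *\<^sub>R f i))"
    proof (rule real_vector.subspaceI)
      show "0 \<in> range (\<lambda>c. \<Sum>i\<in>I. c i *\<^sub>R f i)"
        by (rule range_eqI[of _ _ "\<lambda>_. 0"]) simp
    next
      fix x y assume "x \<in> range (\<lambda>c. \<Sum>i\<in>I. c i *\<^sub>R f i)" "y \<in> range (\<lambda>c. \<Sum>i\<in>I. c i *\<^sub>R f i)"
      then obtain c d where "x = (\<Sum>i\<in>I. c i *\<^sub>R f i)" "y = (\<Sum>i\<in>I. d i *\<^sub>R f i)" by blast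
      then have "x + y = (\<Sum>i\<in>I. (c i + d i) *\<^sub>R f i)"
        by (simp add: sum.distrib scaleR_add_left)
      then show "x + y \<in> range (\<lambda>c. \<Sum>i\<in>I. c i *\<^sub>R f i)"
        by (rule range_eqI[of _ _ "\<lambda>i. c i + d i"])
    next
      fix a x assume "x \<in> range (\<lambda>c. \<Sum>i\<in>I. c i *\<^sub>R f i)"
      then obtain c where "x = (\<Sum>i\<in>I. c i *\<^sub>R f i)" by blast
      then have "a *\<^sub>R x = (\<Sum>i\<in>I. (a * c i) *\<^sub>R f i)"
        by (simp add: scaleR_sum_right)
      then show "a *\<^sub>R x \<in> range (\<lambda>c. \<Sum>i\<in>I. c i *\<^sub>R f i)"
        by (rule range_eqI[of _ _ "\<lambda>i. a * c i"])
    qed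
  qed
qed

section \<open>Translation of vectors and matrix columns\<close>

definition of_vec :: "real vec \<Rightarrow> fvec" where
  "of_vec v = emb (dim_vec v) (\<lambda>i. v $ i)"

lemma of_vec_in_eucl: "v \<in> carrier_vec n \<Longrightarrow> of_vec v \<in> eucl n"
  by (auto simp: of_vec_def)

lemma of_vec_vec [simp]: "of_vec (vec n u) = emb n u"
  by (rule fvec_eqI) (simp add: of_vec_def)

lemma coord_of_vec: "coord (of_vec v) i = (if i < dim_vec v then v $ i else 0)"
  by (simp add: of_vec_def)

lemma of_vec_inj:
  assumes "v \<in> carrier_vec n" "w \<in> carrier_vec n" "of_vec v = of_vec w"
  shows "v = w"
proof (rule eq_vecI)
  show "dim_vec v = dim_vec w" using assms by simp
  fix i assume "i < dim_vec w"
  then show "v $ i = w $ i"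
    using assms(1,2) arg_cong[OF assms(3), of "\<lambda>x. coord x i"] by (simp add: coord_of_vec)
qed

lemma of_vec_add:
  "v \<in> carrier_vec n \<Longrightarrow> w \<in> carrier_vec n \<Longrightarrow> of_vec (v + w) = of_vec v + of_vec w"
  by (rule fvec_eqI) (auto simp: coord_of_vec)

lemma of_vec_minus:
  "v \<in> carrier_vec n \<Longrightarrow> w \<in> carrier_vec n \<Longrightarrow> of_vec (v - w) = of_vec v - of_vec w"
  by (rule fvec_eqI) (auto simp: coord_of_vec)

lemma of_vec_smult: "of_vec (a \<cdot>\<^sub>v v) = a *\<^sub>R of_vec v"
  by (rule fvec_eqI) (auto simp: coord_of_vec)

lemma inner_of_vec:
  assumes "v \<in> carrier_vec n" "w \<in> carrier_vec n"
  shows "inner (of_vec v) (of_vec w) = scalar_prod v w"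
  using assms
  by (subst inner_eucl[OF of_vec_in_eucl[OF assms(1)]])
    (simp add: scalar_prod_def coord_of_vec atLeast0LessThan)

lemma sq_norm2_of_vec: "sq_norm2 v = (norm (of_vec v))\<^sup>2"
  unfolding sq_norm2_def power2_norm_eq_inner
  by (rule inner_of_vec[of v "dim_vec v", symmetric]; rule carrier_vecI; rule refl)

lemma of_vec_mult:
  assumes A: "A \<in> carrier_mat n k" and b: "b \<in> carrier_vec k"
  shows "of_vec (A *\<^sub>v b) = (\<Sum>j<k. b $ j *\<^sub>R of_vec (col A j))"
proof (rule fvec_eqI)
  fix i
  show "coord (of_vec (A *\<^sub>v b)) i = coord (\<Sum>j<k. b $ j *\<^sub>R of_vec (col A j)) i"
    using A b
    by (cases "i < n")
      (auto simp: coord_of_vec scalar_prod_def atLeast0LessThan mult.commute intro!: sum.cong)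
qed

definition xcol :: "real mat \<Rightarrow> nat \<Rightarrow> fvec" where
  "xcol X j = of_vec (col X j)"

lemma xcol_in_eucl: "X \<in> carrier_mat n p \<Longrightarrow> xcol X j \<in> eucl n"
  unfolding xcol_def by (intro of_vec_in_eucl) auto

lemma span_xcol_eucl: "X \<in> carrier_mat n p \<Longrightarrow> span (xcol X ` \<tau>) \<subseteq> eucl n"
  by (intro span_subset_eucl) (auto intro: xcol_in_eucl)

lemma of_vec_range_mult:
  assumes A: "A \<in> carrier_mat n k"
  shows "(\<lambda>b. of_vec (A *\<^sub>v b)) ` carrier_vec k = span (xcol A ` {..<k})"
proof -
  have "(\<lambda>b. of_vec (A *\<^sub>v b)) ` carrier_vec k = (\<lambda>b. \<Sum>j<k. b $ j *\<^sub>R xcol A j) ` carrier_vec k"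
    unfolding xcol_def using of_vec_mult[OF A] by (intro image_cong) auto
  also have "\<dots> = range (\<lambda>c. \<Sum>j<k. c j *\<^sub>R xcol A j)"
  proof (intro subset_antisym subsetI)
    fix x assume "x \<in> range (\<lambda>c. \<Sum>j<k. c j *\<^sub>R xcol A j)"
    then obtain c where "x = (\<Sum>j<k. c j *\<^sub>R xcol A j)" by blast
    then have "x = (\<Sum>j<k. vec k c $ j *\<^sub>R xcol A j)" by simp
    then show "x \<in> (\<lambda>b. \<Sum>j<k. b $ j *\<^sub>R xcol A j) ` carrier_vec k"
      by (rule image_eqI) simp
  next
    fix x assume "x \<in> (\<lambda>b. \<Sum>j<k. b $ j *\<^sub>R xcol A j) ` carrier_vec k"
    then obtain b :: "real vec" where "x = (\<Sum>j<k. b $ j *\<^sub>R xcol A j)" by (rule imageE)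
    then show "x \<in> range (\<lambda>c. \<Sum>j<k. c j *\<^sub>R xcol A j)"
      by (rule range_eqI[of _ _ "\<lambda>j. b $ j"])
  qed
  finally show ?thesis by (simp add: span_image_eq)
qed

lemma of_vec_col_space:
  assumes A: "A \<in> carrier_mat n k"
  shows "of_vec ` vec_space.col_space n A = span (xcol A ` {..<k})"
proof -
  have "vec_space.col_space n A = (\<lambda>b. A *\<^sub>v b) ` carrier_vec k"
  proof (intro subset_antisym subsetI)
    fix x assume "x \<in> vec_space.col_space n A"
    then obtain b where "b \<in> carrier_vec (dim_col A)" "A *\<^sub>v b = x"
      unfolding vec_space.col_space_eq[OF A] by blast
    then show "x \<in> (\<lambda>b. A *\<^sub>v b) ` carrier_vec k" using A by auto
  next
    fix x assume "x \<in> (\<lambda>b. A *\<^sub>v b) ` carrier_vec k"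
    then obtain b where "x = A *\<^sub>v b" "b \<in> carrier_vec k" by (rule imageE)
    then show "x \<in> vec_space.col_space n A"
      unfolding vec_space.col_space_eq[OF A] using A by auto
  qed
  then have "of_vec ` vec_space.col_space n A = (\<lambda>b. of_vec (A *\<^sub>v b)) ` carrier_vec k"
    by (simp only: image_image)
  then show ?thesis
    unfolding of_vec_range_mult[OF A] .
qed

lemma col_space_carrier:
  assumes "(A :: real mat) \<in> carrier_mat n k"
  shows "vec_space.col_space n A \<subseteq> carrier_vec n"
  unfolding vec_space.col_space_eq[OF assms] using assms by blast

lemma bij_betw_pick:
  assumes "finite \<tau>"
  shows "bij_betw (pick \<tau>) {..<card \<tau>} \<tau>"
proof -
  have inj: "inj_on (pick \<tau>) {..<card \<tau>}"
  proof (rule inj_onI)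
    fix i j assume ij: "i \<in> {..<card \<tau>}" "j \<in> {..<card \<tau>}" "pick \<tau> i = pick \<tau> j"
    have "card {a \<in> \<tau>. a < pick \<tau> i} = i" "card {a \<in> \<tau>. a < pick \<tau> j} = j"
      using ij(1,2) by (simp_all add: card_pick_le)
    then show "i = j" using ij(3) by metis
  qed
  have sub: "pick \<tau> ` {..<card \<tau>} \<subseteq> \<tau>"
    by (rule image_subsetI) (simp add: pick_in_set_le)
  have "pick \<tau> ` {..<card \<tau>} = \<tau>"
    by (rule card_subset_eq[OF assms sub]) (simp add: card_image[OF inj])
  with inj show ?thesis by (rule bij_betw_imageI)
qed

section \<open>Columns and coefficients indexed by a model\<close>

context
  fixes X :: "real mat" and n p :: nat and \<tau> :: "nat set"
  assumes X: "X \<in> carrier_mat n p" and \<tau>: "\<tau> \<subseteq> {..<p}"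
begin

lemma cols_set: "{j. j < dim_col X \<and> j \<in> \<tau>} = \<tau>" "{i. i < dim_row X \<and> i \<in> UNIV} = {..<n}"
  using X \<tau> by auto

lemma finite_model: "finite \<tau>"
  by (rule finite_subset[OF \<tau>]) simp

lemma cols_at_carrier: "cols_at X \<tau> \<in> carrier_mat n (card \<tau>)"
  unfolding cols_at_def by (rule carrier_matI) (simp_all only: dim_submatrix cols_set card_lessThan)

lemma xcol_cols_at:
  assumes "k < card \<tau>"
  shows "xcol (cols_at X \<tau>) k = xcol X (pick \<tau> k)"
proof (rule fvec_eqI)
  fix i
  have "pick \<tau> k < p" using pick_in_set[OF disjI1[OF assms]] \<tau> by auto
  then show "coord (xcol (cols_at X \<tau>) k) i = coord (xcol X (pick \<tau> k)) i"
  proof (cases "i < n")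
    case True
    have "cols_at X \<tau> $$ (i, k) = X $$ (pick UNIV i, pick \<tau> k)"
      unfolding cols_at_def by (rule submatrix_index) (simp_all only: cols_set card_lessThan True assms)
    then show ?thesis
      using True assms X cols_at_carrier \<open>pick \<tau> k < p\<close>
      by (simp add: xcol_def coord_of_vec pick_UNIV)
  next
    case False
    then show ?thesis
      using X cols_at_carrier by (simp add: xcol_def coord_of_vec)
  qed
qed

lemma xcol_image_cols_at: "xcol (cols_at X \<tau>) ` {..<card \<tau>} = xcol X ` \<tau>"
proof -
  have "xcol (cols_at X \<tau>) ` {..<card \<tau>} = xcol X ` pick \<tau> ` {..<card \<tau>}"
    unfolding image_image using xcol_cols_at by (intro image_cong) auto
  then show ?thesis
    using bij_betw_pick[OF finite_model] by (simp add: bij_betw_def)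
qed

text \<open>Replaces positions in the coefficient vector by column indices, so that coefficient
  vectors of different index sets can be compared term by term.\<close>

lemma of_vec_cols_at:
  assumes "b \<in> carrier_vec (card \<tau>)"
  shows "of_vec (cols_at X \<tau> *\<^sub>v b) = (\<Sum>j\<in>\<tau>. entry_at \<tau> b j *\<^sub>R xcol X j)"
proof -
  have "of_vec (cols_at X \<tau> *\<^sub>v b) = (\<Sum>k<card \<tau>. b $ k *\<^sub>R xcol X (pick \<tau> k))"
    using of_vec_mult[OF cols_at_carrier assms] xcol_cols_at by (simp add: xcol_def)
  also have "\<dots> = (\<Sum>k<card \<tau>. entry_at \<tau> b (pick \<tau> k) *\<^sub>R xcol X (pick \<tau> k))"
    unfolding entry_at_def using card_pick[of _ \<tau>] by (intro sum.cong refl) simp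
  also have "\<dots> = (\<Sum>j\<in>\<tau>. entry_at \<tau> b j *\<^sub>R xcol X j)"
    using bij_betw_pick[OF finite_model] by (rule sum.reindex_bij_betw)
  finally show ?thesis .
qed

lemma cols_at_in_span: "b \<in> carrier_vec (card \<tau>) \<Longrightarrow> of_vec (cols_at X \<tau> *\<^sub>v b) \<in> span (xcol X ` \<tau>)"
  unfolding xcol_image_cols_at[symmetric] of_vec_range_mult[OF cols_at_carrier, symmetric] by (rule imageI)

lemma span_cols_at:
  assumes "v \<in> span (xcol X ` \<tau>)"
  obtains b where "b \<in> carrier_vec (card \<tau>)" "of_vec (cols_at X \<tau> *\<^sub>v b) = v"
proof -
  have "v \<in> (\<lambda>b. of_vec (cols_at X \<tau> *\<^sub>v b)) ` carrier_vec (card \<tau>)"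
    unfolding of_vec_range_mult[OF cols_at_carrier] xcol_image_cols_at by (rule assms)
  then obtain b where "b \<in> carrier_vec (card \<tau>)" "v = of_vec (cols_at X \<tau> *\<^sub>v b)"
    by (rule imageE)
  then show thesis by (intro that) simp_all
qed

lemma sq_norm2_fit:
  assumes y: "y \<in> carrier_vec n" and b: "b \<in> carrier_vec (card \<tau>)" and u: "u \<in> carrier_vec n"
  shows "sq_norm2 (y - cols_at X \<tau> *\<^sub>v b) = (norm (of_vec y - of_vec (cols_at X \<tau> *\<^sub>v b)))\<^sup>2"
    "sq_norm2 (y - cols_at X \<tau> *\<^sub>v b - s \<cdot>\<^sub>v u)
      = (norm (of_vec y - (of_vec (cols_at X \<tau> *\<^sub>v b) + s *\<^sub>R of_vec u)))\<^sup>2"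
proof -
  have c: "cols_at X \<tau> *\<^sub>v b \<in> carrier_vec n" using cols_at_carrier b by auto
  then show "sq_norm2 (y - cols_at X \<tau> *\<^sub>v b) = (norm (of_vec y - of_vec (cols_at X \<tau> *\<^sub>v b)))\<^sup>2"
    by (simp add: sq_norm2_of_vec of_vec_minus[OF y c])
  have "of_vec (y - cols_at X \<tau> *\<^sub>v b - s \<cdot>\<^sub>v u) = of_vec y - of_vec (cols_at X \<tau> *\<^sub>v b) - s *\<^sub>R of_vec u"
    using y c u by (simp add: of_vec_minus[of _ n] of_vec_smult)
  then show "sq_norm2 (y - cols_at X \<tau> *\<^sub>v b - s \<cdot>\<^sub>v u)
      = (norm (of_vec y - (of_vec (cols_at X \<tau> *\<^sub>v b) + s *\<^sub>R of_vec u)))\<^sup>2"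
    by (simp only: sq_norm2_of_vec diff_diff_eq)
qed

text \<open>Minimising over the coefficients and the scale together is one least squares problem on
  the span of the model's columns and the artificial noise.\<close>

lemma repro_crit_eq:
  assumes y: "y \<in> carrier_vec n" and u: "u \<in> carrier_vec n"
    and C: "orthonormal C" "finite C" "span C = span (insert (of_vec u) (xcol X ` \<tau>))"
  shows "repro_crit X lam y u \<tau> = (norm (of_vec y - oproj C (of_vec y)))\<^sup>2 + lam * real (card \<tau>)"
proof -
  let ?g = "\<lambda>(b, s). sq_norm2 (y - cols_at X \<tau> *\<^sub>v b - s \<cdot>\<^sub>v u) + lam * real (card \<tau>)"
  let ?S = "carrier_vec (card \<tau>) \<times> (UNIV :: real set)"
  let ?m = "(norm (of_vec y - oproj C (of_vec y)))\<^sup>2 + lam * real (card \<tau>)"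
  have "Inf (?g ` ?S) = ?m"
  proof (rule cInf_eq_minimum)
    have "oproj C (of_vec y) \<in> span (insert (of_vec u) (xcol X ` \<tau>))"
      using oproj_in_span[of C] C(3) by simp
    then obtain s where "oproj C (of_vec y) - s *\<^sub>R of_vec u \<in> span (xcol X ` \<tau>)"
      by (auto simp: real_vector.span_insert)
    then obtain b where b: "b \<in> carrier_vec (card \<tau>)"
      "of_vec (cols_at X \<tau> *\<^sub>v b) = oproj C (of_vec y) - s *\<^sub>R of_vec u"
      by (rule span_cols_at)
    have "?g (b, s) = ?m"
      using sq_norm2_fit(2)[OF y b(1) u, of s] by (simp add: b(2))
    then show "?m \<in> ?g ` ?S"
      using b(1) by (intro image_eqI[of _ _ "(b, s)"]) auto
  next
    fix z assume "z \<in> ?g ` ?S"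
    then obtain b s where b: "b \<in> carrier_vec (card \<tau>)" and z: "z = ?g (b, s)" by auto
    let ?v = "of_vec (cols_at X \<tau> *\<^sub>v b) + s *\<^sub>R of_vec u"
    have "of_vec (cols_at X \<tau> *\<^sub>v b) \<in> span (insert (of_vec u) (xcol X ` \<tau>))"
      using cols_at_in_span[OF b] span_mono[of "xcol X ` \<tau>" "insert (of_vec u) (xcol X ` \<tau>)"] by blast
    then have "?v \<in> span C"
      unfolding C(3) by (rule span_add) (intro span_scale span_base insertI1)
    from norm_diff_span[OF C(1,2) this, of "of_vec y"]
    show "?m \<le> z"
      using sq_norm2_fit(2)[OF y b u, of s] by (simp add: z)
  qed
  then show ?thesis
    by (simp add: repro_crit_def)
qed

text \<open>The basis in \<open>repro_crit_eq\<close> moves with \<open>u\<close>. Here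
  \<open>C\<close> depends on the model only, and the noise enters through its residual
  \<open>w\<close>; this explicit expression is what makes the criterion measurable.\<close>

lemma repro_crit_formula:
  assumes y: "y \<in> carrier_vec n" and u: "u \<in> carrier_vec n"
    and C: "orthonormal C" "finite C" "span C = span (xcol X ` \<tau>)"
    and w: "w = of_vec u - oproj C (of_vec u)"
  shows "repro_crit X lam y u \<tau> = inner (of_vec y) (of_vec y) - (\<Sum>c\<in>C. (inner c (of_vec y))\<^sup>2)
    - (inner w (of_vec y))\<^sup>2 / inner w w + lam * real (card \<tau>)"
proof -
  have "span (insert (of_vec u) (xcol X ` \<tau>)) = span (insert (of_vec u) C)"
    by (simp only: real_vector.span_insert C(3))
  also have "\<dots> = span (insert w C)"
    by (rule real_vector.eq_span_insert_eq) (simp add: w oproj_in_span)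
  finally have sp: "span (insert (of_vec u) (xcol X ` \<tau>)) = span (insert w C)" .
  show ?thesis
  proof (cases "w = 0")
    \<comment> \<open>If the noise already lies in the span of the model, the correction term is
      0/0, whose value 0 is the right one.\<close>
    case True
    have "span C = span (insert (of_vec u) (xcol X ` \<tau>))"
      unfolding sp True by (rule real_vector.span_insert_0[symmetric])
    from repro_crit_eq[OF y u C(1,2) this] show ?thesis
      using norm_residual_sq[OF C(1,2), of "of_vec y"] True by simp
  next
    case False
    define e where "e = (1 / norm w) *\<^sub>R w"
    have nw: "norm w \<noteq> 0" using False by simp
    have wC: "inner w c = 0" if "c \<in> C" for c
      unfolding w using oproj_residual[OF C(1,2) span_base[OF that]] .
    have "norm e = 1" using nw by (simp add: e_def)
    then have ee: "inner e e = 1" by (simp add: dot_square_norm)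
    have eC: "e \<notin> C"
    proof
      assume "e \<in> C"
      from wC[OF this] have "inner e e = 0" by (simp add: e_def)
      then show False using ee by simp
    qed
    have ec: "inner e c = 0" "inner c e = 0" if "c \<in> C" for c
      using wC[OF that] by (simp_all add: e_def inner_commute[of c])
    have on: "orthonormal (insert e C)"
      unfolding orthonormal_def
    proof (intro ballI)
      fix a b assume ab: "a \<in> insert e C" "b \<in> insert e C"
      show "inner a b = (if a = b then 1 else 0)"
      proof (cases "a = e"; cases "b = e")
        assume "a \<noteq> e" "b \<noteq> e"
        then show ?thesis using ab C(1) by (simp add: orthonormal_def)
      qed (use ab ee ec in auto)
    qed
    have "span (insert e C) = span (insert w C)"
    proof (intro subset_antisym real_vector.span_minimal)
      have w1: "w \<in> span (insert w C)" and e1: "e \<in> span (insert e C)"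
        by (simp_all add: span_base)
      have "e \<in> span (insert w C)" unfolding e_def using w1 by (rule span_scale)
      then show "insert e C \<subseteq> span (insert w C)" by (auto intro: span_base)
      have "w = norm w *\<^sub>R e" using nw by (simp add: e_def)
      then have "w \<in> span (insert e C)" using e1 span_scale by metis
      then show "insert w C \<subseteq> span (insert e C)" by (auto intro: span_base)
    qed simp_all
    then have sp': "span (insert e C) = span (insert (of_vec u) (xcol X ` \<tau>))" by (simp only: sp)
    have "(inner e (of_vec y))\<^sup>2 = (inner w (of_vec y))\<^sup>2 / inner w w"
      by (simp add: e_def power_divide power2_norm_eq_inner)
    then show ?thesis
      using repro_crit_eq[OF y u on finite.insertI[OF C(2)] sp'] eC C(2)
        norm_residual_sq[OF on finite.insertI[OF C(2)], of "of_vec y"] by simp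
  qed
qed

end

text \<open>Turns the nested minimum into a lower bound on the distance to every point of the
  competitor's span, the form in which separation is used.\<close>

lemma C_min_le:
  assumes X: "X \<in> carrier_mat n p" and \<tau>\<^sub>0: "\<tau>\<^sub>0 \<subseteq> {..<p}" "\<beta>\<^sub>0 \<in> carrier_vec (card \<tau>\<^sub>0)"
    and \<tau>: "\<tau> \<subseteq> {..<p}" "\<tau> \<noteq> \<tau>\<^sub>0" "card \<tau> \<le> card \<tau>\<^sub>0" and n: "1 \<le> n"
    and v: "v \<in> span (xcol X ` \<tau>)"
  shows "C_min X \<tau>\<^sub>0 \<beta>\<^sub>0 * (real n * real (max (card (\<tau>\<^sub>0 - \<tau>)) 1))
    \<le> (norm (of_vec (cols_at X \<tau>\<^sub>0 *\<^sub>v \<beta>\<^sub>0) - v))\<^sup>2"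
proof -
  let ?y = "cols_at X \<tau>\<^sub>0 *\<^sub>v \<beta>\<^sub>0"
  let ?g = "\<lambda>\<tau> b. sq_norm2 (?y - cols_at X \<tau> *\<^sub>v b) / (real n * real (max (card (\<tau>\<^sub>0 - \<tau>)) 1))"
  have dims: "dim_row X = n" "dim_col X = p" using X by simp_all
  have y: "?y \<in> carrier_vec n" using cols_at_carrier[OF X \<tau>\<^sub>0(1)] \<tau>\<^sub>0(2) by simp
  obtain b where b: "b \<in> carrier_vec (card \<tau>)" "of_vec (cols_at X \<tau> *\<^sub>v b) = v"
    using span_cols_at[OF X \<tau>(1) v] .
  have "C_min X \<tau>\<^sub>0 \<beta>\<^sub>0 \<le> (INF b \<in> carrier_vec (card \<tau>). ?g \<tau> b)"
    unfolding C_min_def dims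
  proof (rule Min_le)
    have "finite (Pow {..<p})" by simp
    then have "finite {\<tau>. \<tau> \<subseteq> {..<p} \<and> \<tau> \<noteq> \<tau>\<^sub>0 \<and> card \<tau> \<le> card \<tau>\<^sub>0}"
      by (rule rev_finite_subset) auto
    then show "finite ((\<lambda>\<tau>. INF b\<in>carrier_vec (card \<tau>). ?g \<tau> b)
        ` {\<tau>. \<tau> \<subseteq> {..<p} \<and> \<tau> \<noteq> \<tau>\<^sub>0 \<and> card \<tau> \<le> card \<tau>\<^sub>0})"
      by (rule finite_imageI)
    show "(INF b\<in>carrier_vec (card \<tau>). ?g \<tau> b) \<in> (\<lambda>\<tau>. INF b\<in>carrier_vec (card \<tau>). ?g \<tau> b)
        ` {\<tau>. \<tau> \<subseteq> {..<p} \<and> \<tau> \<noteq> \<tau>\<^sub>0 \<and> card \<tau> \<le> card \<tau>\<^sub>0}"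
      using \<tau> by (intro imageI) simp
  qed
  also have "\<dots> \<le> ?g \<tau> b"
  proof (rule cINF_lower[OF _ b(1)])
    show "bdd_below (?g \<tau> ` carrier_vec (card \<tau>))"
      by (rule bdd_belowI[of _ 0]) (auto simp: sq_norm2_of_vec)
  qed
  finally have "C_min X \<tau>\<^sub>0 \<beta>\<^sub>0 * (real n * real (max (card (\<tau>\<^sub>0 - \<tau>)) 1)) \<le> sq_norm2 (?y - cols_at X \<tau> *\<^sub>v b)"
    using n by (subst (asm) pos_le_divide_eq) simp_all
  then show ?thesis
    using sq_norm2_fit(1)[OF X \<tau>(1) y b(1) y] by (simp add: b(2))
qed

text \<open>The sum of the outer products of the vectors of \<open>C\<close> has the defining
  property. Any other such matrix acts in the same way by \<open>oproj_eqI\<close>, and the unit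
  vectors recover its entries, so the definite description is met.\<close>

lemma orth_proj_oproj:
  assumes V: "V \<subseteq> carrier_vec n" "of_vec ` V = span C" and C: "orthonormal C" "finite C"
  shows "orth_proj n V \<in> carrier_mat n n"
    and "y \<in> carrier_vec n \<Longrightarrow> of_vec (orth_proj n V *\<^sub>v y) = oproj C (of_vec y)"
proof -
  define P where "P = mat n n (\<lambda>(i, j). \<Sum>c\<in>C. coord c i * coord c j)"
  have P: "P \<in> carrier_mat n n" by (simp add: P_def)
  have CV: "c \<in> of_vec ` V" if "c \<in> C" for c
    unfolding V(2) using that by (rule span_base)
  have C_eucl: "c \<in> eucl n" if "c \<in> C" for c
  proof -
    obtain v where "c = of_vec v" "v \<in> V" using CV[OF \<open>c \<in> C\<close>] by (rule imageE)
    then show ?thesis using V(1) of_vec_in_eucl[of v n] by blast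
  qed
  have Py: "of_vec (P *\<^sub>v y) = oproj C (of_vec y)" if y: "y \<in> carrier_vec n" for y
  proof (rule fvec_eqI)
    fix i
    show "coord (of_vec (P *\<^sub>v y)) i = coord (oproj C (of_vec y)) i"
    proof (cases "i < n")
      case True
      have "coord (of_vec (P *\<^sub>v y)) i = (\<Sum>j<n. (\<Sum>c\<in>C. coord c i * coord c j) * y $ j)"
        using True y by (simp add: coord_of_vec P_def scalar_prod_def atLeast0LessThan)
      also have "\<dots> = (\<Sum>c\<in>C. \<Sum>j<n. coord c j * y $ j * coord c i)"
        unfolding sum_distrib_right by (subst sum.swap) (simp add: mult_ac)
      also have "\<dots> = (\<Sum>c\<in>C. inner c (of_vec y) * coord c i)"
      proof (intro sum.cong refl)
        fix c
        have "inner c (of_vec y) = (\<Sum>j<n. coord c j * y $ j)"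
          unfolding of_vec_def inner_emb_right using y by simp
        then show "(\<Sum>j<n. coord c j * y $ j * coord c i) = inner c (of_vec y) * coord c i"
          by (simp add: sum_distrib_right)
      qed
      finally show ?thesis by (simp add: oproj_def)
    next
      case False
      then have "coord c i = 0" if "c \<in> C" for c using C_eucl[OF that] by (simp add: eucl_def)
      then show ?thesis using False P by (simp add: coord_of_vec oproj_def)
    qed
  qed
  let ?Q = "\<lambda>P. P \<in> carrier_mat n n \<and>
     (\<forall>y \<in> carrier_vec n. P *\<^sub>v y \<in> V \<and> (\<forall>v \<in> V. scalar_prod (y - P *\<^sub>v y) v = 0))"
  have QP: "?Q P"
  proof (intro conjI ballI P)
    fix y :: "real vec" assume y: "y \<in> carrier_vec n"
    have Pc: "P *\<^sub>v y \<in> carrier_vec n" using P y by simp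
    have "of_vec (P *\<^sub>v y) \<in> of_vec ` V"
      unfolding V(2) Py[OF y] by (rule oproj_in_span)
    then obtain v where v: "of_vec (P *\<^sub>v y) = of_vec v" "v \<in> V" by (rule imageE)
    then show "P *\<^sub>v y \<in> V"
      using of_vec_inj[OF Pc _ v(1)] V(1) by auto
    fix v assume v: "v \<in> V"
    then have vc: "v \<in> carrier_vec n" using V(1) by blast
    have "of_vec v \<in> span C" unfolding V(2)[symmetric] using v by (rule imageI)
    from oproj_residual[OF C this, of "of_vec y"]
    have "inner (of_vec (y - P *\<^sub>v y)) (of_vec v) = 0"
      by (simp only: of_vec_minus[OF y Pc] Py[OF y])
    then show "scalar_prod (y - P *\<^sub>v y) v = 0"
      using inner_of_vec[of "y - P *\<^sub>v y" n v] y Pc vc by simp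
  qed
  have uniq: "Q = P" if Q: "?Q Q" for Q
  proof -
    have Qc: "Q \<in> carrier_mat n n" using Q by blast
    have act: "Q *\<^sub>v y = P *\<^sub>v y" if y: "y \<in> carrier_vec n" for y
    proof (rule of_vec_inj)
      show Qy: "Q *\<^sub>v y \<in> carrier_vec n" using Qc y by simp
      show "P *\<^sub>v y \<in> carrier_vec n" using P y by simp
      have "oproj C (of_vec y) = of_vec (Q *\<^sub>v y)"
      proof (rule oproj_eqI[OF C])
        have "Q *\<^sub>v y \<in> V" using Q y by blast
        then show "of_vec (Q *\<^sub>v y) \<in> span C" unfolding V(2)[symmetric] by (rule imageI)
        fix w assume "w \<in> span C"
        then obtain v where v: "w = of_vec v" "v \<in> V" unfolding V(2)[symmetric] by (rule imageE)
        then have "v \<in> carrier_vec n" using V(1) by blast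
        moreover have "scalar_prod (y - Q *\<^sub>v y) v = 0" using Q y v(2) by blast
        ultimately show "inner (of_vec y - of_vec (Q *\<^sub>v y)) w = 0"
          using inner_of_vec[of "y - Q *\<^sub>v y" n v] y Qy
          by (simp add: of_vec_minus[OF y Qy, symmetric] v(1))
      qed
      then show "of_vec (Q *\<^sub>v y) = of_vec (P *\<^sub>v y)" by (simp only: Py[OF y])
    qed
    show ?thesis
    proof (rule eq_matI)
      fix i j assume ij: "i < dim_row P" "j < dim_col P"
      then have ij: "i < n" "j < n" using P by simp_all
      have "(R *\<^sub>v unit_vec n j) $ i = R $$ (i, j)" if "R \<in> carrier_mat n n" for R :: "real mat"
        using that ij by (simp add: scalar_prod_right_unit[of j n])
      from this[OF Qc] this[OF P] show "Q $$ (i, j) = P $$ (i, j)"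
        using act[of "unit_vec n j"] by simp
    qed (use P Qc in simp_all)
  qed
  have "orth_proj n V = P"
    unfolding orth_proj_def by (rule the_equality) (use QP uniq in blast)+
  then show "orth_proj n V \<in> carrier_mat n n"
    "y \<in> carrier_vec n \<Longrightarrow> of_vec (orth_proj n V *\<^sub>v y) = oproj C (of_vec y)"
    using P Py by simp_all
qed

lemma col_proj_oproj:
  assumes A: "A \<in> carrier_mat n k" and C: "orthonormal C" "finite C" "span C = span (xcol A ` {..<k})"
  shows "col_proj A \<in> carrier_mat n n"
    and "y \<in> carrier_vec n \<Longrightarrow> of_vec (col_proj A *\<^sub>v y) = oproj C (of_vec y)"
proof -
  have "dim_row A = n" using A by simp
  moreover have "of_vec ` vec_space.col_space n A = span C"
    using of_vec_col_space[OF A] C(3) by simp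
  ultimately show "col_proj A \<in> carrier_mat n n"
    "y \<in> carrier_vec n \<Longrightarrow> of_vec (col_proj A *\<^sub>v y) = oproj C (of_vec y)"
    unfolding col_proj_def using orth_proj_oproj[OF col_space_carrier[OF A] _ C(1,2)] by simp_all
qed

section \<open>Comparison of residual sums of squares\<close>

text \<open>An infimum over the span is independent of any basis, so that each model can be treated
  with its own.\<close>

definition rss :: "'a::real_inner set \<Rightarrow> 'a \<Rightarrow> real" where
  "rss B y = (INF v \<in> span B. (norm (y - v))\<^sup>2)"

lemma rss_eq:
  assumes "orthonormal C" "finite C" "span C = span B"
  shows "rss B y = (norm (y - oproj C y))\<^sup>2"
  unfolding rss_def
proof (rule cInf_eq_minimum)
  show "(norm (y - oproj C y))\<^sup>2 \<in> (\<lambda>v. (norm (y - v))\<^sup>2) ` span B"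
    unfolding assms(3)[symmetric] by (intro imageI oproj_in_span)
  fix z assume "z \<in> (\<lambda>v. (norm (y - v))\<^sup>2) ` span B"
  then obtain v where v: "z = (norm (y - v))\<^sup>2" "v \<in> span C"
    unfolding assms(3)[symmetric] by (rule imageE)
  show "(norm (y - oproj C y))\<^sup>2 \<le> z"
    unfolding v(1) norm_diff_span[OF assms(1,2) v(2), of y] by simp
qed

text \<open>The component of \<open>u\<close> orthogonal to
  \<open>span (B\<^sub>0 \<union> K)\<close> occurs in both residuals and cancels. What is left for
  \<open>B\<close> is a square, bounded below by 0 or by expansion around \<nu>; what is left for
  \<open>B\<^sub>0\<close> is the energy of \<open>u\<close> on \<open>D\<close>. A vector common to
  \<open>B\<close> and \<open>B\<^sub>0\<close>, such as the artificial noise, adds no dimension to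
  \<open>D\<close>.\<close>

lemma rss_gap:
  fixes B B\<^sub>0 K :: "'a::real_inner set"
  assumes fin: "finite B" "finite B\<^sub>0" "finite K"
    and \<mu>: "\<mu> \<in> span B\<^sub>0" and B: "B \<subseteq> span (B\<^sub>0 \<union> K)"
  obtains D \<nu> where "orthonormal D" "D \<subseteq> span (B\<^sub>0 \<union> K)" "card D \<le> card K"
    "\<nu> \<in> span (B\<^sub>0 \<union> K)" "\<mu> - \<nu> \<in> span B"
    "\<And>u \<sigma>. rss B (\<mu> + \<sigma> *\<^sub>R u) - rss B\<^sub>0 (\<mu> + \<sigma> *\<^sub>R u)
      \<ge> (norm \<nu>)\<^sup>2 + 2 * \<sigma> * inner \<nu> u - \<sigma>\<^sup>2 * (\<Sum>d\<in>D. (inner d u)\<^sup>2)"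
    "\<And>u \<sigma>. rss B (\<mu> + \<sigma> *\<^sub>R u) - rss B\<^sub>0 (\<mu> + \<sigma> *\<^sub>R u) \<ge> - \<sigma>\<^sup>2 * (\<Sum>d\<in>D. (inner d u)\<^sup>2)"
proof -
  obtain C where C: "finite C" "orthonormal C" "card C \<le> card B" "span C = span B"
    by (rule orthonormal_basis_exists[OF fin(1)])
  obtain C\<^sub>0 where C\<^sub>0: "finite C\<^sub>0" "orthonormal C\<^sub>0" "card C\<^sub>0 \<le> card B\<^sub>0" "span C\<^sub>0 = span B\<^sub>0"
    by (rule orthonormal_basis_exists[OF fin(2)])
  obtain D where D: "finite D" "C\<^sub>0 \<inter> D = {}" "orthonormal (C\<^sub>0 \<union> D)" "card D \<le> card K"
    "span (C\<^sub>0 \<union> D) = span (C\<^sub>0 \<union> K)"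
    by (rule orthonormal_extend[OF C\<^sub>0(2,1) fin(3)])
  have W: "span (C\<^sub>0 \<union> D) = span (B\<^sub>0 \<union> K)"
    unfolding D(5) by (simp only: real_vector.span_Un C\<^sub>0(4))
  have finE: "finite (C\<^sub>0 \<union> D)" using C\<^sub>0(1) D(1) by simp
  have onD: "orthonormal D" by (rule orthonormal_subset[OF D(3)]) simp
  have DW: "D \<subseteq> span (B\<^sub>0 \<union> K)"
    unfolding W[symmetric] by (rule subset_trans[OF _ span_superset]) simp
  have CW: "span C \<subseteq> span (B\<^sub>0 \<union> K)"
    unfolding C(4) by (rule span_minimal[OF B]) simp
  define \<nu> where "\<nu> = \<mu> - oproj C \<mu>"
  have \<mu>W: "\<mu> \<in> span (B\<^sub>0 \<union> K)" using \<mu> span_mono[of B\<^sub>0 "B\<^sub>0 \<union> K"] by blast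
  have \<nu>W: "\<nu> \<in> span (B\<^sub>0 \<union> K)"
    unfolding \<nu>_def using \<mu>W oproj_in_span[of C \<mu>] CW by (intro real_vector.span_diff) blast+
  have \<nu>B: "\<mu> - \<nu> \<in> span B" unfolding \<nu>_def C(4)[symmetric] by (simp add: oproj_in_span)
  have gap: "rss B (\<mu> + \<sigma> *\<^sub>R u) - rss B\<^sub>0 (\<mu> + \<sigma> *\<^sub>R u)
      = (norm (\<mu> - oproj C (\<mu> + \<sigma> *\<^sub>R u) + \<sigma> *\<^sub>R oproj (C\<^sub>0 \<union> D) u))\<^sup>2 - \<sigma>\<^sup>2 * (\<Sum>d\<in>D. (inner d u)\<^sup>2)" for u \<sigma>
  proof -
    let ?P = "oproj (C\<^sub>0 \<union> D) u" and ?v = "oproj C (\<mu> + \<sigma> *\<^sub>R u)"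
    have "\<mu> - ?v + \<sigma> *\<^sub>R ?P \<in> span (C\<^sub>0 \<union> D)"
      unfolding W using \<mu>W oproj_in_span[of C "\<mu> + \<sigma> *\<^sub>R u"] CW oproj_in_span[of "C\<^sub>0 \<union> D" u]
      unfolding W by (intro span_add real_vector.span_diff span_scale) blast+
    from oproj_residual[OF D(3) finE this, of u]
    have orth: "inner (\<mu> - ?v + \<sigma> *\<^sub>R ?P) (\<sigma> *\<^sub>R (u - ?P)) = 0"
      by (simp add: inner_commute)
    have "(\<mu> + \<sigma> *\<^sub>R u) - ?v = (\<mu> - ?v + \<sigma> *\<^sub>R ?P) + \<sigma> *\<^sub>R (u - ?P)"
      by (simp add: algebra_simps)
    moreover have "real_inner_class.orthogonal (\<mu> - ?v + \<sigma> *\<^sub>R ?P) (\<sigma> *\<^sub>R (u - ?P))"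
      unfolding Linear_Algebra.orthogonal_def by (rule orth)
    ultimately have 1: "(norm ((\<mu> + \<sigma> *\<^sub>R u) - ?v))\<^sup>2 = (norm (\<mu> - ?v + \<sigma> *\<^sub>R ?P))\<^sup>2 + \<sigma>\<^sup>2 * (norm (u - ?P))\<^sup>2"
      by (simp only: norm_add_Pythagorean norm_scaleR power_mult_distrib power2_abs)
    have "oproj C\<^sub>0 (\<mu> + \<sigma> *\<^sub>R u) = \<mu> + \<sigma> *\<^sub>R oproj C\<^sub>0 u"
      using oproj_id[OF C\<^sub>0(2,1), of \<mu>] \<mu> unfolding C\<^sub>0(4)
      by (simp add: oproj_def inner_add_right scaleR_add_left sum.distrib scaleR_sum_right)
    then have "(\<mu> + \<sigma> *\<^sub>R u) - oproj C\<^sub>0 (\<mu> + \<sigma> *\<^sub>R u) = \<sigma> *\<^sub>R (u - oproj C\<^sub>0 u)"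
      by (simp add: algebra_simps)
    then have 2: "(norm ((\<mu> + \<sigma> *\<^sub>R u) - oproj C\<^sub>0 (\<mu> + \<sigma> *\<^sub>R u)))\<^sup>2 = \<sigma>\<^sup>2 * (norm (u - oproj C\<^sub>0 u))\<^sup>2"
      by (simp add: power_mult_distrib)
    have 3: "(norm (u - oproj C\<^sub>0 u))\<^sup>2 = (norm (u - ?P))\<^sup>2 + (\<Sum>d\<in>D. (inner d u)\<^sup>2)"
      unfolding norm_residual_sq[OF C\<^sub>0(2,1)] norm_residual_sq[OF D(3) finE]
        sum.union_disjoint[OF C\<^sub>0(1) D(1,2)] by simp
    show ?thesis
      unfolding rss_eq[OF C(2,1,4)] rss_eq[OF C\<^sub>0(2,1,4)] 1 2 3 by (simp add: algebra_simps)
  qed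
  have "(norm \<nu>)\<^sup>2 + 2 * \<sigma> * inner \<nu> u
      \<le> (norm (\<mu> - oproj C (\<mu> + \<sigma> *\<^sub>R u) + \<sigma> *\<^sub>R oproj (C\<^sub>0 \<union> D) u))\<^sup>2" for u \<sigma>
  proof -
    let ?P = "oproj (C\<^sub>0 \<union> D) u" and ?v = "oproj C (\<mu> + \<sigma> *\<^sub>R u)"
    \<comment> \<open>The part of \<open>z\<close> in \<open>span C\<close> is orthogonal to \<nu>,
      and \<nu> sees the projected noise as it sees \<open>u\<close>, because \<nu> lies in the
      space projected onto. Dropping the square of \<open>z\<close> gives the bound.\<close>
    define z where "z = (oproj C \<mu> - ?v) + \<sigma> *\<^sub>R ?P"
    have "oproj C \<mu> - ?v \<in> span C" by (intro real_vector.span_diff oproj_in_span)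
    from oproj_residual[OF C(2,1) this, of \<mu>] have "inner \<nu> (oproj C \<mu> - ?v) = 0"
      by (simp only: \<nu>_def)
    moreover have "inner \<nu> ?P = inner \<nu> u"
      using oproj_residual[OF D(3) finE, of \<nu> u] \<nu>W unfolding W
      by (simp add: inner_diff_right inner_diff_left inner_commute[of _ \<nu>])
    ultimately have "inner \<nu> z = \<sigma> * inner \<nu> u"
      by (simp add: z_def inner_add_right)
    then have "(norm (\<nu> + z))\<^sup>2 = (norm \<nu>)\<^sup>2 + 2 * \<sigma> * inner \<nu> u + (norm z)\<^sup>2"
      by (simp add: power2_norm_eq_inner inner_add_left inner_add_right inner_commute)
    moreover have "\<mu> - ?v + \<sigma> *\<^sub>R ?P = \<nu> + z" by (simp add: \<nu>_def z_def)
    ultimately show ?thesis by simp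
  qed
  then show thesis
    by (intro that[OF onD DW D(4) \<nu>W \<nu>B]) (simp_all add: gap)
qed

text \<open>Adding \<open>w\<close> to the span improves the fit of \<mu> only through the component
  of \<open>w\<close> along \<open>e\<close>, the direction of the residual of \<mu>. A multiple of
  \<open>w\<close> also brings in its components along \<open>G\<close>, which are orthogonal to
  \<open>e\<close> and to \<open>B\<close>; unless these are small, a third of the squared distance
  survives.\<close>

lemma alignment_alternative:
  assumes B: "finite B" "B \<subseteq> eucl n" and \<mu>: "\<mu> \<in> eucl n"
    and K: "0 < K" "\<And>v. v \<in> span B \<Longrightarrow> K \<le> (norm (\<mu> - v))\<^sup>2"
  obtains e G where "orthonormal (insert e G)" "insert e G \<subseteq> eucl n" "e \<notin> G" "n - card B - 1 \<le> card G"
    "\<And>w v. (inner e w)\<^sup>2 \<le> 2 * (\<Sum>g\<in>G. (inner g w)\<^sup>2) \<Longrightarrow> v \<in> span (insert w B) \<Longrightarrow> K / 3 \<le> (norm (\<mu> - v))\<^sup>2"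
proof -
  obtain C where C: "finite C" "orthonormal C" "card C \<le> card B" "span C = span B"
    by (rule orthonormal_basis_exists[OF B(1)])
  have Ce: "span C \<subseteq> eucl n" unfolding C(4) by (rule span_subset_eucl[OF B(2)])
  define \<nu> where "\<nu> = \<mu> - oproj C \<mu>"
  have \<nu>e: "\<nu> \<in> eucl n"
    unfolding \<nu>_def using oproj_in_span[of C \<mu>] Ce by (intro real_vector.subspace_diff[OF subspace_eucl] \<mu>) blast
  have K\<nu>: "K \<le> (norm \<nu>)\<^sup>2"
    unfolding \<nu>_def by (rule K(2)) (simp add: C(4)[symmetric] oproj_in_span)
  then have n\<nu>: "norm \<nu> > 0" using K(1) by (cases "\<nu> = 0") auto
  define e where "e = (1 / norm \<nu>) *\<^sub>R \<nu>"
  have ee: "inner e e = 1"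
    using n\<nu> by (simp add: e_def dot_square_norm power2_eq_square)
  have eC: "inner e c = 0" if "c \<in> span C" for c
    using oproj_residual[OF C(2,1) that, of \<mu>] by (simp add: e_def \<nu>_def)
  have eC': "e \<notin> C" using eC[of e] ee span_base[of e C] by auto
  have on: "orthonormal (insert e C)"
    unfolding orthonormal_def
  proof (intro ballI)
    fix a b assume ab: "a \<in> insert e C" "b \<in> insert e C"
    have "inner e c = 0" "inner c e = 0" if "c \<in> C" for c
      using eC[OF span_base[OF that]] by (simp_all add: inner_commute)
    with ab ee eC' show "inner a b = (if a = b then 1 else 0)"
      by (cases "a = e"; cases "b = e") (use C(2) in \<open>auto simp: orthonormal_def\<close>)
  qed
  have sub: "insert e C \<subseteq> eucl n"
    using real_vector.subspace_scale[OF subspace_eucl \<nu>e] span_superset[of C] Ce by (auto simp: e_def)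
  obtain G where G: "finite G" "insert e C \<inter> G = {}" "orthonormal (insert e C \<union> G)"
    "span (insert e C \<union> G) = eucl n" "G \<subseteq> eucl n" "card G = n - card (insert e C)"
    by (rule orthonormal_complete[OF on sub])
  have onG: "orthonormal (insert e G)"
    by (rule orthonormal_subset[OF G(3)]) auto
  have eG: "e \<notin> G" using G(2) by blast
  have cardG: "n - card B - 1 \<le> card G"
    using G(6) C(1,3) eC' by simp
  have gC: "inner g c = 0" if "g \<in> G" "c \<in> span (insert e C)" for g c
    by (rule orthonormal_Un_orthogonal[OF G(3) _ that]) (use G(2) in blast)
  show thesis
  proof (rule that[OF onG _ eG cardG])
    show "insert e G \<subseteq> eucl n" using sub G(5) by blast
  next
    fix w v assume w: "(inner e w)\<^sup>2 \<le> 2 * (\<Sum>g\<in>G. (inner g w)\<^sup>2)" and "v \<in> span (insert w B)"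
    then obtain s where "v - s *\<^sub>R w \<in> span B" by (auto simp: real_vector.span_insert)
    then have x: "v - s *\<^sub>R w \<in> span C" by (simp only: C(4))
    define x where "x = v - s *\<^sub>R w"
    define \<pi> where "\<pi> = oproj C \<mu>"
    have \<pi>: "\<pi> \<in> span C" by (simp add: \<pi>_def oproj_in_span)
    have split: "\<mu> - v = \<nu> + (\<pi> - x) - s *\<^sub>R w" by (simp add: \<nu>_def \<pi>_def x_def)
    have \<pi>x: "\<pi> - x \<in> span C" using \<pi> x by (simp add: x_def real_vector.span_diff)
    have e\<nu>: "inner e \<nu> = norm \<nu>" using n\<nu> by (simp add: e_def dot_square_norm power2_eq_square)
    have 1: "inner e (\<mu> - v) = norm \<nu> - s * inner e w"
      unfolding split using eC[OF \<pi>x] by (simp add: inner_add_right inner_diff_right e\<nu>)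
    have 2: "inner g (\<mu> - v) = - s * inner g w" if g: "g \<in> G" for g
    proof -
      have "\<pi> - x \<in> span (insert e C)" using \<pi>x span_mono[of C "insert e C"] by blast
      from gC[OF g this] have "inner g (\<pi> - x) = 0" .
      moreover have "inner g \<nu> = 0"
        using gC[OF g span_base[of e]] n\<nu> by (simp add: e_def)
      ultimately show ?thesis unfolding split by (simp add: inner_add_right inner_diff_right)
    qed
    have "0 \<le> inner (\<mu> - v) (\<mu> - v) - (\<Sum>d\<in>insert e G. (inner d (\<mu> - v))\<^sup>2)"
      using norm_residual_sq[OF onG finite.insertI[OF G(1)], of "\<mu> - v"] by (metis zero_le_power2)
    then have "(inner e (\<mu> - v))\<^sup>2 + (\<Sum>g\<in>G. (inner g (\<mu> - v))\<^sup>2) \<le> (norm (\<mu> - v))\<^sup>2"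
      using eG G(1) by (simp add: power2_norm_eq_inner)
    moreover have "(\<Sum>g\<in>G. (inner g (\<mu> - v))\<^sup>2) = s\<^sup>2 * (\<Sum>g\<in>G. (inner g w)\<^sup>2)"
      unfolding sum_distrib_left by (intro sum.cong refl) (simp add: 2 power_mult_distrib)
    ultimately have "(norm \<nu> - s * inner e w)\<^sup>2 + s\<^sup>2 * (\<Sum>g\<in>G. (inner g w)\<^sup>2) \<le> (norm (\<mu> - v))\<^sup>2"
      by (simp add: 1)
    moreover have "s\<^sup>2 * ((inner e w)\<^sup>2 / 2) \<le> s\<^sup>2 * (\<Sum>g\<in>G. (inner g w)\<^sup>2)"
      using w by (intro mult_left_mono) simp_all
    \<comment> \<open>With N the norm of \<nu> and x = s * inner e w, the expression (N - x)^2 +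
      x^2/2 is least at x = 2N/3, where it equals N^2/3. This is the source of the factor
      1/3.\<close>
    moreover have "(norm \<nu> - s * inner e w)\<^sup>2 + s\<^sup>2 * ((inner e w)\<^sup>2 / 2)
        = (norm \<nu>)\<^sup>2 / 3 + 3 / 2 * (s * inner e w - 2 / 3 * norm \<nu>)\<^sup>2"
      by (simp add: power2_eq_square algebra_simps)
    moreover have "0 \<le> 3 / 2 * (s * inner e w - 2 / 3 * norm \<nu>)\<^sup>2" by simp
    ultimately show "K / 3 \<le> (norm (\<mu> - v))\<^sup>2" using K\<nu> by linarith
  qed
qed

section \<open>Counting models and numerical estimates\<close>

lemma binomial_le_power: "n choose k \<le> n ^ k"
proof (cases "k \<le> n")
  case True
  then show ?thesis by (rule binomial_le_pow)
qed (simp add: binomial_eq_0)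

lemma finite_models: "finite {\<tau>. \<tau> \<subseteq> {..<p::nat} \<and> P \<tau>}"
  by (rule finite_subset[of _ "Pow {..<p}"]) auto

lemma card_models_eq: "card {\<tau>. \<tau> \<subseteq> {..<p} \<and> card \<tau> = k} = p choose k"
  using n_subsets[of "{..<p}" k] by simp

text \<open>Inflating \<open>p choose k\<close> to (s choose k) p^k lets the binomial theorem sum
  the counts, at the cost of no more than a constant factor compared with p^s when s \<le>
  p.\<close>

lemma card_models_le: "card {\<tau>. \<tau> \<subseteq> {..<p} \<and> card \<tau> \<le> s} \<le> (p + 1) ^ s"
proof -
  have "{\<tau>. \<tau> \<subseteq> {..<p} \<and> card \<tau> \<le> s} = (\<Union>k\<le>s. {\<tau>. \<tau> \<subseteq> {..<p} \<and> card \<tau> = k})" by auto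
  then have "card {\<tau>. \<tau> \<subseteq> {..<p} \<and> card \<tau> \<le> s} \<le> (\<Sum>k\<le>s. card {\<tau>. \<tau> \<subseteq> {..<p} \<and> card \<tau> = k})"
    by (simp only: card_UN_le[OF finite_atMost])
  also have "\<dots> \<le> (\<Sum>k\<le>s. (s choose k) * p ^ k)"
  proof (rule sum_mono)
    fix k assume "k \<in> {..s}"
    then have "1 \<le> s choose k" by (simp add: Suc_leI)
    from mult_mono[OF this binomial_le_power[of p k]]
    show "card {\<tau>. \<tau> \<subseteq> {..<p} \<and> card \<tau> = k} \<le> (s choose k) * p ^ k"
      by (simp add: card_models_eq)
  qed
  also have "\<dots> = (p + 1) ^ s"
    using binomial_ring[of p 1 s] by simp
  finally show ?thesis .
qed

text \<open>(p + 1)^s exceeds p^s by a factor of at most e^(s/p) \<le> e \<le> 3. As ln 2 / 2 \<ge>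
  1/3 and n - s \<ge> 3n/4, the power of 1/sqrt 2 is at most exp (-n/4), and 0.23 - 1/4 =
  -1/50.\<close>

lemma small_residual_total:
  fixes n p s :: nat
  assumes p: "1 \<le> p" and s: "s \<le> p" "real s \<le> real n / 4" "s < n" and log: "real s * ln (real p) \<le> 0.23 * real n"
  shows "real ((p + 1) ^ s) * (sqrt 2 * (1 / sqrt 2) ^ (n - s - 1)) \<le> 6 * exp (- real n / 50)"
proof -
  have "(1 + 1 / real p) ^ s \<le> exp (1 / real p) ^ s"
    by (intro power_mono exp_ge_add_one_self) simp
  also have "\<dots> = exp (real s / real p)" by (simp add: exp_of_nat_mult[symmetric])
  also have "\<dots> \<le> exp 1" using s(1) p by simp
  also have "\<dots> \<le> 3" by (rule exp_le)
  finally have e3: "(1 + 1 / real p) ^ s \<le> 3" .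
  have "real p ^ s = exp (real s * ln (real p))"
    using p by (simp add: exp_of_nat_mult)
  also have "\<dots> \<le> exp (0.23 * real n)" using log by simp
  finally have ps: "real p ^ s \<le> exp (0.23 * real n)" .
  have "real ((p + 1) ^ s) = real p ^ s * (1 + 1 / real p) ^ s"
    using p by (simp add: power_mult_distrib[symmetric] algebra_simps)
  also have "\<dots> \<le> exp (0.23 * real n) * 3"
    using ps e3 by (intro mult_mono) simp_all
  finally have cnt: "real ((p + 1) ^ s) \<le> 3 * exp (0.23 * real n)" by simp
  obtain m where m: "n - s = Suc m" using s(3) by (metis Suc_diff_Suc)
  have "sqrt 2 * (1 / sqrt 2) ^ m = 2 * (1 / sqrt 2) ^ (n - s)"
    by (simp add: m field_simps)
  also have "(1 / sqrt 2) ^ (n - s) = exp (- (ln 2 / 2) * real (n - s))"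
  proof -
    have "exp (- (ln 2 / 2)) = 1 / sqrt (2::real)"
      by (simp add: exp_minus ln_sqrt[symmetric] inverse_eq_divide)
    then show ?thesis by (metis exp_of_nat2_mult)
  qed
  also have "\<dots> \<le> exp (- real n / 4)"
  proof -
    have "real (n - s) \<ge> 3 / 4 * real n" using s by simp
    then have "(1 / 3) * (3 / 4 * real n) \<le> (ln 2 / 2) * real (n - s)"
      using ln2_ge_two_thirds by (intro mult_mono) simp_all
    then show ?thesis by simp
  qed
  finally have res: "sqrt 2 * (1 / sqrt 2) ^ m \<le> 2 * exp (- real n / 4)" by simp
  have "real ((p + 1) ^ s) * (sqrt 2 * (1 / sqrt 2) ^ m) \<le> (3 * exp (0.23 * real n)) * (2 * exp (- real n / 4))"
    by (rule mult_mono[OF cnt res]) simp_all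
  also have "\<dots> = 6 * exp (- real n / 50)"
    by (simp add: exp_add[symmetric])
  finally show ?thesis using m by simp
qed

text \<open>Union bounds for the linear and the quadratic deviation. K/90 pays for the number of
  models and leaves a/36; the larger K/40 pays for the factor \<open>sqrt 2 ^ s\<close> as
  well.\<close>

lemma underfit_total:
  fixes p s :: nat
  assumes p: "1 \<le> p" and a: "0 \<le> a" and K: "90 * ((real s + 2) * ln (real p + 1)) + 5 / 2 * a \<le> K"
  shows "real ((p + 1) ^ s) * exp (- K / 90) \<le> exp (- a / 36)"
    and "real ((p + 1) ^ s) * (sqrt 2 ^ s * exp (- K / 40)) \<le> exp (- a / 36)"
proof -
  let ?L = "ln (real p + 1)"
  have L: "0 \<le> ?L" using p by simp
  have pw: "real ((p + 1) ^ s) = exp (real s * ?L)"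
    by (simp add: exp_of_nat_mult add.commute)
  have "real s * ?L \<le> (real s + 2) * ?L" using L by (intro mult_right_mono) simp_all
  then have "real s * ?L - K / 90 \<le> - a / 36" using K by linarith
  then show "real ((p + 1) ^ s) * exp (- K / 90) \<le> exp (- a / 36)"
    unfolding pw by (simp add: exp_add[symmetric])
  have "sqrt 2 \<le> exp ?L" using p real_sqrt_le_mono[of 2 4] by simp
  then have "sqrt 2 ^ s \<le> exp ?L ^ s" by (intro power_mono) simp_all
  also have "\<dots> = exp (real s * ?L)" by (simp only: exp_of_nat_mult)
  finally have sq: "sqrt 2 ^ s \<le> exp (real s * ?L)" .
  \<comment> \<open>9/4 = 90/40 is the coefficient that the hypothesis on \<open>K\<close> leaves
    after division by 40.\<close>
  have "2 * (real s * ?L) \<le> 9 / 4 * ((real s + 2) * ?L)"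
  proof -
    have "0 \<le> real s * ?L" using L by simp
    moreover have "(real s + 2) * ?L = real s * ?L + 2 * ?L" by (simp add: distrib_right)
    ultimately show ?thesis using L by linarith
  qed
  then have "real s * ?L + real s * ?L - K / 40 \<le> - a / 36" using K a by linarith
  then have "exp (real s * ?L) * (exp (real s * ?L) * exp (- K / 40)) \<le> exp (- a / 36)"
    by (simp add: exp_add[symmetric])
  moreover have "exp (real s * ?L) * (sqrt 2 ^ s * exp (- K / 40)) \<le> exp (real s * ?L) * (exp (real s * ?L) * exp (- K / 40))"
    using sq by (intro mult_left_mono mult_right_mono) simp_all
  ultimately show "real ((p + 1) ^ s) * (sqrt 2 ^ s * exp (- K / 40)) \<le> exp (- a / 36)"
    unfolding pw by linarith
qed

text \<open>The left side bounds the total failure probability of all models with \<open>k\<close>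
  surplus columns. Its k-th power form on the right makes the sum over \<open>k\<close>
  geometric.\<close>

lemma overfit_term:
  fixes p s k :: nat
  assumes k: "1 \<le> k" "s + k \<le> p" and s: "1 \<le> s" and l: "6 * (real s + 1) * ln (real p / 2) + a \<le> l"
  shows "real (p ^ (s + k)) * (sqrt 2 ^ (s + k) * exp (- (real k * l) / 4)) \<le> (4 ^ 16 * exp (- a / 4)) ^ k"
proof -
  \<comment> \<open>This product dominates s + k and is also the multiple of 6 ln (p/2) that the
    penalty supplies, so counting and penalty become comparable.\<close>
  define q where "q = (real s + 1) * real k"
  let ?P = "ln (real p)" and ?T = "ln (2::real)"
  have p: "2 \<le> p" using k s by simp
  have P: "?T \<le> ?P" using p by simp
  have T: "0 < ?T" by simp
  have q: "real (s + k) \<le> q"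
    unfolding q_def using k(1) s by (simp add: algebra_simps mult_le_cancel_left1)
  have P0: "0 \<le> ?P" using p by simp
  have "exp ?P = real p" using p by simp
  then have p1: "real (p ^ (s + k)) = exp (real (s + k) * ?P)"
    by (simp only: of_nat_power exp_of_nat_mult)
  have "exp (?T / 2) = sqrt 2" by (simp add: ln_sqrt[symmetric])
  then have p2: "sqrt 2 ^ (s + k) = exp (real (s + k) * (?T / 2))"
    by (simp only: exp_of_nat_mult)
  have "real (s + k) * (?P + ?T / 2) \<le> q * (?P + ?T / 2)"
    using P0 T by (intro mult_right_mono[OF q]) linarith
  moreover have "6 * q * (?P - ?T) + real k * a \<le> real k * l"
  proof -
    have "real k * (6 * (real s + 1) * ln (real p / 2) + a) \<le> real k * l"
      using l by (intro mult_left_mono) simp_all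
    moreover have "ln (real p / 2) = ?P - ?T" using p by (simp add: ln_div)
    ultimately show ?thesis by (simp add: q_def algebra_simps)
  qed
  \<comment> \<open>Counting minus penalty gives ln p the coefficient 1 - 6/4 = -1/2 and ln 2 the
    coefficient 1/2 + 6/4 = 2, so the sign changes at p = 16. Below 16 the model sizes are bounded,
    q \<le> 16 k, and the loss per unit of k is 2^32 = 4^16.\<close>
  moreover have "q * (2 * ?T - ?P / 2) \<le> real k * (32 * ?T)"
  proof (cases "p < 16")
    case True
    then have "real s + 1 \<le> 16" using k by simp
    then have "q \<le> 16 * real k" unfolding q_def by (intro mult_right_mono) simp_all
    then have "q * (2 * ?T) \<le> (16 * real k) * (2 * ?T)" using T by (intro mult_right_mono) simp_all
    moreover have "0 \<le> q * (?P / 2)" using P0 q by (intro mult_nonneg_nonneg) simp_all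
    moreover have "(16 * real k) * (2 * ?T) = real k * (32 * ?T)" by simp
    ultimately show ?thesis unfolding right_diff_distrib by linarith
  next
    case False
    have "4 * ?T = ln (2 ^ 4)" by (simp only: ln_realpow)
    also have "\<dots> \<le> ?P" using False by simp
    finally have "q * (2 * ?T - ?P / 2) \<le> 0" using q by (intro mult_nonneg_nonpos) simp_all
    also have "0 \<le> real k * (32 * ?T)" using T by simp
    finally show ?thesis .
  qed
  ultimately have "real (s + k) * ?P + real (s + k) * (?T / 2) - real k * l / 4 \<le> real k * (32 * ?T - a / 4)"
    by (simp add: algebra_simps)
  then have "exp (real (s + k) * ?P) * (exp (real (s + k) * (?T / 2)) * exp (- (real k * l) / 4)) \<le> exp (real k * (32 * ?T - a / 4))"
    by (simp add: exp_add[symmetric])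
  also have "\<dots> = (4 ^ 16 * exp (- a / 4)) ^ k"
  proof -
    have "exp (32 * ?T - a / 4) = exp (32 * ?T) * exp (- a / 4)" by (simp add: exp_add[symmetric])
    also have "exp (32 * ?T) = exp ?T ^ 32" by (metis exp_of_nat_mult of_nat_numeral)
    also have "\<dots> = (4::real) ^ 16" by simp
    finally show ?thesis by (simp only: exp_of_nat_mult)
  qed
  finally show ?thesis unfolding p1 p2 .
qed

lemma geometric_sum_le:
  fixes x :: real
  assumes "0 \<le> x" "x \<le> 1 / 2"
  shows "(\<Sum>k=1..m. x ^ k) \<le> 2 * x"
proof -
  have eq: "(\<Sum>k=1..m. x ^ k) = x * (\<Sum>k<m. x ^ k)"
    by (simp add: sum_distrib_left sum.atLeast1_atMost_eq)
  have "(\<Sum>k<m. x ^ k) \<le> 2"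
  proof -
    have "(\<Sum>k<m. x ^ k) = (1 - x ^ m) / (1 - x)" using assms by (simp add: sum_gp_strict)
    also have "\<dots> \<le> 1 / (1 / 2)" using assms by (intro frac_le) simp_all
    finally show ?thesis by simp
  qed
  then have "x * (\<Sum>k<m. x ^ k) \<le> x * 2" using assms(1) by (rule mult_left_mono)
  then show ?thesis unfolding eq by simp
qed

section \<open>Selection of the true model\<close>

lemma measurable_inner_coord:
  assumes "\<And>\<omega>. f \<omega> \<in> eucl n"
    and "\<And>i. (\<lambda>\<omega>. coord (f \<omega>) i) \<in> borel_measurable M" "\<And>i. (\<lambda>\<omega>. coord (g \<omega>) i) \<in> borel_measurable M"
  shows "(\<lambda>\<omega>. inner (f \<omega>) (g \<omega>)) \<in> borel_measurable M"
proof -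
  have "(\<lambda>\<omega>. inner (f \<omega>) (g \<omega>)) = (\<lambda>\<omega>. \<Sum>i<n. coord (f \<omega>) i * coord (g \<omega>) i)"
    by (rule ext) (rule inner_eucl[OF assms(1)])
  then show ?thesis using assms(2,3) by simp
qed

text \<open>The tie-breaking rule is an arbitrary choice function, so measurability has to come from
  its argument: the set of minimisers takes finitely many values, and each value is described by
  finitely many comparisons of criteria.\<close>

lemma sets_tau_hat:
  assumes "\<And>\<tau>. \<tau> \<subseteq> {..<dim_col X} \<Longrightarrow> (\<lambda>\<omega>. repro_crit X lam (y \<omega>) (u \<omega>) \<tau>) \<in> borel_measurable M"
  shows "{\<omega> \<in> space M. Q (tau_hat sel X lam (y \<omega>) (u \<omega>))} \<in> sets M"
proof -
  let ?F = "Pow {..<dim_col X}"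
  have F: "finite ?F" "?F \<noteq> {}" by (simp, blast)
  define A where "A = (\<lambda>\<omega>. {\<tau>. is_arg_min (repro_crit X lam (y \<omega>) (u \<omega>)) (\<lambda>\<tau>. \<tau> \<subseteq> {..<dim_col X}) \<tau>})"
  have A_sub: "A \<omega> \<subseteq> ?F" for \<omega> by (auto simp: A_def is_arg_min_def)
  have crit[measurable]: "(\<lambda>\<omega>. repro_crit X lam (y \<omega>) (u \<omega>) \<tau>) \<in> borel_measurable M" if "\<tau> \<in> ?F" for \<tau>
    using assms[of \<tau>] that by simp
  have mem: "{\<omega> \<in> space M. \<tau> \<in> A \<omega>} \<in> sets M" if \<tau>: "\<tau> \<in> ?F" for \<tau>
  proof -
    have "{\<omega> \<in> space M. \<tau> \<in> A \<omega>}
      = {\<omega> \<in> space M. \<forall>\<tau>'\<in>?F. repro_crit X lam (y \<omega>) (u \<omega>) \<tau> \<le> repro_crit X lam (y \<omega>) (u \<omega>) \<tau>'}"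
    proof (intro Collect_cong conj_cong refl)
      fix \<omega>
      show "\<tau> \<in> A \<omega> \<longleftrightarrow> (\<forall>\<tau>'\<in>?F. repro_crit X lam (y \<omega>) (u \<omega>) \<tau> \<le> repro_crit X lam (y \<omega>) (u \<omega>) \<tau>')"
        using \<tau> unfolding A_def is_arg_min_def mem_Collect_eq Pow_iff Ball_def not_ex de_Morgan_conj not_less by blast
    qed
    also have "\<dots> \<in> sets M"
    proof (rule sets.sets_Collect_finite_All')
      show "{\<omega> \<in> space M. repro_crit X lam (y \<omega>) (u \<omega>) \<tau> \<le> repro_crit X lam (y \<omega>) (u \<omega>) \<tau>'} \<in> sets M"
        if "\<tau>' \<in> ?F" for \<tau>'
        by (rule borel_measurable_le[OF crit[OF \<tau>] crit[OF that]])
    qed (rule F)+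
    finally show ?thesis .
  qed
  have eq: "{\<omega> \<in> space M. A \<omega> = S} \<in> sets M" if "S \<subseteq> ?F" for S
  proof -
    have "{\<omega> \<in> space M. A \<omega> = S} = {\<omega> \<in> space M. \<forall>\<tau>\<in>?F. \<tau> \<in> A \<omega> \<longleftrightarrow> \<tau> \<in> S}"
    proof (intro Collect_cong conj_cong refl iffI)
      fix \<omega> assume *: "\<forall>\<tau>\<in>?F. \<tau> \<in> A \<omega> \<longleftrightarrow> \<tau> \<in> S"
      show "A \<omega> = S"
      proof (rule Set.set_eqI)
        fix \<tau>
        show "\<tau> \<in> A \<omega> \<longleftrightarrow> \<tau> \<in> S"
          using * A_sub[of \<omega>] that by (cases "\<tau> \<in> ?F") auto
      qed
    qed simp
    also have "\<dots> \<in> sets M"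
    proof (rule sets.sets_Collect_finite_All')
      fix \<tau> assume "\<tau> \<in> ?F"
      then show "{\<omega> \<in> space M. \<tau> \<in> A \<omega> \<longleftrightarrow> \<tau> \<in> S} \<in> sets M"
        using mem[of \<tau>] sets.sets_Collect_neg[OF mem[of \<tau>]] by (cases "\<tau> \<in> S") simp_all
    qed (rule F)+
    finally show ?thesis .
  qed
  have "{\<omega> \<in> space M. Q (tau_hat sel X lam (y \<omega>) (u \<omega>))} = (\<Union>S\<in>{S \<in> Pow ?F. Q (sel S)}. {\<omega> \<in> space M. A \<omega> = S})"
  proof -
    have "tau_hat sel X lam (y \<omega>) (u \<omega>) = sel (A \<omega>)" for \<omega> by (simp only: tau_hat_def A_def)
    then show ?thesis using A_sub by (intro Set.set_eqI) simp
  qed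
  also have "\<dots> \<in> sets M"
    using eq by (intro sets.finite_UN) auto
  finally show ?thesis .
qed

section \<open>One selection problem of fixed dimensions\<close>

locale repro_problem =
  fixes X :: "real mat" and n p :: nat and \<tau>\<^sub>0 :: "nat set" and \<beta>\<^sub>0 :: "real vec"
    and \<sigma>\<^sub>0 lam :: real and sel :: "nat set set \<Rightarrow> nat set"
  assumes X: "X \<in> carrier_mat n p" and \<tau>\<^sub>0: "\<tau>\<^sub>0 \<subseteq> {..<p}" "\<tau>\<^sub>0 \<noteq> {}" and \<beta>\<^sub>0: "\<beta>\<^sub>0 \<in> carrier_vec (card \<tau>\<^sub>0)"
    and \<sigma>\<^sub>0: "0 < \<sigma>\<^sub>0" and lam: "0 < lam" and sel: "\<And>A. A \<noteq> {} \<Longrightarrow> sel A \<in> A" and n: "1 \<le> n"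
begin

abbreviation s where "s \<equiv> card \<tau>\<^sub>0"

abbreviation "Y u \<equiv> response X \<tau>\<^sub>0 \<beta>\<^sub>0 \<sigma>\<^sub>0 (vec n u)"

definition \<mu> :: fvec where "\<mu> = of_vec (cols_at X \<tau>\<^sub>0 *\<^sub>v \<beta>\<^sub>0)"

lemma dims: "dim_row X = n" "dim_col X = p"
  using X by simp_all

lemma mean_carrier: "cols_at X \<tau>\<^sub>0 *\<^sub>v \<beta>\<^sub>0 \<in> carrier_vec n"
  using cols_at_carrier[OF X \<tau>\<^sub>0(1)] \<beta>\<^sub>0 by simp

lemma \<mu>_eucl: "\<mu> \<in> eucl n"
  unfolding \<mu>_def by (rule of_vec_in_eucl[OF mean_carrier])

lemma \<mu>_span: "\<mu> \<in> span (xcol X ` \<tau>\<^sub>0)"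
  unfolding \<mu>_def by (rule cols_at_in_span[OF X \<tau>\<^sub>0(1) \<beta>\<^sub>0])

lemma Y_carrier: "Y u \<in> carrier_vec n"
  unfolding response_def using mean_carrier by simp

lemma of_vec_Y: "of_vec (Y u) = \<mu> + \<sigma>\<^sub>0 *\<^sub>R emb n u"
  unfolding response_def \<mu>_def
  by (subst of_vec_add[OF mean_carrier]) (simp_all add: of_vec_smult)

lemma s_pos: "1 \<le> s"
  using \<tau>\<^sub>0(2) finite_model[OF X \<tau>\<^sub>0(1)] by (simp add: Suc_le_eq card_gt_0_iff)

lemma s_le_p: "s \<le> p"
  using card_mono[OF _ \<tau>\<^sub>0(1)] by simp

lemma repro_crit_rss:
  assumes "\<tau> \<subseteq> {..<p}"
  shows "repro_crit X lam (Y u) (vec n w) \<tau>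
    = rss (insert (emb n w) (xcol X ` \<tau>)) (\<mu> + \<sigma>\<^sub>0 *\<^sub>R emb n u) + lam * real (card \<tau>)"
proof -
  have fin: "finite (insert (emb n w) (xcol X ` \<tau>))"
    using finite_model[OF X assms] by simp
  obtain C where C: "finite C" "orthonormal C" "card C \<le> card (insert (emb n w) (xcol X ` \<tau>))"
    "span C = span (insert (emb n w) (xcol X ` \<tau>))"
    by (rule orthonormal_basis_exists[OF fin])
  have w: "vec n w \<in> carrier_vec n" by simp
  have C': "span C = span (insert (of_vec (vec n w)) (xcol X ` \<tau>))" using C(4) by simp
  show ?thesis
    unfolding repro_crit_eq[OF X assms Y_carrier w C(2,1) C'] rss_eq[OF C(2,1,4)] of_vec_Y ..
qed

text \<open>By \<open>repro_crit_formula\<close> the criterion is a rational expression in the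
  coordinates of the two noises, over a basis that does not move.\<close>

lemma measurable_repro_crit:
  assumes \<tau>: "\<tau> \<subseteq> {..<p}"
    and [measurable]: "u \<in> M \<rightarrow>\<^sub>M Pi\<^sub>M {..<n} (\<lambda>_. borel)" "w \<in> M \<rightarrow>\<^sub>M Pi\<^sub>M {..<n} (\<lambda>_. borel)"
  shows "(\<lambda>\<omega>. repro_crit X lam (Y (u \<omega>)) (vec n (w \<omega>)) \<tau>) \<in> borel_measurable M"
proof -
  obtain C where C: "finite C" "orthonormal C" "card C \<le> card (xcol X ` \<tau>)" "span C = span (xcol X ` \<tau>)"
    by (rule orthonormal_basis_exists[OF finite_imageI[OF finite_model[OF X \<tau>]]])
  have C_eucl: "c \<in> eucl n" if "c \<in> C" for c
    using span_base[OF that] span_xcol_eucl[OF X, of \<tau>] unfolding C(4) by blast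
  have wv: "vec n v \<in> carrier_vec n" for v by simp
  define y where "y = (\<lambda>\<omega>. \<mu> + \<sigma>\<^sub>0 *\<^sub>R emb n (u \<omega>))"
  define z where "z = (\<lambda>\<omega>. emb n (w \<omega>) - oproj C (emb n (w \<omega>)))"
  have cu: "(\<lambda>\<omega>. coord (emb n (u \<omega>)) i) \<in> borel_measurable M" for i
    by (cases "i < n") (simp_all, measurable)
  have cw: "(\<lambda>\<omega>. coord (emb n (w \<omega>)) i) \<in> borel_measurable M" for i
    by (cases "i < n") (simp_all, measurable)
  have ye: "y \<omega> \<in> eucl n" for \<omega>
    unfolding y_def by (intro real_vector.subspace_add[OF subspace_eucl] real_vector.subspace_scale[OF subspace_eucl] \<mu>_eucl emb_in_eucl)
  have "oproj C v \<in> eucl n" for v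
    using oproj_in_span[of C v] span_xcol_eucl[OF X, of \<tau>] unfolding C(4) by blast
  then have ze: "z \<omega> \<in> eucl n" for \<omega>
    unfolding z_def by (intro real_vector.subspace_diff[OF subspace_eucl] emb_in_eucl)
  have cy: "(\<lambda>\<omega>. coord (y \<omega>) i) \<in> borel_measurable M" for i
    unfolding y_def coord_simps using cu[of i] by measurable
  have cz: "(\<lambda>\<omega>. coord (z \<omega>) i) \<in> borel_measurable M" for i
    unfolding z_def oproj_def coord_simps coord_sum
    by (intro borel_measurable_diff borel_measurable_sum borel_measurable_times cw borel_measurable_const
        measurable_inner_coord[OF C_eucl])
  have cc: "(\<lambda>\<omega>. coord c i) \<in> borel_measurable M" for c i by simp
  have "(\<lambda>\<omega>. repro_crit X lam (Y (u \<omega>)) (vec n (w \<omega>)) \<tau>) =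
    (\<lambda>\<omega>. inner (y \<omega>) (y \<omega>) - (\<Sum>c\<in>C. (inner c (y \<omega>))\<^sup>2)
      - (inner (z \<omega>) (y \<omega>))\<^sup>2 / inner (z \<omega>) (z \<omega>) + lam * real (card \<tau>))"
    by (rule ext, subst repro_crit_formula[OF X \<tau> Y_carrier wv C(2,1,4) refl])
      (simp only: of_vec_Y y_def z_def of_vec_vec)
  moreover have "\<dots> \<in> borel_measurable M"
    by (intro borel_measurable_add borel_measurable_diff borel_measurable_divide borel_measurable_power
        borel_measurable_sum borel_measurable_const measurable_inner_coord[OF ye cy cy]
        measurable_inner_coord[OF ze cz cy] measurable_inner_coord[OF ze cz cz]
        measurable_inner_coord[OF C_eucl cc cy])
  ultimately show ?thesis by (simp only:)
qed

text \<open>Strict inequalities leave a single minimiser, so every tie-breaking rule returns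
  it.\<close>

lemma tau_hat_eq:
  assumes "\<And>\<tau>. \<tau> \<subseteq> {..<p} \<Longrightarrow> \<tau> \<noteq> \<tau>\<^sub>0 \<Longrightarrow> repro_crit X lam y v \<tau>\<^sub>0 < repro_crit X lam y v \<tau>"
  shows "tau_hat sel X lam y v = \<tau>\<^sub>0"
proof -
  have "is_arg_min (repro_crit X lam y v) (\<lambda>\<tau>. \<tau> \<subseteq> {..<dim_col X}) \<tau> \<longleftrightarrow> \<tau> = \<tau>\<^sub>0" for \<tau>
    using assms \<tau>\<^sub>0(1) unfolding is_arg_min_def dims by (metis less_asym less_irrefl)
  then have "{\<tau>. is_arg_min (repro_crit X lam y v) (\<lambda>\<tau>. \<tau> \<subseteq> {..<dim_col X}) \<tau>} = {\<tau>\<^sub>0}" by simp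
  then show ?thesis
    unfolding tau_hat_def using sel[of "{\<tau>\<^sub>0}"] by simp
qed

lemma tau_hat_subset: "tau_hat sel X lam y v \<subseteq> {..<p}"
proof -
  let ?A = "{\<tau>. is_arg_min (repro_crit X lam y v) (\<lambda>\<tau>. \<tau> \<subseteq> {..<dim_col X}) \<tau>}"
  have "finite {\<tau>. \<tau> \<subseteq> {..<dim_col X}}" using finite_models[of "dim_col X" "\<lambda>_. True"] by simp
  moreover have "{\<tau>. \<tau> \<subseteq> {..<dim_col X}} \<noteq> {}" by blast
  ultimately obtain \<tau> where "is_arg_min (repro_crit X lam y v) (\<lambda>\<tau>. \<tau> \<in> {\<tau>. \<tau> \<subseteq> {..<dim_col X}}) \<tau>"
    using ex_is_arg_min_if_finite by metis
  then have "?A \<noteq> {}" by auto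
  from CollectD[OF sel[OF this]] show ?thesis
    unfolding tau_hat_def is_arg_min_def by (simp only: dims)
qed

section \<open>Competitors of at most the true size, and larger ones\<close>

abbreviation "underfit \<equiv> {\<tau>. \<tau> \<subseteq> {..<p} \<and> \<tau> \<noteq> \<tau>\<^sub>0 \<and> card \<tau> \<le> s}"

abbreviation "overfit \<equiv> {\<tau>. \<tau> \<subseteq> {..<p} \<and> s < card \<tau>}"

text \<open>The lower bound of \<open>C_min_le\<close> for the squared distance of \<mu> from the
  span of the model; it sets the scale of all deviations for underfitted models.\<close>

definition K :: "nat set \<Rightarrow> real" where
  "K \<tau> = C_min X \<tau>\<^sub>0 \<beta>\<^sub>0 * (real n * real (max (card (\<tau>\<^sub>0 - \<tau>)) 1))"

text \<open>\<open>D\<close> and \<nu> are fixed before \<open>u\<close> is quantified. For given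
  artificial noise they are deterministic, so the Gaussian tail bounds in \<open>u\<close> apply to
  them.\<close>

definition gap_vectors :: "nat set \<Rightarrow> (nat \<Rightarrow> real) \<Rightarrow> fvec set \<Rightarrow> fvec \<Rightarrow> bool" where
  "gap_vectors \<tau> w D \<nu> \<longleftrightarrow> orthonormal D \<and> D \<subseteq> eucl n \<and> card D \<le> card (\<tau> - \<tau>\<^sub>0) \<and> \<nu> \<in> eucl n
    \<and> \<mu> - \<nu> \<in> span (insert (emb n w) (xcol X ` \<tau>))
    \<and> (\<forall>u. repro_crit X lam (Y u) (vec n w) \<tau> - repro_crit X lam (Y u) (vec n w) \<tau>\<^sub>0
        \<ge> (norm \<nu>)\<^sup>2 + 2 * \<sigma>\<^sub>0 * inner \<nu> (emb n u) - \<sigma>\<^sub>0\<^sup>2 * (\<Sum>d\<in>D. (inner d (emb n u))\<^sup>2)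
          + lam * (real (card \<tau>) - real s))
    \<and> (\<forall>u. repro_crit X lam (Y u) (vec n w) \<tau> - repro_crit X lam (Y u) (vec n w) \<tau>\<^sub>0
        \<ge> - \<sigma>\<^sub>0\<^sup>2 * (\<Sum>d\<in>D. (inner d (emb n u))\<^sup>2) + lam * (real (card \<tau>) - real s))"

lemma gap_vectors_exist:
  assumes \<tau>: "\<tau> \<subseteq> {..<p}"
  shows "\<exists>D \<nu>. gap_vectors \<tau> w D \<nu>"
proof -
  let ?B = "insert (emb n w) (xcol X ` \<tau>)" and ?B\<^sub>0 = "insert (emb n w) (xcol X ` \<tau>\<^sub>0)"
  let ?K = "xcol X ` (\<tau> - \<tau>\<^sub>0)"
  have fin: "finite ?B" "finite ?B\<^sub>0" "finite ?K"
    using finite_model[OF X \<tau>] finite_model[OF X \<tau>\<^sub>0(1)] by simp_all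
  have \<mu>: "\<mu> \<in> span ?B\<^sub>0" using \<mu>_span span_mono[of "xcol X ` \<tau>\<^sub>0" ?B\<^sub>0] by blast
  have "?B \<subseteq> ?B\<^sub>0 \<union> ?K" by blast
  then have B: "?B \<subseteq> span (?B\<^sub>0 \<union> ?K)" using span_superset[of "?B\<^sub>0 \<union> ?K"] by (rule subset_trans)
  have "?B\<^sub>0 \<union> ?K \<subseteq> eucl n" using xcol_in_eucl[OF X] emb_in_eucl by blast
  then have We: "span (?B\<^sub>0 \<union> ?K) \<subseteq> eucl n" by (rule span_subset_eucl)
  have cK: "card ?K \<le> card (\<tau> - \<tau>\<^sub>0)" using finite_model[OF X \<tau>] by (intro card_image_le) simp
  have diff: "repro_crit X lam (Y u) (vec n w) \<tau> - repro_crit X lam (Y u) (vec n w) \<tau>\<^sub>0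
    = rss ?B (\<mu> + \<sigma>\<^sub>0 *\<^sub>R emb n u) - rss ?B\<^sub>0 (\<mu> + \<sigma>\<^sub>0 *\<^sub>R emb n u) + lam * (real (card \<tau>) - real s)" for u
    unfolding repro_crit_rss[OF \<tau>] repro_crit_rss[OF \<tau>\<^sub>0(1)] by (simp add: right_diff_distrib)
  show ?thesis
  proof (rule rss_gap[OF fin \<mu> B], goal_cases)
    case (1 D \<nu>)
    have "gap_vectors \<tau> w D \<nu>"
      unfolding gap_vectors_def diff
    proof (intro conjI allI)
      show "D \<subseteq> eucl n" using 1(2) We by (rule subset_trans)
      show "\<nu> \<in> eucl n" using 1(4) We by blast
      show "card D \<le> card (\<tau> - \<tau>\<^sub>0)" using 1(3) cK by (rule order_trans)
    qed (use 1(1,5) 1(6)[where \<sigma>=\<sigma>\<^sub>0] 1(7)[where \<sigma>=\<sigma>\<^sub>0] in simp_all)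
    then show ?case by blast
  qed
qed

text \<open>
  The constants balance: with \<open>\<nu>\<close> of squared norm at least \<open>K / 3\<close>, the linear term at most
  \<open>2 \<bar>\<nu>\<bar> sqrt (K / 45)\<close> and the quadratic term at most \<open>K / 10\<close>, more than \<open>K / 20\<close> remains.
\<close>

lemma gap_constants:
  fixes N k q l :: real
  assumes "0 < k" "k / 3 \<le> N\<^sup>2" "0 \<le> N" "- sqrt (k / 45) * N \<le> l" "q \<le> k / 10"
  shows "k / 20 < N\<^sup>2 + 2 * l - q"
proof -
  \<comment> \<open>3/20 bounds 1/sqrt 45 from above and 57/100 bounds 1/sqrt 3 from below; what
    remains is 0.57 * (0.57 - 0.3) - 0.1 = 0.0539, just above 1/20.\<close>
  define r where "r = sqrt k"
  have r: "0 < r" "r\<^sup>2 = k" using assms(1) by (simp_all add: r_def)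
  have "(r * (3 / 20))\<^sup>2 = k * (9 / 400)" using r(2) by (simp add: power_mult_distrib power2_eq_square)
  then have "sqrt (k / 45) \<le> r * (3 / 20)"
    using r(1) assms(1) by (intro real_le_lsqrt) simp_all
  then have "sqrt (k / 45) * N \<le> r * (3 / 20) * N" using assms(3) by (rule mult_right_mono)
  then have l: "- (r * (3 / 20) * N) \<le> l" using assms(4) by simp
  have "57 / 100 * r \<le> N"
  proof (rule power2_le_imp_le)
    have "(57 / 100 * r)\<^sup>2 = 3249 / 10000 * k" using r(2) by (simp add: power_mult_distrib power2_eq_square)
    then show "(57 / 100 * r)\<^sup>2 \<le> N\<^sup>2" using assms(1,2) by simp
  qed (use assms in simp)
  then have "(57 / 100 * r) * (57 / 100 * r - 3 / 10 * r) \<le> N * (N - 3 / 10 * r)"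
    using r by (intro mult_mono) simp_all
  moreover have "(57 / 100 * r) * (57 / 100 * r - 3 / 10 * r) = 1539 / 10000 * k"
    using r(2) by (simp add: power2_eq_square algebra_simps)
  moreover have "N * (N - 3 / 10 * r) = N\<^sup>2 - 3 / 10 * (N * r)"
    by (simp add: power2_eq_square algebra_simps)
  moreover have "- (3 / 20 * (N * r)) \<le> l" using l by (simp add: mult_ac)
  ultimately show ?thesis using assms(1,5) by linarith
qed

lemma K_ge:
  assumes "0 \<le> C_min X \<tau>\<^sub>0 \<beta>\<^sub>0"
  shows "real n * C_min X \<tau>\<^sub>0 \<beta>\<^sub>0 \<le> K \<tau>"
proof -
  have "(real n * C_min X \<tau>\<^sub>0 \<beta>\<^sub>0) * 1 \<le> (real n * C_min X \<tau>\<^sub>0 \<beta>\<^sub>0) * real (max (card (\<tau>\<^sub>0 - \<tau>)) 1)"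
    using assms by (intro mult_left_mono) simp_all
  then show ?thesis by (simp only: K_def mult_ac mult_1_right)
qed

text \<open>The exceptional set consists of artificial noises only. The sets of all models can be
  removed together before \<open>U\<close> is considered.\<close>

lemma alignment_event:
  assumes \<tau>: "\<tau> \<in> underfit" and C: "0 < C_min X \<tau>\<^sub>0 \<beta>\<^sub>0"
  obtains S where "S \<in> sets (std_gauss n)"
    "measure (std_gauss n) S \<le> sqrt 2 * (1 / sqrt 2) ^ (n - s - 1)"
    "\<And>w v. w \<in> space (std_gauss n) - S \<Longrightarrow> v \<in> span (insert (emb n w) (xcol X ` \<tau>))
      \<Longrightarrow> K \<tau> / 3 \<le> (norm (\<mu> - v))\<^sup>2"
proof -
  have \<tau>': "\<tau> \<subseteq> {..<p}" "\<tau> \<noteq> \<tau>\<^sub>0" "card \<tau> \<le> s" using \<tau> by simp_all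
  have fin: "finite (xcol X ` \<tau>)" using finite_model[OF X \<tau>'(1)] by simp
  have sub: "xcol X ` \<tau> \<subseteq> eucl n" using xcol_in_eucl[OF X] by blast
  have "0 < real n * C_min X \<tau>\<^sub>0 \<beta>\<^sub>0" using n C by simp
  also have "\<dots> \<le> K \<tau>" using C by (intro K_ge) simp
  finally have K: "0 < K \<tau>" .
  have Kv: "K \<tau> \<le> (norm (\<mu> - v))\<^sup>2" if "v \<in> span (xcol X ` \<tau>)" for v
    unfolding K_def \<mu>_def by (rule C_min_le[OF X \<tau>\<^sub>0(1) \<beta>\<^sub>0 \<tau>' n that])
  show thesis
  proof (rule alignment_alternative[OF fin sub \<mu>_eucl K Kv], assumption, goal_cases)
    case (1 e G)
    let ?S = "{u \<in> space (std_gauss n). (inner e (emb n u))\<^sup>2 > 2 * (\<Sum>g\<in>G. (inner g (emb n u))\<^sup>2)}"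
    show ?case
    proof (rule that[of ?S])
      show "?S \<in> sets (std_gauss n)" by measurable
      have "card (xcol X ` \<tau>) \<le> s"
        using card_image_le[OF finite_model[OF X \<tau>'(1)], of "xcol X"] \<tau>'(3) by simp
      then have "n - s - 1 \<le> card G" using 1(4) by simp
      then have "(1 / sqrt 2) ^ card G \<le> (1 / sqrt 2 :: real) ^ (n - s - 1)"
        by (intro power_decreasing) simp_all
      then have "sqrt 2 * (1 / sqrt 2) ^ card G \<le> sqrt 2 * (1 / sqrt 2) ^ (n - s - 1)"
        by (intro mult_left_mono) simp_all
      with gauss_small_residual[OF 1(1-3)]
      show "measure (std_gauss n) ?S \<le> sqrt 2 * (1 / sqrt 2) ^ (n - s - 1)" by (rule order_trans)
    next
      fix w v assume w: "w \<in> space (std_gauss n) - ?S" and v: "v \<in> span (insert (emb n w) (xcol X ` \<tau>))"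
      have "(inner e (emb n w))\<^sup>2 \<le> 2 * (\<Sum>g\<in>G. (inner g (emb n w))\<^sup>2)"
        using w by (simp add: not_less)
      from 1(5)[OF this v] show "K \<tau> / 3 \<le> (norm (\<mu> - v))\<^sup>2" .
    qed
  qed
qed

text \<open>Grouped by the number of surplus columns, the union bound is dominated by a geometric
  series whose ratio is at most 1/2 by \<open>H4\<close>.\<close>

lemma overfit_sum:
  assumes H2: "6 * (real s + 1) * ln (real p / 2) + a \<le> lam / \<sigma>\<^sub>0\<^sup>2"
    and H4: "4 ^ 16 * exp (- a / 4) \<le> 1 / 2"
  shows "(\<Sum>\<tau>\<in>overfit. sqrt 2 ^ card \<tau> * exp (- ((real (card \<tau>) - real s) * (lam / \<sigma>\<^sub>0\<^sup>2)) / 4))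
    \<le> 2 * (4 ^ 16 * exp (- a / 4))"
proof -
  let ?h = "\<lambda>\<tau>. sqrt 2 ^ card \<tau> * exp (- ((real (card \<tau>) - real s) * (lam / \<sigma>\<^sub>0\<^sup>2)) / 4)"
  let ?x = "4 ^ 16 * exp (- a / 4) :: real"
  have im: "(\<lambda>\<tau>. card \<tau> - s) ` overfit \<subseteq> {1..p}"
  proof (rule image_subsetI)
    fix \<tau> assume "\<tau> \<in> overfit"
    then have "s < card \<tau>" "card \<tau> \<le> p" using card_mono[of "{..<p}" \<tau>] by simp_all
    then show "card \<tau> - s \<in> {1..p}" unfolding atLeastAtMost_iff by linarith
  qed
  have "(\<Sum>\<tau>\<in>overfit. ?h \<tau>) = (\<Sum>k\<in>{1..p}. \<Sum>\<tau>\<in>{\<tau> \<in> overfit. card \<tau> - s = k}. ?h \<tau>)"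
    by (rule sum.group[OF finite_models _ im, symmetric]) simp
  also have "\<dots> \<le> (\<Sum>k\<in>{1..p}. ?x ^ k)"
  proof (rule sum_mono)
    fix k assume k: "k \<in> {1..p}"
    have eq: "{\<tau> \<in> overfit. card \<tau> - s = k} = {\<tau>. \<tau> \<subseteq> {..<p} \<and> card \<tau> = s + k}"
      using k by (intro Collect_cong) auto
    have "(\<Sum>\<tau>\<in>{\<tau> \<in> overfit. card \<tau> - s = k}. ?h \<tau>)
        = (\<Sum>\<tau>\<in>{\<tau>. \<tau> \<subseteq> {..<p} \<and> card \<tau> = s + k}. sqrt 2 ^ (s + k) * exp (- (real k * (lam / \<sigma>\<^sub>0\<^sup>2)) / 4))"
      unfolding eq by (intro sum.cong refl) simp
    also have "\<dots> = real (p choose (s + k)) * (sqrt 2 ^ (s + k) * exp (- (real k * (lam / \<sigma>\<^sub>0\<^sup>2)) / 4))"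
      by (simp only: sum_constant card_models_eq)
    also have "\<dots> \<le> ?x ^ k"
    proof (cases "s + k \<le> p")
      case True
      have "real (p choose (s + k)) * (sqrt 2 ^ (s + k) * exp (- (real k * (lam / \<sigma>\<^sub>0\<^sup>2)) / 4))
        \<le> real (p ^ (s + k)) * (sqrt 2 ^ (s + k) * exp (- (real k * (lam / \<sigma>\<^sub>0\<^sup>2)) / 4))"
        using binomial_le_power[of p "s + k"] by (intro mult_right_mono) (simp_all del: of_nat_power)
      also have "\<dots> \<le> ?x ^ k"
        using k True s_pos H2 by (intro overfit_term) simp_all
      finally show ?thesis .
    qed (simp add: binomial_eq_0)
    finally show "(\<Sum>\<tau>\<in>{\<tau> \<in> overfit. card \<tau> - s = k}. ?h \<tau>) \<le> ?x ^ k" .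
  qed
  also have "\<dots> \<le> 2 * ?x" using H4 by (intro geometric_sum_le) simp_all
  finally show ?thesis .
qed

text \<open>The artificial noise is fixed and well aligned with no competitor, so only
  \<open>U\<close> is random. Outside three families of deviation events every competitor has a
  strictly larger criterion than \<open>\<tau>\<^sub>0\<close>.\<close>

lemma selection_error_given:
  assumes C: "0 < C_min X \<tau>\<^sub>0 \<beta>\<^sub>0" and a: "0 \<le> a"
    and H1: "90 * ((real s + 2) * ln (real p + 1)) + 5 / 2 * a \<le> real n * C_min X \<tau>\<^sub>0 \<beta>\<^sub>0 / \<sigma>\<^sub>0\<^sup>2"
    and H2: "6 * (real s + 1) * ln (real p / 2) + a \<le> lam / \<sigma>\<^sub>0\<^sup>2"
    and H3: "lam \<le> real n * C_min X \<tau>\<^sub>0 \<beta>\<^sub>0 / 20"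
    and H4: "4 ^ 16 * exp (- a / 4) \<le> 1 / 2"
    and w: "\<And>\<tau> v. \<tau> \<in> underfit \<Longrightarrow> v \<in> span (insert (emb n w) (xcol X ` \<tau>)) \<Longrightarrow> K \<tau> / 3 \<le> (norm (\<mu> - v))\<^sup>2"
  shows "measure (std_gauss n) {u \<in> space (std_gauss n). tau_hat sel X lam (Y u) (vec n w) \<noteq> \<tau>\<^sub>0}
    \<le> 2 * exp (- a / 36) + 2 * (4 ^ 16 * exp (- a / 4))"
proof -
  interpret P: prob_space "std_gauss n" by (rule prob_space_std_gauss)
  let ?\<gamma> = "std_gauss n" and ?\<kappa> = "real n * C_min X \<tau>\<^sub>0 \<beta>\<^sub>0 / \<sigma>\<^sub>0\<^sup>2"
  define D where "D = (\<lambda>\<tau>. SOME D. \<exists>\<nu>. gap_vectors \<tau> w D \<nu>)"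
  define \<nu> where "\<nu> = (\<lambda>\<tau>. SOME \<nu>. gap_vectors \<tau> w (D \<tau>) \<nu>)"
  have DN: "gap_vectors \<tau> w (D \<tau>) (\<nu> \<tau>)" if "\<tau> \<subseteq> {..<p}" for \<tau>
  proof -
    have "\<exists>\<nu>. gap_vectors \<tau> w (D \<tau>) \<nu>"
      unfolding D_def by (rule someI_ex[OF gap_vectors_exist[OF that]])
    then show ?thesis unfolding \<nu>_def by (rule someI_ex)
  qed
  define Q where "Q = (\<lambda>\<tau> u. \<Sum>d\<in>D \<tau>. (inner d (emb n u))\<^sup>2)"
  \<comment> \<open>The thresholds of \<open>B2\<close> and \<open>B3\<close> are those of
    \<open>gap_constants\<close>, rescaled by the noise level. For \<open>B4\<close> the threshold
    is the extra penalty itself.\<close>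
  define B2 where "B2 = (\<lambda>\<tau>. {u \<in> space ?\<gamma>. inner (\<nu> \<tau>) (emb n u) < - (sqrt (K \<tau> / 45) / \<sigma>\<^sub>0) * norm (\<nu> \<tau>)})"
  define B3 where "B3 = (\<lambda>\<tau>. {u \<in> space ?\<gamma>. K \<tau> / (10 * \<sigma>\<^sub>0\<^sup>2) \<le> Q \<tau> u})"
  define B4 where "B4 = (\<lambda>\<tau>. {u \<in> space ?\<gamma>. (real (card \<tau>) - real s) * (lam / \<sigma>\<^sub>0\<^sup>2) \<le> Q \<tau> u})"
  have meas: "B2 \<tau> \<in> sets ?\<gamma>" "B3 \<tau> \<in> sets ?\<gamma>" "B4 \<tau> \<in> sets ?\<gamma>" for \<tau>
    unfolding B2_def B3_def B4_def Q_def by measurable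
  have s2: "0 < \<sigma>\<^sub>0\<^sup>2" using \<sigma>\<^sub>0 by simp
  have Kpos: "0 < K \<tau>" for \<tau>
  proof -
    have "0 < real n * C_min X \<tau>\<^sub>0 \<beta>\<^sub>0" using n C by simp
    also have "\<dots> \<le> K \<tau>" using C by (intro K_ge) simp
    finally show ?thesis .
  qed
  have K\<kappa>: "?\<kappa> \<le> K \<tau> / \<sigma>\<^sub>0\<^sup>2" for \<tau>
    using K_ge[of \<tau>] C s2 by (intro divide_right_mono) simp_all
  have cover: "{u \<in> space ?\<gamma>. tau_hat sel X lam (Y u) (vec n w) \<noteq> \<tau>\<^sub>0}
    \<subseteq> (\<Union>\<tau>\<in>underfit. B2 \<tau>) \<union> (\<Union>\<tau>\<in>underfit. B3 \<tau>) \<union> (\<Union>\<tau>\<in>overfit. B4 \<tau>)"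
  proof (rule subsetI, rule ccontr)
    fix u assume "u \<in> {u \<in> space ?\<gamma>. tau_hat sel X lam (Y u) (vec n w) \<noteq> \<tau>\<^sub>0}"
    then have u: "u \<in> space ?\<gamma>" "tau_hat sel X lam (Y u) (vec n w) \<noteq> \<tau>\<^sub>0" by simp_all
    assume notin: "u \<notin> (\<Union>\<tau>\<in>underfit. B2 \<tau>) \<union> (\<Union>\<tau>\<in>underfit. B3 \<tau>) \<union> (\<Union>\<tau>\<in>overfit. B4 \<tau>)"
    have out: "\<tau> \<in> underfit \<Longrightarrow> u \<notin> B2 \<tau> \<and> u \<notin> B3 \<tau>" "\<tau> \<in> overfit \<Longrightarrow> u \<notin> B4 \<tau>" for \<tau>
      using notin unfolding Un_iff UN_iff by fast+
    have "repro_crit X lam (Y u) (vec n w) \<tau>\<^sub>0 < repro_crit X lam (Y u) (vec n w) \<tau>"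
      if \<tau>: "\<tau> \<subseteq> {..<p}" "\<tau> \<noteq> \<tau>\<^sub>0" for \<tau>
    proof (cases "card \<tau> \<le> s")
      case True
      then have un: "\<tau> \<in> underfit" using \<tau> by simp
      have "\<mu> - \<nu> \<tau> \<in> span (insert (emb n w) (xcol X ` \<tau>))"
        using DN[OF \<tau>(1)] by (simp only: gap_vectors_def)
      from w[OF un this] have N: "K \<tau> / 3 \<le> (norm (\<nu> \<tau>))\<^sup>2" by simp
      have "- (sqrt (K \<tau> / 45) / \<sigma>\<^sub>0) * norm (\<nu> \<tau>) \<le> inner (\<nu> \<tau>) (emb n u)"
        using out(1)[OF un] u(1) by (simp add: B2_def not_less)
      then have "\<sigma>\<^sub>0 * (- (sqrt (K \<tau> / 45) / \<sigma>\<^sub>0) * norm (\<nu> \<tau>)) \<le> \<sigma>\<^sub>0 * inner (\<nu> \<tau>) (emb n u)"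
        using \<sigma>\<^sub>0 by (intro mult_left_mono) simp_all
      then have l: "- sqrt (K \<tau> / 45) * norm (\<nu> \<tau>) \<le> \<sigma>\<^sub>0 * inner (\<nu> \<tau>) (emb n u)"
        using \<sigma>\<^sub>0 by simp
      have "Q \<tau> u \<le> K \<tau> / (10 * \<sigma>\<^sub>0\<^sup>2)"
        using out(1)[OF un] u(1) by (simp add: B3_def)
      then have "\<sigma>\<^sub>0\<^sup>2 * Q \<tau> u \<le> \<sigma>\<^sub>0\<^sup>2 * (K \<tau> / (10 * \<sigma>\<^sub>0\<^sup>2))"
        using s2 by (intro mult_left_mono) simp_all
      then have q: "\<sigma>\<^sub>0\<^sup>2 * Q \<tau> u \<le> K \<tau> / 10" using s2 by simp
      have big: "K \<tau> / 20 < (norm (\<nu> \<tau>))\<^sup>2 + 2 * (\<sigma>\<^sub>0 * inner (\<nu> \<tau>) (emb n u)) - \<sigma>\<^sub>0\<^sup>2 * Q \<tau> u"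
        by (rule gap_constants[OF Kpos N _ l q]) simp
      let ?m = "real (max (card (\<tau>\<^sub>0 - \<tau>)) 1)"
      \<comment> \<open>A smaller model saves at most \<open>lam\<close> times the number of true
        columns it misses, and \<open>K\<close> carries the same number. This is where the
        normalisation of \<open>C_min\<close> by that number enters.\<close>
      have "s - card \<tau> \<le> card (\<tau>\<^sub>0 - \<tau>)"
        by (rule diff_card_le_card_Diff[OF finite_model[OF X \<tau>(1)]])
      then have "real s - real (card \<tau>) \<le> ?m" using True by linarith
      then have "lam * (real s - real (card \<tau>)) \<le> lam * ?m"
        using lam by (intro mult_left_mono) simp_all
      also have "\<dots> \<le> (real n * C_min X \<tau>\<^sub>0 \<beta>\<^sub>0 / 20) * ?m"
        using H3 by (intro mult_right_mono) simp_all
      also have "\<dots> = K \<tau> / 20" by (simp add: K_def)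
      finally have pen: "- (K \<tau> / 20) \<le> lam * (real (card \<tau>) - real s)"
        by (simp add: right_diff_distrib)
      have "repro_crit X lam (Y u) (vec n w) \<tau> - repro_crit X lam (Y u) (vec n w) \<tau>\<^sub>0
        \<ge> (norm (\<nu> \<tau>))\<^sup>2 + 2 * \<sigma>\<^sub>0 * inner (\<nu> \<tau>) (emb n u) - \<sigma>\<^sub>0\<^sup>2 * Q \<tau> u + lam * (real (card \<tau>) - real s)"
        using DN[OF \<tau>(1)] unfolding gap_vectors_def Q_def by (elim conjE allE)
      then show ?thesis using big pen by linarith
    next
      case False
      then have "\<tau> \<in> overfit" using \<tau> by simp
      from out(2)[OF this] have "Q \<tau> u < (real (card \<tau>) - real s) * (lam / \<sigma>\<^sub>0\<^sup>2)"
        using u(1) by (simp add: B4_def)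
      then have "\<sigma>\<^sub>0\<^sup>2 * Q \<tau> u < \<sigma>\<^sub>0\<^sup>2 * ((real (card \<tau>) - real s) * (lam / \<sigma>\<^sub>0\<^sup>2))"
        using s2 by (intro mult_strict_left_mono)
      then have "\<sigma>\<^sub>0\<^sup>2 * Q \<tau> u < lam * (real (card \<tau>) - real s)"
        using s2 by (simp add: mult.commute)
      moreover have "repro_crit X lam (Y u) (vec n w) \<tau> - repro_crit X lam (Y u) (vec n w) \<tau>\<^sub>0
        \<ge> - \<sigma>\<^sub>0\<^sup>2 * Q \<tau> u + lam * (real (card \<tau>) - real s)"
        using DN[OF \<tau>(1)] unfolding gap_vectors_def Q_def by (elim conjE allE)
      ultimately show ?thesis by simp
    qed
    from tau_hat_eq[OF this] u(2) show False by simp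
  qed
  have DN': "orthonormal (D \<tau>)" "D \<tau> \<subseteq> eucl n" "card (D \<tau>) \<le> card \<tau>" "\<nu> \<tau> \<in> eucl n" if "\<tau> \<subseteq> {..<p}" for \<tau>
  proof -
    have "card (\<tau> - \<tau>\<^sub>0) \<le> card \<tau>" using finite_model[OF X that] by (intro card_mono) auto
    then show "card (D \<tau>) \<le> card \<tau>" using DN[OF that] unfolding gap_vectors_def by linarith
    show "orthonormal (D \<tau>)" "D \<tau> \<subseteq> eucl n" "\<nu> \<tau> \<in> eucl n"
      using DN[OF that] by (simp_all only: gap_vectors_def)
  qed
  have sq1: "1 \<le> sqrt (2::real)" by simp
  have b2: "P.prob (B2 \<tau>) \<le> exp (- ?\<kappa> / 90)" if \<tau>: "\<tau> \<in> underfit" for \<tau>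
  proof -
    have z: "0 < sqrt (K \<tau> / 45) / \<sigma>\<^sub>0" using Kpos \<sigma>\<^sub>0 by simp
    have "P.prob (B2 \<tau>) \<le> exp (- (sqrt (K \<tau> / 45) / \<sigma>\<^sub>0)\<^sup>2 / 2)"
      unfolding B2_def using \<tau> by (intro gauss_tail_inner DN' z) simp
    also have "(sqrt (K \<tau> / 45) / \<sigma>\<^sub>0)\<^sup>2 = (K \<tau> / \<sigma>\<^sub>0\<^sup>2) / 45"
      using Kpos[of \<tau>] by (simp add: power_divide)
    also have "exp (- ((K \<tau> / \<sigma>\<^sub>0\<^sup>2) / 45) / 2) \<le> exp (- ?\<kappa> / 90)"
    proof -
      have "- (x / 45) / 2 \<le> - y / 90" if "y \<le> x" for x y :: real using that by simp
      from this[OF K\<kappa>[of \<tau>]] show ?thesis by (simp only: exp_le_cancel_iff)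
    qed
    finally show ?thesis .
  qed
  have b3: "P.prob (B3 \<tau>) \<le> sqrt 2 ^ s * exp (- ?\<kappa> / 40)" if \<tau>: "\<tau> \<in> underfit" for \<tau>
  proof -
    have "P.prob (B3 \<tau>) \<le> sqrt 2 ^ card (D \<tau>) * exp (- (K \<tau> / (10 * \<sigma>\<^sub>0\<^sup>2)) / 4)"
      unfolding B3_def Q_def using \<tau> by (intro gauss_tail_sum_squares DN') simp_all
    also have "\<dots> \<le> sqrt 2 ^ s * exp (- ?\<kappa> / 40)"
    proof (rule mult_mono)
      have "card (D \<tau>) \<le> s" using DN'(3)[of \<tau>] \<tau> by simp
      then show "sqrt 2 ^ card (D \<tau>) \<le> sqrt (2::real) ^ s" by (rule power_increasing[OF _ sq1])
      have "K \<tau> / (10 * \<sigma>\<^sub>0\<^sup>2) = (K \<tau> / \<sigma>\<^sub>0\<^sup>2) / 10" by simp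
      moreover have "- (x / 10) / 4 \<le> - y / 40" if "y \<le> x" for x y :: real using that by simp
      ultimately show "exp (- (K \<tau> / (10 * \<sigma>\<^sub>0\<^sup>2)) / 4) \<le> exp (- ?\<kappa> / 40)"
        using K\<kappa>[of \<tau>] by (simp only: exp_le_cancel_iff)
    qed simp_all
    finally show ?thesis .
  qed
  have b4: "P.prob (B4 \<tau>) \<le> sqrt 2 ^ card \<tau> * exp (- ((real (card \<tau>) - real s) * (lam / \<sigma>\<^sub>0\<^sup>2)) / 4)"
    if \<tau>: "\<tau> \<in> overfit" for \<tau>
  proof -
    have "P.prob (B4 \<tau>) \<le> sqrt 2 ^ card (D \<tau>) * exp (- ((real (card \<tau>) - real s) * (lam / \<sigma>\<^sub>0\<^sup>2)) / 4)"
      unfolding B4_def Q_def using \<tau> by (intro gauss_tail_sum_squares DN') simp_all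
    also have "\<dots> \<le> sqrt 2 ^ card \<tau> * exp (- ((real (card \<tau>) - real s) * (lam / \<sigma>\<^sub>0\<^sup>2)) / 4)"
      using DN'(3)[of \<tau>] \<tau> by (intro mult_right_mono power_increasing[OF _ sq1]) simp_all
    finally show ?thesis .
  qed
  have fu: "finite underfit" and fo: "finite overfit" by (rule finite_models)+
  have cu: "real (card underfit) \<le> real ((p + 1) ^ s)"
  proof -
    have "card underfit \<le> card {\<tau>. \<tau> \<subseteq> {..<p} \<and> card \<tau> \<le> s}"
      by (intro card_mono finite_models) auto
    also have "\<dots> \<le> (p + 1) ^ s" by (rule card_models_le)
    finally show ?thesis by (simp only: of_nat_le_iff)
  qed
  have p1: "1 \<le> p" using s_pos s_le_p by simp
  have u2: "P.prob (\<Union>\<tau>\<in>underfit. B2 \<tau>) \<le> exp (- a / 36)"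
  proof -
    have "P.prob (\<Union>\<tau>\<in>underfit. B2 \<tau>) \<le> (\<Sum>\<tau>\<in>underfit. P.prob (B2 \<tau>))"
      using meas by (intro P.finite_measure_subadditive_finite fu) blast
    also have "\<dots> \<le> (\<Sum>\<tau>\<in>underfit. exp (- ?\<kappa> / 90))" by (rule sum_mono[OF b2])
    also have "\<dots> = real (card underfit) * exp (- ?\<kappa> / 90)" by (rule sum_constant)
    also have "\<dots> \<le> real ((p + 1) ^ s) * exp (- ?\<kappa> / 90)" using cu by (rule mult_right_mono) simp
    also have "\<dots> \<le> exp (- a / 36)" by (rule underfit_total(1)[OF p1 a H1])
    finally show ?thesis .
  qed
  have u3: "P.prob (\<Union>\<tau>\<in>underfit. B3 \<tau>) \<le> exp (- a / 36)"
  proof -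
    have "P.prob (\<Union>\<tau>\<in>underfit. B3 \<tau>) \<le> (\<Sum>\<tau>\<in>underfit. P.prob (B3 \<tau>))"
      using meas by (intro P.finite_measure_subadditive_finite fu) blast
    also have "\<dots> \<le> (\<Sum>\<tau>\<in>underfit. sqrt 2 ^ s * exp (- ?\<kappa> / 40))" by (rule sum_mono[OF b3])
    also have "\<dots> = real (card underfit) * (sqrt 2 ^ s * exp (- ?\<kappa> / 40))" by (rule sum_constant)
    also have "\<dots> \<le> real ((p + 1) ^ s) * (sqrt 2 ^ s * exp (- ?\<kappa> / 40))" using cu by (rule mult_right_mono) simp
    also have "\<dots> \<le> exp (- a / 36)" by (rule underfit_total(2)[OF p1 a H1])
    finally show ?thesis .
  qed
  have u4: "P.prob (\<Union>\<tau>\<in>overfit. B4 \<tau>) \<le> 2 * (4 ^ 16 * exp (- a / 4))"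
  proof -
    have "P.prob (\<Union>\<tau>\<in>overfit. B4 \<tau>) \<le> (\<Sum>\<tau>\<in>overfit. P.prob (B4 \<tau>))"
      using meas by (intro P.finite_measure_subadditive_finite fo) blast
    also have "\<dots> \<le> (\<Sum>\<tau>\<in>overfit. sqrt 2 ^ card \<tau> * exp (- ((real (card \<tau>) - real s) * (lam / \<sigma>\<^sub>0\<^sup>2)) / 4))"
      by (rule sum_mono[OF b4])
    also have "\<dots> \<le> 2 * (4 ^ 16 * exp (- a / 4))" by (rule overfit_sum[OF H2 H4])
    finally show ?thesis .
  qed
  have m2: "(\<Union>\<tau>\<in>underfit. B2 \<tau>) \<in> sets ?\<gamma>" "(\<Union>\<tau>\<in>underfit. B3 \<tau>) \<in> sets ?\<gamma>" "(\<Union>\<tau>\<in>overfit. B4 \<tau>) \<in> sets ?\<gamma>"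
    using meas fu fo by (auto intro!: sets.finite_UN)
  have "P.prob {u \<in> space ?\<gamma>. tau_hat sel X lam (Y u) (vec n w) \<noteq> \<tau>\<^sub>0}
    \<le> P.prob ((\<Union>\<tau>\<in>underfit. B2 \<tau>) \<union> (\<Union>\<tau>\<in>underfit. B3 \<tau>) \<union> (\<Union>\<tau>\<in>overfit. B4 \<tau>))"
    using m2 by (intro P.finite_measure_mono cover sets.Un)
  also have "\<dots> \<le> P.prob ((\<Union>\<tau>\<in>underfit. B2 \<tau>) \<union> (\<Union>\<tau>\<in>underfit. B3 \<tau>)) + P.prob (\<Union>\<tau>\<in>overfit. B4 \<tau>)"
    using m2 by (intro measure_Un_le) auto
  also have "P.prob ((\<Union>\<tau>\<in>underfit. B2 \<tau>) \<union> (\<Union>\<tau>\<in>underfit. B3 \<tau>))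
    \<le> P.prob (\<Union>\<tau>\<in>underfit. B2 \<tau>) + P.prob (\<Union>\<tau>\<in>underfit. B3 \<tau>)"
    using m2 by (intro measure_Un_le) auto
  finally show ?thesis using u2 u3 u4 by linarith
qed

text \<open>Fubini with the artificial noise outermost: the alignment set \<open>T\<close> costs its
  own probability, and off \<open>T\<close> the bound for fixed noise holds uniformly.\<close>

lemma selection_error:
  assumes C: "0 < C_min X \<tau>\<^sub>0 \<beta>\<^sub>0" and a: "0 \<le> a"
    and H1: "90 * ((real s + 2) * ln (real p + 1)) + 5 / 2 * a \<le> real n * C_min X \<tau>\<^sub>0 \<beta>\<^sub>0 / \<sigma>\<^sub>0\<^sup>2"
    and H2: "6 * (real s + 1) * ln (real p / 2) + a \<le> lam / \<sigma>\<^sub>0\<^sup>2"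
    and H3: "lam \<le> real n * C_min X \<tau>\<^sub>0 \<beta>\<^sub>0 / 20"
    and H4: "4 ^ 16 * exp (- a / 4) \<le> 1 / 2"
    and H5: "real s \<le> real n / 4" "s < n" "real s * ln (real p) \<le> 0.23 * real n"
    and N: "{z \<in> space (std_gauss n \<Otimes>\<^sub>M std_gauss n). tau_hat sel X lam (Y (fst z)) (vec n (snd z)) \<noteq> \<tau>\<^sub>0}
      \<in> sets (std_gauss n \<Otimes>\<^sub>M std_gauss n)" (is "?N \<in> _")
  shows "measure (std_gauss n \<Otimes>\<^sub>M std_gauss n) ?N
    \<le> 6 * exp (- real n / 50) + 2 * exp (- a / 36) + 2 * (4 ^ 16 * exp (- a / 4))"
proof -
  interpret P: prob_space "std_gauss n" by (rule prob_space_std_gauss)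
  interpret PP: pair_prob_space "std_gauss n" "std_gauss n" ..
  let ?\<gamma> = "std_gauss n"
  define \<epsilon> where "\<epsilon> = 2 * exp (- a / 36) + 2 * (4 ^ 16 * exp (- a / 4))"
  have \<epsilon>: "0 \<le> \<epsilon>" by (simp add: \<epsilon>_def)
  have "\<forall>\<tau>\<in>underfit. \<exists>S. S \<in> sets ?\<gamma> \<and> measure ?\<gamma> S \<le> sqrt 2 * (1 / sqrt 2) ^ (n - s - 1)
      \<and> (\<forall>w v. w \<in> space ?\<gamma> - S \<longrightarrow> v \<in> span (insert (emb n w) (xcol X ` \<tau>)) \<longrightarrow> K \<tau> / 3 \<le> (norm (\<mu> - v))\<^sup>2)"
  proof
    fix \<tau> assume \<tau>: "\<tau> \<in> underfit"
    show "\<exists>S. S \<in> sets ?\<gamma> \<and> measure ?\<gamma> S \<le> sqrt 2 * (1 / sqrt 2) ^ (n - s - 1)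
      \<and> (\<forall>w v. w \<in> space ?\<gamma> - S \<longrightarrow> v \<in> span (insert (emb n w) (xcol X ` \<tau>)) \<longrightarrow> K \<tau> / 3 \<le> (norm (\<mu> - v))\<^sup>2)"
    proof (rule alignment_event[OF \<tau> C], goal_cases)
      case (1 S)
      then show ?case by (intro exI[of _ S] conjI allI impI) simp_all
    qed
  qed
  from bchoice[OF this] obtain S where S0: "\<forall>\<tau>\<in>underfit. S \<tau> \<in> sets ?\<gamma>
      \<and> measure ?\<gamma> (S \<tau>) \<le> sqrt 2 * (1 / sqrt 2) ^ (n - s - 1)
      \<and> (\<forall>w v. w \<in> space ?\<gamma> - S \<tau> \<longrightarrow> v \<in> span (insert (emb n w) (xcol X ` \<tau>)) \<longrightarrow> K \<tau> / 3 \<le> (norm (\<mu> - v))\<^sup>2)"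
    by (rule exE)
  have S: "S \<tau> \<in> sets ?\<gamma>" "measure ?\<gamma> (S \<tau>) \<le> sqrt 2 * (1 / sqrt 2) ^ (n - s - 1)"
    if "\<tau> \<in> underfit" for \<tau>
    using bspec[OF S0 that] by (rule conjunct1, elim conjE)
  have S': "K \<tau> / 3 \<le> (norm (\<mu> - v))\<^sup>2"
    if "\<tau> \<in> underfit" "w \<in> space ?\<gamma> - S \<tau>" "v \<in> span (insert (emb n w) (xcol X ` \<tau>))" for \<tau> w v
    using bspec[OF S0 that(1), THEN conjunct2, THEN conjunct2] that(2,3) by (elim allE impE)
  define T where "T = (\<Union>\<tau>\<in>underfit. S \<tau>)"
  have fu: "finite underfit" by (rule finite_models)
  have T: "T \<in> sets ?\<gamma>" unfolding T_def using S(1) fu by (intro sets.finite_UN) auto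
  have p1: "1 \<le> p" using s_pos s_le_p by simp
  have PT: "P.prob T \<le> 6 * exp (- real n / 50)"
  proof -
    let ?c = "sqrt 2 * (1 / sqrt 2) ^ (n - s - 1) :: real"
    have "P.prob T \<le> (\<Sum>\<tau>\<in>underfit. P.prob (S \<tau>))"
      unfolding T_def using S(1) by (intro P.finite_measure_subadditive_finite fu) blast
    also have "\<dots> \<le> (\<Sum>\<tau>\<in>underfit. ?c)" by (rule sum_mono[OF S(2)])
    also have "\<dots> = real (card underfit) * ?c" by (rule sum_constant)
    also have "\<dots> \<le> real ((p + 1) ^ s) * ?c"
    proof (rule mult_right_mono)
      have "card underfit \<le> card {\<tau>. \<tau> \<subseteq> {..<p} \<and> card \<tau> \<le> s}"
        by (intro card_mono finite_models) auto
      also have "\<dots> \<le> (p + 1) ^ s" by (rule card_models_le)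
      finally show "real (card underfit) \<le> real ((p + 1) ^ s)" by (simp only: of_nat_le_iff)
    qed simp
    also have "\<dots> \<le> 6 * exp (- real n / 50)" by (rule small_residual_total[OF p1 s_le_p H5])
    finally show ?thesis .
  qed
  have sec: "emeasure ?\<gamma> ((\<lambda>u. (u, w)) -` ?N) \<le> indicator T w + ennreal \<epsilon>" if w: "w \<in> space ?\<gamma>" for w
  proof (cases "w \<in> T")
    case True
    have "emeasure ?\<gamma> ((\<lambda>u. (u, w)) -` ?N) \<le> 1" by (rule P.emeasure_le_1)
    then show ?thesis using True by (simp add: add_increasing2)
  next
    case False
    have "(\<lambda>u. (u, w)) -` ?N = {u \<in> space ?\<gamma>. tau_hat sel X lam (Y u) (vec n w) \<noteq> \<tau>\<^sub>0}"
      using w by (auto simp: space_pair_measure)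
    moreover have "P.prob {u \<in> space ?\<gamma>. tau_hat sel X lam (Y u) (vec n w) \<noteq> \<tau>\<^sub>0} \<le> \<epsilon>"
      unfolding \<epsilon>_def
    proof (rule selection_error_given[OF C a H1 H2 H3 H4])
      fix \<tau> v assume \<tau>: "\<tau> \<in> underfit" and v: "v \<in> span (insert (emb n w) (xcol X ` \<tau>))"
      have "w \<in> space ?\<gamma> - S \<tau>" using w False \<tau> by (auto simp: T_def)
      from S'[OF \<tau> this v] show "K \<tau> / 3 \<le> (norm (\<mu> - v))\<^sup>2" .
    qed
    ultimately show ?thesis
      using False by (simp add: P.emeasure_eq_measure ennreal_leI)
  qed
  have "emeasure (?\<gamma> \<Otimes>\<^sub>M ?\<gamma>) ?N = (\<integral>\<^sup>+w. emeasure ?\<gamma> ((\<lambda>u. (u, w)) -` ?N) \<partial>?\<gamma>)"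
    by (rule PP.emeasure_pair_measure_alt2[OF N])
  also have "\<dots> \<le> (\<integral>\<^sup>+w. indicator T w + ennreal \<epsilon> \<partial>?\<gamma>)"
    by (rule nn_integral_mono) (rule sec)
  also have "\<dots> = emeasure ?\<gamma> T + ennreal \<epsilon>"
    using T by (subst nn_integral_add) (simp_all add: P.emeasure_space_1)
  also have "\<dots> \<le> ennreal (6 * exp (- real n / 50)) + ennreal \<epsilon>"
    using PT by (intro add_mono) (simp_all add: P.emeasure_eq_measure)
  also have "\<dots> = ennreal (6 * exp (- real n / 50) + \<epsilon>)"
    using \<epsilon> by (intro ennreal_plus[symmetric]) simp_all
  finally have "measure (?\<gamma> \<Otimes>\<^sub>M ?\<gamma>) ?N \<le> 6 * exp (- real n / 50) + \<epsilon>"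
    unfolding PP.emeasure_eq_measure using \<epsilon> by (subst (asm) ennreal_le_iff) simp_all
  then show ?thesis by (simp only: \<epsilon>_def add.assoc)
qed

end

section \<open>The exact law of the test statistic\<close>

text \<open>If the distribution function were below \<alpha> at the quantile, right continuity would
  keep it below \<alpha> on an interval to the right, against the choice of the infimum.\<close>

lemma (in real_distribution) cdf_quantile:
  assumes "0 < \<alpha>" "\<alpha> < 1"
  shows "\<alpha> \<le> cdf M (quantile M \<alpha>)"
proof (rule ccontr)
  let ?S = "{x. \<alpha> \<le> cdf M x}" and ?q = "quantile M \<alpha>"
  assume "\<not> \<alpha> \<le> cdf M ?q"
  then have lt: "cdf M ?q < \<alpha>" by simp
  have "\<forall>\<^sub>F x in at_top. \<alpha> < cdf M x"
    using cdf_lim_at_top_prob assms(2) by (rule order_tendstoD(1))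
  then obtain x where "\<alpha> < cdf M x" by (rule eventually_happens'[OF trivial_limit_at_top_linorder, THEN exE])
  then have ne: "?S \<noteq> {}" by (auto intro: less_imp_le)
  have "continuous (at_right ?q) (cdf M)" by (rule cdf_is_right_cont)
  then have "(cdf M \<longlongrightarrow> cdf M ?q) (at_right ?q)" by (simp add: continuous_within)
  then have "\<forall>\<^sub>F x in at_right ?q. cdf M x < \<alpha>" using lt by (rule order_tendstoD(2))
  then obtain b where b: "?q < b" "\<And>y. ?q < y \<Longrightarrow> y < b \<Longrightarrow> cdf M y < \<alpha>"
    unfolding eventually_at_right_field by blast
  define y where "y = (?q + b) / 2"
  have y: "?q < y" "y < b" using b(1) by (simp_all add: y_def)
  have "y \<le> x" if "x \<in> ?S" for x
  proof (rule ccontr)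
    assume "\<not> y \<le> x"
    then have "cdf M x \<le> cdf M y" by (intro cdf_nondecreasing) simp
    then show False using that b(2)[OF y] by simp
  qed
  then have "y \<le> Inf ?S" by (intro cInf_greatest ne)
  then show False using y(1) by (simp add: quantile_def)
qed

lemma distr_sum_squares:
  assumes "finite D"
  shows "distr (Pi\<^sub>M D (\<lambda>_. std_normal_distribution)) borel (\<lambda>z. \<Sum>d\<in>D. (z d)\<^sup>2) = chi_square_distr (card D)"
proof -
  let ?N = std_normal_distribution
  obtain e where e: "bij_betw e {..<card D} D"
    using ex_bij_betw_nat_finite[OF assms] by (auto simp: atLeast0LessThan)
  have eD: "i < card D \<Longrightarrow> e i \<in> D" for i using e by (auto simp: bij_betw_def)
  have [measurable]: "(\<lambda>\<omega>. \<lambda>i\<in>{..<card D}. \<omega> (e i)) \<in> Pi\<^sub>M D (\<lambda>_. ?N) \<rightarrow>\<^sub>M Pi\<^sub>M {..<card D} (\<lambda>_. ?N)"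
    using eD by (intro measurable_restrict measurable_component_singleton) simp
  have re: "distr (Pi\<^sub>M D (\<lambda>_. ?N)) (Pi\<^sub>M {..<card D} (\<lambda>_. ?N)) (\<lambda>\<omega>. \<lambda>i\<in>{..<card D}. \<omega> (e i)) = Pi\<^sub>M {..<card D} (\<lambda>_. ?N)"
    using e prob_space_std_normal
    by (intro distr_PiM_reindex[where M="\<lambda>_. std_normal_distribution"]) (auto simp: bij_betw_def)
  have "chi_square_distr (card D) = distr (Pi\<^sub>M D (\<lambda>_. ?N)) borel
      ((\<lambda>z. \<Sum>i<card D. (z i)\<^sup>2) \<circ> (\<lambda>\<omega>. \<lambda>i\<in>{..<card D}. \<omega> (e i)))"
    unfolding chi_square_distr_def by (subst re[symmetric], rule distr_distr) measurable
  also have "(\<lambda>z. \<Sum>i<card D. (z i)\<^sup>2) \<circ> (\<lambda>\<omega>. \<lambda>i\<in>{..<card D}. \<omega> (e i)) = (\<lambda>z. \<Sum>d\<in>D. (z d)\<^sup>2)"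
  proof
    fix z
    show "((\<lambda>z. \<Sum>i<card D. (z i)\<^sup>2) \<circ> (\<lambda>\<omega>. \<lambda>i\<in>{..<card D}. \<omega> (e i))) z = (\<Sum>d\<in>D. (z d)\<^sup>2)"
      using sum.reindex_bij_betw[OF e, of "\<lambda>d. (z d)\<^sup>2"] by simp
  qed
  finally show ?thesis ..
qed

text \<open>\<open>D\<close> and \<open>G\<close> are disjoint parts of one orthonormal set, so the
  two sums of squares are independent. A vanishing denominator is harmless, because
  \<open>F_distr\<close> is defined by the same total division.\<close>

lemma distr_F_ratio:
  assumes D: "orthonormal (D \<union> G)" "D \<union> G \<subseteq> eucl n" "D \<inter> G = {}"
  shows "distr (std_gauss n) borel
      (\<lambda>u. ((\<Sum>d\<in>D. (inner d (emb n u))\<^sup>2) / real (card D)) / ((\<Sum>g\<in>G. (inner g (emb n u))\<^sup>2) / real (card G)))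
    = F_distr (card D) (card G)"
proof -
  let ?N = std_normal_distribution and ?\<gamma> = "std_gauss n"
  let ?P = "\<lambda>I. Pi\<^sub>M I (\<lambda>_::fvec. ?N)"
  have fin: "finite D" "finite G" using orthonormal_eucl(1)[OF D(1,2)] by simp_all
  interpret product_sigma_finite "\<lambda>_::fvec. ?N"
    unfolding product_sigma_finite_def
    using prob_space_std_normal prob_space.axioms(1) finite_measure.axioms(1) by blast
  let ?q = "\<lambda>I z. \<Sum>d\<in>I. (z d)\<^sup>2 :: real"
  let ?r = "\<lambda>u. \<lambda>d\<in>D \<union> G. inner d (emb n u)"
  let ?h = "\<lambda>z. (?q D z / real (card D)) / (?q G z / real (card G))"
  have sP: "sets (?P I) = sets (Pi\<^sub>M I (\<lambda>_. borel))" for I by (intro sets_PiM_cong) simp_all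
  have [measurable]: "?q I \<in> borel_measurable (?P J)" if "I \<subseteq> J" for I J
    using that by (intro borel_measurable_sum borel_measurable_power) (auto intro!: measurable_component_singleton)
  have hm: "?h \<in> borel_measurable (?P (D \<union> G))" by measurable
  have rm: "?r \<in> ?\<gamma> \<rightarrow>\<^sub>M Pi\<^sub>M (D \<union> G) (\<lambda>_. borel)" by measurable
  have rm': "?r \<in> ?\<gamma> \<rightarrow>\<^sub>M ?P (D \<union> G)" using rm by (simp cong: measurable_cong_sets add: sP)
  have law: "distr ?\<gamma> (?P (D \<union> G)) ?r = ?P (D \<union> G)"
  proof -
    have "distr ?\<gamma> (?P (D \<union> G)) ?r = distr ?\<gamma> (Pi\<^sub>M (D \<union> G) (\<lambda>_. borel)) ?r"
      by (intro distr_cong refl sP)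
    then show ?thesis by (simp only: distr_inner_orthonormal[OF D(1,2)])
  qed
  have "distr ?\<gamma> borel (\<lambda>u. ((\<Sum>d\<in>D. (inner d (emb n u))\<^sup>2) / real (card D)) / ((\<Sum>g\<in>G. (inner g (emb n u))\<^sup>2) / real (card G)))
      = distr ?\<gamma> borel (?h \<circ> ?r)"
    by (intro distr_cong refl) simp
  also have "\<dots> = distr (?P (D \<union> G)) borel ?h"
    by (subst distr_distr[OF hm rm', symmetric]) (simp only: law)
  also have "\<dots> = distr (?P D \<Otimes>\<^sub>M ?P G) borel (?h \<circ> merge D G)"
    by (subst distr_merge[OF D(3) fin, symmetric], rule distr_distr[OF hm measurable_merge])
  also have "\<dots> = distr (?P D \<Otimes>\<^sub>M ?P G) borel
      ((\<lambda>(a, b). (a / real (card D)) / (b / real (card G))) \<circ> (\<lambda>(x, y). (?q D x, ?q G y)))"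
  proof (intro distr_cong refl)
    fix z assume "z \<in> space (?P D \<Otimes>\<^sub>M ?P G)"
    have "?q D (merge D G z) = ?q D (fst z)" by (intro sum.cong refl) (simp add: merge_def case_prod_beta')
    moreover have "?q G (merge D G z) = ?q G (snd z)"
      using D(3) by (intro sum.cong refl) (auto simp: merge_def case_prod_beta')
    ultimately show "(?h \<circ> merge D G) z
      = ((\<lambda>(a, b). (a / real (card D)) / (b / real (card G))) \<circ> (\<lambda>(x, y). (?q D x, ?q G y))) z"
      by (simp add: case_prod_beta')
  qed
  also have "\<dots> = distr (distr (?P D \<Otimes>\<^sub>M ?P G) (borel \<Otimes>\<^sub>M borel) (\<lambda>(x, y). (?q D x, ?q G y))) borel
      (\<lambda>(a, b). (a / real (card D)) / (b / real (card G)))"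
    by (rule distr_distr[symmetric]) measurable
  also have "distr (?P D \<Otimes>\<^sub>M ?P G) (borel \<Otimes>\<^sub>M borel) (\<lambda>(x, y). (?q D x, ?q G y))
      = distr (?P D) borel (?q D) \<Otimes>\<^sub>M distr (?P G) borel (?q G)"
  proof (rule pair_measure_distr[symmetric])
    have "prob_space (distr (?P G) borel (?q G))"
      by (intro prob_space.prob_space_distr prob_space_PiM prob_space_std_normal) measurable
    then show "sigma_finite_measure (distr (?P G) borel (?q G))"
      by (intro finite_measure.axioms(1) prob_space.axioms(1))
  qed measurable
  finally show ?thesis
    unfolding F_distr_def distr_sum_squares[OF fin(1)] distr_sum_squares[OF fin(2)] .
qed

lemma F_quantile_coverage:
  assumes D: "orthonormal (D \<union> G)" "D \<union> G \<subseteq> eucl n" "D \<inter> G = {}" and \<alpha>: "0 < \<alpha>" "\<alpha> < 1"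
  shows "\<alpha> \<le> measure (std_gauss n) {u \<in> space (std_gauss n).
    ((\<Sum>d\<in>D. (inner d (emb n u))\<^sup>2) / real (card D)) / ((\<Sum>g\<in>G. (inner g (emb n u))\<^sup>2) / real (card G))
      \<le> quantile (F_distr (card D) (card G)) \<alpha>}"
proof -
  let ?f = "\<lambda>u. ((\<Sum>d\<in>D. (inner d (emb n u))\<^sup>2) / real (card D)) / ((\<Sum>g\<in>G. (inner g (emb n u))\<^sup>2) / real (card G))"
  let ?F = "F_distr (card D) (card G)"
  have m: "?f \<in> borel_measurable (std_gauss n)" by measurable
  have F: "?F = distr (std_gauss n) borel ?f" by (rule distr_F_ratio[OF D, symmetric])
  have "real_distribution ?F"
    unfolding F by (rule prob_space.real_distribution_distr[OF prob_space_std_gauss m])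
  then have "\<alpha> \<le> cdf ?F (quantile ?F \<alpha>)" using \<alpha> by (rule real_distribution.cdf_quantile)
  also have "\<dots> = measure (std_gauss n) (?f -` {..quantile ?F \<alpha>} \<inter> space (std_gauss n))"
    by (subst F, unfold cdf_def, rule measure_distr[OF m]) simp
  also have "?f -` {..quantile ?F \<alpha>} \<inter> space (std_gauss n)
      = {u \<in> space (std_gauss n). ?f u \<le> quantile ?F \<alpha>}" by auto
  finally show ?thesis .
qed

section \<open>The test statistic in terms of projections\<close>

lemma xcol_mult:
  assumes "A \<in> carrier_mat n m" "B \<in> carrier_mat m k" "j < k"
  shows "xcol (A * B) j = of_vec (A *\<^sub>v col B j)"
  unfolding xcol_def using assms by (simp add: col_mult2[of A n m B k j])

lemma minus_mult_vec:
  fixes A :: "real mat"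
  assumes "A \<in> carrier_mat n n" "v \<in> carrier_vec n"
  shows "(1\<^sub>m n - A) *\<^sub>v v = v - A *\<^sub>v v"
  using assms by (simp add: minus_mult_distrib_mat_vec[of _ n n])

lemma hat_mat_oproj:
  assumes X: "X \<in> carrier_mat n p" and \<tau>: "\<tau> \<subseteq> {..<p}"
    and C: "orthonormal C" "finite C" "span C = span (xcol X ` \<tau>)"
  shows "hat_mat X \<tau> \<in> carrier_mat n n"
    and "y \<in> carrier_vec n \<Longrightarrow> of_vec (hat_mat X \<tau> *\<^sub>v y) = oproj C (of_vec y)"
proof -
  have "span C = span (xcol (cols_at X \<tau>) ` {..<card \<tau>})"
    unfolding xcol_image_cols_at[OF X \<tau>] by (rule C(3))
  from col_proj_oproj[OF cols_at_carrier[OF X \<tau>] C(1,2) this]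
  show "hat_mat X \<tau> \<in> carrier_mat n n"
    "y \<in> carrier_vec n \<Longrightarrow> of_vec (hat_mat X \<tau> *\<^sub>v y) = oproj C (of_vec y)"
    unfolding hat_mat_def .
qed

context
  fixes X :: "real mat" and n p :: nat and \<tau> \<Lambda> :: "nat set"
  assumes X: "X \<in> carrier_mat n p" and \<tau>: "\<tau> \<subseteq> {..<p}" and \<Lambda>: "\<Lambda> \<subseteq> {..<p}"
begin

text \<open>The columns of the product matrix are the residuals b - oproj C b of the tested columns,
  so its column space is the \<open>span D\<close> delivered by
  \<open>orthonormal_extend\<close>.\<close>

lemma O_mat_oproj:
  assumes C: "orthonormal C" "finite C" "span C = span (xcol X ` (\<tau> - \<Lambda>))"
    and D: "orthonormal D" "finite D" "span D = span ((\<lambda>b. b - oproj C b) ` xcol X ` (\<Lambda> \<inter> \<tau>))"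
  shows "O_mat X \<tau> \<Lambda> \<in> carrier_mat n n"
    and "y \<in> carrier_vec n \<Longrightarrow> of_vec (O_mat X \<tau> \<Lambda> *\<^sub>v y) = oproj D (of_vec y)"
proof -
  have sub: "\<tau> - \<Lambda> \<subseteq> {..<p}" "\<Lambda> \<inter> \<tau> \<subseteq> {..<p}" using \<tau> by auto
  let ?H = "hat_mat X (\<tau> - \<Lambda>)" and ?B = "cols_at X (\<Lambda> \<inter> \<tau>)" and ?k = "card (\<Lambda> \<inter> \<tau>)"
  note H = hat_mat_oproj[OF X sub(1) C]
  have B: "?B \<in> carrier_mat n ?k" by (rule cols_at_carrier[OF X sub(2)])
  have I: "1\<^sub>m n - ?H \<in> carrier_mat n n" by (rule minus_carrier_mat[OF H(1)])
  have M: "(1\<^sub>m n - ?H) * ?B \<in> carrier_mat n ?k" using I B by simp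
  have col: "xcol ((1\<^sub>m n - ?H) * ?B) j = xcol ?B j - oproj C (xcol ?B j)" if j: "j < ?k" for j
  proof -
    have c: "col ?B j \<in> carrier_vec n" using B j by simp
    have "xcol ((1\<^sub>m n - ?H) * ?B) j = of_vec (col ?B j - ?H *\<^sub>v col ?B j)"
      unfolding xcol_mult[OF I B j] minus_mult_vec[OF H(1) c] ..
    also have "\<dots> = of_vec (col ?B j) - of_vec (?H *\<^sub>v col ?B j)"
      by (rule of_vec_minus[OF c mult_mat_vec_carrier[OF H(1) c]])
    finally show ?thesis unfolding H(2)[OF c] by (simp only: xcol_def)
  qed
  have "xcol ((1\<^sub>m n - ?H) * ?B) ` {..<?k} = (\<lambda>b. b - oproj C b) ` xcol ?B ` {..<?k}"
    unfolding image_image using col by (intro image_cong) simp_all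
  then have "span D = span (xcol ((1\<^sub>m n - ?H) * ?B) ` {..<?k})"
    unfolding D(3) xcol_image_cols_at[OF X sub(2)] by simp
  from col_proj_oproj[OF M D(1,2) this]
  show "O_mat X \<tau> \<Lambda> \<in> carrier_mat n n"
    "y \<in> carrier_vec n \<Longrightarrow> of_vec (O_mat X \<tau> \<Lambda> *\<^sub>v y) = oproj D (of_vec y)"
    using X unfolding O_mat_def by simp_all
qed

lemma T_stat_formula:
  assumes C: "orthonormal C" "finite C" "span C = span (xcol X ` (\<tau> - \<Lambda>))"
    and D: "orthonormal D" "finite D" "span D = span ((\<lambda>b. b - oproj C b) ` xcol X ` (\<Lambda> \<inter> \<tau>))"
    and H: "orthonormal H" "finite H" "span H = span (xcol X ` \<tau>)"
    and y: "y \<in> carrier_vec n" and b: "b \<in> carrier_vec (card \<Lambda>)"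
    and r: "r = of_vec y - of_vec (cols_at X \<Lambda> *\<^sub>v b)"
  shows "T_stat X \<Lambda> y b \<tau> = (if \<exists>i\<in>\<Lambda> - \<tau>. entry_at \<Lambda> b i \<noteq> 0 then \<infinity> else if \<Lambda> \<inter> \<tau> = {} then 0
    else ereal (((\<Sum>d\<in>D. (inner d r)\<^sup>2) / real (card (\<Lambda> \<inter> \<tau>)))
      / ((inner r r - (\<Sum>h\<in>H. (inner h r)\<^sup>2)) / (real n - real (card \<tau>)))))"
proof -
  define v where "v = y - cols_at X \<Lambda> *\<^sub>v b"
  have c: "cols_at X \<Lambda> *\<^sub>v b \<in> carrier_vec n" using cols_at_carrier[OF X \<Lambda>] b by simp
  have v: "v \<in> carrier_vec n" using y c by (simp add: v_def)
  have rv: "of_vec v = r" unfolding v_def r by (rule of_vec_minus[OF y c])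
  note O = O_mat_oproj[OF C D]
  note HH = hat_mat_oproj[OF X \<tau> H]
  have "scalar_prod v (O_mat X \<tau> \<Lambda> *\<^sub>v v) = inner r (oproj D r)"
    using inner_of_vec[of v n "O_mat X \<tau> \<Lambda> *\<^sub>v v"] O(1) v by (simp add: O(2)[OF v] rv)
  also have "\<dots> = (\<Sum>d\<in>D. (inner d r)\<^sup>2)" by (rule inner_oproj_self[OF D(1,2)])
  finally have 1: "scalar_prod v (O_mat X \<tau> \<Lambda> *\<^sub>v v) = (\<Sum>d\<in>D. (inner d r)\<^sup>2)" .
  have Hv: "hat_mat X \<tau> *\<^sub>v v \<in> carrier_vec n" using HH(1) v by simp
  have "scalar_prod v ((1\<^sub>m n - hat_mat X \<tau>) *\<^sub>v v) = inner (of_vec v) (of_vec (v - hat_mat X \<tau> *\<^sub>v v))"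
    unfolding minus_mult_vec[OF HH(1) v]
    by (rule inner_of_vec[symmetric, OF v minus_carrier_vec[OF v Hv]])
  also have "\<dots> = inner r r - inner r (oproj H r)"
    unfolding of_vec_minus[OF v Hv] HH(2)[OF v] rv by (rule inner_diff_right)
  also have "\<dots> = inner r r - (\<Sum>h\<in>H. (inner h r)\<^sup>2)" by (simp only: inner_oproj_self[OF H(1,2)])
  finally have 2: "scalar_prod v ((1\<^sub>m n - hat_mat X \<tau>) *\<^sub>v v) = inner r r - (\<Sum>h\<in>H. (inner h r)\<^sup>2)" .
  have "dim_row X = n" using X by simp
  then show ?thesis
    unfolding T_stat_def Let_def v_def[symmetric] by (simp only: 1 2)
qed

end

section \<open>Coverage for the true model\<close>

text \<open>Otherwise dropping column \<open>j\<close> would leave a smaller model that still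
  represents the mean.\<close>

lemma identifiable_not_in_span:
  assumes X: "X \<in> carrier_mat n p" and \<tau>\<^sub>0: "\<tau>\<^sub>0 \<subseteq> {..<p}" and \<beta>\<^sub>0: "\<beta>\<^sub>0 \<in> carrier_vec (card \<tau>\<^sub>0)"
    and id: "identifiable X \<tau>\<^sub>0 \<beta>\<^sub>0" and j: "j \<in> \<tau>\<^sub>0"
  shows "xcol X j \<notin> span (xcol X ` (\<tau>\<^sub>0 - {j}))"
proof
  let ?\<tau> = "\<tau>\<^sub>0 - {j}" and ?y = "cols_at X \<tau>\<^sub>0 *\<^sub>v \<beta>\<^sub>0"
  assume "xcol X j \<in> span (xcol X ` ?\<tau>)"
  then have "span (insert (xcol X j) (xcol X ` ?\<tau>)) = span (xcol X ` ?\<tau>)"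
    by (rule real_vector.span_redundant)
  moreover have "insert (xcol X j) (xcol X ` ?\<tau>) = xcol X ` \<tau>\<^sub>0" using j by blast
  ultimately have "of_vec ?y \<in> span (xcol X ` ?\<tau>)"
    using cols_at_in_span[OF X \<tau>\<^sub>0 \<beta>\<^sub>0] by simp
  moreover have sub: "?\<tau> \<subseteq> {..<p}" using \<tau>\<^sub>0 by blast
  ultimately obtain b where b: "b \<in> carrier_vec (card ?\<tau>)" "of_vec (cols_at X ?\<tau> *\<^sub>v b) = of_vec ?y"
    using span_cols_at[OF X sub] by metis
  have "cols_at X ?\<tau> *\<^sub>v b = ?y"
    by (rule of_vec_inj[OF _ _ b(2), of n])
      (use cols_at_carrier[OF X sub] cols_at_carrier[OF X \<tau>\<^sub>0] b(1) \<beta>\<^sub>0 in simp_all)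
  then have "?\<tau> \<in> representing_models X \<tau>\<^sub>0 \<beta>\<^sub>0"
    using sub b(1) X unfolding representing_models_def by auto
  moreover have "is_arg_min card (\<lambda>\<tau>. \<tau> \<in> representing_models X \<tau>\<^sub>0 \<beta>\<^sub>0) \<tau>\<^sub>0"
    using id unfolding identifiable_def by (metis mem_Collect_eq singletonI)
  ultimately have "\<not> card ?\<tau> < card \<tau>\<^sub>0" unfolding is_arg_min_def by blast
  moreover have "card ?\<tau> < card \<tau>\<^sub>0"
    using finite_model[OF X \<tau>\<^sub>0] j by (rule card_Diff1_less)
  ultimately show False by blast
qed

text \<open>Removing an index instead of a value also excludes repeated columns, so the rank is the
  number of indices.\<close>

lemma card_basis_of_independent_family:
  fixes f :: "'i \<Rightarrow> 'a::real_inner"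
  assumes f: "\<And>j. j \<in> I \<Longrightarrow> f j \<notin> span (f ` (I - {j}))" and C: "orthonormal C" "span C = span (f ` I)"
  shows "card C = card I"
proof -
  have inj: "inj_on f I"
  proof (rule inj_onI, rule ccontr)
    fix i j assume ij: "i \<in> I" "j \<in> I" "f i = f j" "i \<noteq> j"
    then have "f j \<in> f ` (I - {i})" by blast
    then have "f i \<in> span (f ` (I - {i}))" unfolding ij(3) by (rule span_base)
    then show False using f[OF ij(1)] by blast
  qed
  have "independent (f ` I)"
    unfolding real_vector.dependent_def
  proof
    assume "\<exists>a\<in>f ` I. a \<in> span (f ` I - {a})"
    then obtain j where j: "j \<in> I" "f j \<in> span (f ` I - {f j})" by blast
    have "f ` I - {f j} \<subseteq> f ` (I - {j})" by blast
    from span_mono[OF this] j(2) have "f j \<in> span (f ` (I - {j}))" by blast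
    then show False using f[OF j(1)] by blast
  qed
  then have "dim (f ` I) = card (f ` I)" by (intro dim_eq_card) simp_all
  moreover have "dim (f ` I) = card C"
    by (rule dim_eq_card[OF C(2) orthonormal_independent[OF C(1)]])
  ultimately show ?thesis by (simp add: card_image[OF inj])
qed

section \<open>The statistic at the true coefficients\<close>

locale coverage_problem = repro_problem +
  fixes \<Lambda> :: "nat set" and conv :: "nat set \<Rightarrow> ereal set" and \<alpha> :: real
  assumes \<Lambda>: "\<Lambda> \<subseteq> {..<p}" and conv: "\<And>\<tau>. conv \<tau> \<in> sets borel" and \<alpha>: "0 < \<alpha>" "\<alpha> < 1"
    and id: "identifiable X \<tau>\<^sub>0 \<beta>\<^sub>0"
begin

definition \<beta>\<^sub>\<Lambda> :: "real vec" where "\<beta>\<^sub>\<Lambda> = subvector (full_coef p \<tau>\<^sub>0 \<beta>\<^sub>0) \<Lambda>"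

lemma \<beta>\<Lambda>_carrier: "\<beta>\<^sub>\<Lambda> \<in> carrier_vec (card \<Lambda>)"
  by (simp add: \<beta>\<^sub>\<Lambda>_def subvector_def)

lemma entry_\<beta>\<Lambda>:
  assumes "i \<in> \<Lambda>"
  shows "entry_at \<Lambda> \<beta>\<^sub>\<Lambda> i = (if i \<in> \<tau>\<^sub>0 then entry_at \<tau>\<^sub>0 \<beta>\<^sub>0 i else 0)"
proof -
  have "{a \<in> \<Lambda>. a < i} \<subset> \<Lambda>" using assms by blast
  then have "card {a \<in> \<Lambda>. a < i} < card \<Lambda>" using finite_model[OF X \<Lambda>] by (intro psubset_card_mono)
  moreover have "i < p" using assms \<Lambda> by blast
  ultimately show ?thesis
    unfolding entry_at_def[of \<Lambda>] \<beta>\<^sub>\<Lambda>_def subvector_def full_coef_def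
    using pick_card_in_set[OF assms] by simp
qed

text \<open>Subtracting the tested part leaves only true columns outside \<Lambda> in the mean. This
  nuisance term is annihilated by both quadratic forms of the statistic for
  \<open>\<tau>\<^sub>0\<close>.\<close>

lemma residual_\<beta>\<Lambda>:
  "\<exists>x \<in> span (xcol X ` (\<tau>\<^sub>0 - \<Lambda>)). \<forall>u. of_vec (Y u) - of_vec (cols_at X \<Lambda> *\<^sub>v \<beta>\<^sub>\<Lambda>) = x + \<sigma>\<^sub>0 *\<^sub>R emb n u"
proof -
  let ?f = "\<lambda>j. entry_at \<tau>\<^sub>0 \<beta>\<^sub>0 j *\<^sub>R xcol X j"
  define x where "x = (\<Sum>j\<in>\<tau>\<^sub>0 - \<Lambda>. ?f j)"
  have fin: "finite \<tau>\<^sub>0" "finite \<Lambda>" by (rule finite_model[OF X \<tau>\<^sub>0(1)], rule finite_model[OF X \<Lambda>])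
  have "of_vec (cols_at X \<Lambda> *\<^sub>v \<beta>\<^sub>\<Lambda>) = (\<Sum>j\<in>\<Lambda>. if j \<in> \<tau>\<^sub>0 then ?f j else 0)"
    unfolding of_vec_cols_at[OF X \<Lambda> \<beta>\<Lambda>_carrier] by (intro sum.cong refl) (simp add: entry_\<beta>\<Lambda>)
  also have "\<dots> = (\<Sum>j\<in>\<Lambda> \<inter> \<tau>\<^sub>0. ?f j)" by (rule sum.inter_restrict[OF fin(2), symmetric])
  finally have 1: "of_vec (cols_at X \<Lambda> *\<^sub>v \<beta>\<^sub>\<Lambda>) = (\<Sum>j\<in>\<tau>\<^sub>0 \<inter> \<Lambda>. ?f j)" by (simp only: Int_commute)
  have "\<mu> = (\<Sum>j\<in>\<tau>\<^sub>0 \<inter> \<Lambda>. ?f j) + x"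
    unfolding \<mu>_def of_vec_cols_at[OF X \<tau>\<^sub>0(1) \<beta>\<^sub>0] x_def by (rule sum.Int_Diff[OF fin(1)])
  then have "of_vec (Y u) - of_vec (cols_at X \<Lambda> *\<^sub>v \<beta>\<^sub>\<Lambda>) = x + \<sigma>\<^sub>0 *\<^sub>R emb n u" for u
    unfolding of_vec_Y 1 by simp
  moreover have "x \<in> span (xcol X ` (\<tau>\<^sub>0 - \<Lambda>))"
    unfolding x_def by (intro span_sum span_scale span_base imageI)
  ultimately show ?thesis by blast
qed

text \<open>Every model is covered, since the coverage event may be met through any selected
  model.\<close>

lemma measurable_T_stat:
  assumes \<tau>: "\<tau> \<subseteq> {..<p}"
  shows "(\<lambda>u. T_stat X \<Lambda> (Y u) \<beta>\<^sub>\<Lambda> \<tau>) \<in> borel_measurable (Pi\<^sub>M {..<n} (\<lambda>_. borel))"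
proof -
  have fin: "finite (xcol X ` I)" if "I \<subseteq> {..<p}" for I
    by (rule finite_imageI[OF finite_model[OF X that]])
  have sub: "\<tau> - \<Lambda> \<subseteq> {..<p}" "\<Lambda> \<inter> \<tau> \<subseteq> {..<p}" using \<tau> by auto
  obtain C where C: "finite C" "orthonormal C" "card C \<le> card (xcol X ` (\<tau> - \<Lambda>))" "span C = span (xcol X ` (\<tau> - \<Lambda>))"
    by (rule orthonormal_basis_exists[OF fin[OF sub(1)]])
  obtain H where H: "finite H" "orthonormal H" "card H \<le> card (xcol X ` \<tau>)" "span H = span (xcol X ` \<tau>)"
    by (rule orthonormal_basis_exists[OF fin[OF \<tau>]])
  let ?R = "(\<lambda>b. b - oproj C b) ` xcol X ` (\<Lambda> \<inter> \<tau>)"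
  obtain D where D: "finite D" "orthonormal D" "card D \<le> card ?R" "span D = span ?R"
    by (rule orthonormal_basis_exists[OF finite_imageI[OF fin[OF sub(2)]]])
  have Ce: "span C \<subseteq> eucl n" unfolding C(4) by (rule span_xcol_eucl[OF X])
  have Re: "?R \<subseteq> eucl n"
  proof (rule image_subsetI)
    fix b assume "b \<in> xcol X ` (\<Lambda> \<inter> \<tau>)"
    then have "b \<in> eucl n" using xcol_in_eucl[OF X] by blast
    moreover have "oproj C b \<in> eucl n" using Ce oproj_in_span[of C b] by blast
    ultimately show "b - oproj C b \<in> eucl n" by (rule real_vector.subspace_diff[OF subspace_eucl])
  qed
  have De: "d \<in> eucl n" if "d \<in> D" for d
    using span_base[OF that] span_subset_eucl[OF Re] unfolding D(4) by blast
  have He: "h \<in> eucl n" if "h \<in> H" for h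
    using span_base[OF that] span_xcol_eucl[OF X, of \<tau>] unfolding H(4) by blast
  obtain x where x: "x \<in> span (xcol X ` (\<tau>\<^sub>0 - \<Lambda>))"
    and r: "\<forall>u. of_vec (Y u) - of_vec (cols_at X \<Lambda> *\<^sub>v \<beta>\<^sub>\<Lambda>) = x + \<sigma>\<^sub>0 *\<^sub>R emb n u"
    using residual_\<beta>\<Lambda> by (rule bexE)
  have xe: "x \<in> eucl n" using x span_xcol_eucl[OF X] by blast
  let ?r = "\<lambda>u. x + \<sigma>\<^sub>0 *\<^sub>R emb n u"
  have re: "?r u \<in> eucl n" for u
    by (intro real_vector.subspace_add[OF subspace_eucl] real_vector.subspace_scale[OF subspace_eucl] xe emb_in_eucl)
  have cr: "(\<lambda>u. coord (?r u) i) \<in> borel_measurable (Pi\<^sub>M {..<n} (\<lambda>_. borel))" for i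
    unfolding coord_simps by (cases "i < n") (simp_all, measurable)
  have cc: "(\<lambda>u. coord c i) \<in> borel_measurable (Pi\<^sub>M {..<n} (\<lambda>_. borel))" for c i by simp
  have m: "(\<lambda>u. ereal (((\<Sum>d\<in>D. (inner d (?r u))\<^sup>2) / real (card (\<Lambda> \<inter> \<tau>)))
      / ((inner (?r u) (?r u) - (\<Sum>h\<in>H. (inner h (?r u))\<^sup>2)) / (real n - real (card \<tau>)))))
      \<in> borel_measurable (Pi\<^sub>M {..<n} (\<lambda>_. borel))"
    by (intro borel_measurable_ereal borel_measurable_diff borel_measurable_divide borel_measurable_power
        borel_measurable_sum borel_measurable_const measurable_inner_coord[OF re cr cr]
        measurable_inner_coord[OF De cc cr] measurable_inner_coord[OF He cc cr])
  have "(\<lambda>u. T_stat X \<Lambda> (Y u) \<beta>\<^sub>\<Lambda> \<tau>) = (\<lambda>u. if \<exists>i\<in>\<Lambda> - \<tau>. entry_at \<Lambda> \<beta>\<^sub>\<Lambda> i \<noteq> 0 then \<infinity> else if \<Lambda> \<inter> \<tau> = {} then 0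
    else ereal (((\<Sum>d\<in>D. (inner d (?r u))\<^sup>2) / real (card (\<Lambda> \<inter> \<tau>)))
      / ((inner (?r u) (?r u) - (\<Sum>h\<in>H. (inner h (?r u))\<^sup>2)) / (real n - real (card \<tau>)))))"
    by (rule ext, rule T_stat_formula[OF X \<tau> \<Lambda> C(2,1,4) D(2,1,4) H(2,1,4) Y_carrier \<beta>\<Lambda>_carrier])
      (simp only: r)
  moreover have "\<dots> \<in> borel_measurable (Pi\<^sub>M {..<n} (\<lambda>_. borel))"
    using m by (cases "\<exists>i\<in>\<Lambda> - \<tau>. entry_at \<Lambda> \<beta>\<^sub>\<Lambda> i \<noteq> 0"; cases "\<Lambda> \<inter> \<tau> = {}") (simp_all only: if_True if_False simp_thms borel_measurable_const)
  ultimately show ?thesis by (simp only:)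
qed

lemma sets_B_set: "B_set conv n \<alpha> \<Lambda> \<tau> \<in> sets borel"
  unfolding B_set_def using conv by simp

abbreviation "covers \<tau> u \<equiv> T_stat X \<Lambda> (Y u) \<beta>\<^sub>\<Lambda> \<tau> \<in> B_set conv n \<alpha> \<Lambda> \<tau>"

text \<open>\<open>C\<close> spans the nuisance columns, \<open>D\<close> completes it to the span
  of the true model, and \<open>G\<close> completes both to R^n. The residual has noise only along
  \<open>D\<close> and \<open>G\<close>, the noise level cancels in the ratio, and the statistic is
  exactly F distributed.\<close>

lemma coverage_true_model:
  assumes s: "s < n"
  shows "\<alpha> \<le> measure (std_gauss n) {u \<in> space (std_gauss n). covers \<tau>\<^sub>0 u}"
proof -
  interpret P: prob_space "std_gauss n" by (rule prob_space_std_gauss)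
  have no: "\<not> (\<exists>i\<in>\<Lambda> - \<tau>\<^sub>0. entry_at \<Lambda> \<beta>\<^sub>\<Lambda> i \<noteq> 0)" by (simp add: entry_\<beta>\<Lambda>)
  show ?thesis
  proof (cases "\<Lambda> \<inter> \<tau>\<^sub>0 = {}")
    case True
    then have "covers \<tau>\<^sub>0 u" for u
      using no by (simp add: T_stat_def B_set_def del: bex_simps)
    then show ?thesis using \<alpha> P.prob_space by simp
  next
    case False
    have fin: "finite (xcol X ` I)" if "I \<subseteq> {..<p}" for I
      by (rule finite_imageI[OF finite_model[OF X that]])
    have sub: "\<tau>\<^sub>0 - \<Lambda> \<subseteq> {..<p}" "\<Lambda> \<inter> \<tau>\<^sub>0 \<subseteq> {..<p}" using \<tau>\<^sub>0(1) by auto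
    note f\<tau> = finite_model[OF X \<tau>\<^sub>0(1)]
    obtain C where C: "finite C" "orthonormal C" "card C \<le> card (xcol X ` (\<tau>\<^sub>0 - \<Lambda>))"
      "span C = span (xcol X ` (\<tau>\<^sub>0 - \<Lambda>))"
      by (rule orthonormal_basis_exists[OF fin[OF sub(1)]])
    show ?thesis
    proof (rule orthonormal_extend[OF C(2,1) fin[OF sub(2)]], goal_cases)
      case (1 D)
      note D = 1
      have onD: "orthonormal D" by (rule orthonormal_subset[OF D(3)]) simp
      have finH: "finite (C \<union> D)" using C(1) D(1) by simp
      have "span (C \<union> D) = span (xcol X ` (\<tau>\<^sub>0 - \<Lambda>) \<union> xcol X ` (\<Lambda> \<inter> \<tau>\<^sub>0))"
        unfolding D(5) by (simp only: real_vector.span_Un C(4))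
      also have "xcol X ` (\<tau>\<^sub>0 - \<Lambda>) \<union> xcol X ` (\<Lambda> \<inter> \<tau>\<^sub>0) = xcol X ` \<tau>\<^sub>0" by blast
      finally have H: "span (C \<union> D) = span (xcol X ` \<tau>\<^sub>0)" .
      have "C \<union> D \<subseteq> span (xcol X ` \<tau>\<^sub>0)" unfolding H[symmetric] by (rule span_superset)
      then have He: "C \<union> D \<subseteq> eucl n" using span_xcol_eucl[OF X] by (rule subset_trans)
      have "card (C \<union> D) = s"
        by (rule card_basis_of_independent_family[OF identifiable_not_in_span[OF X \<tau>\<^sub>0(1) \<beta>\<^sub>0 id] D(3) H])
      then have cs: "card C + card D = s" using card_Un_disjoint[OF C(1) D(1,2)] by simp
      have "card C \<le> card (\<tau>\<^sub>0 - \<Lambda>)"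
        using C(3) card_image_le[of "\<tau>\<^sub>0 - \<Lambda>" "xcol X"] f\<tau> by simp
      moreover have "card D \<le> card (\<Lambda> \<inter> \<tau>\<^sub>0)"
        using D(4) card_image_le[of "\<Lambda> \<inter> \<tau>\<^sub>0" "xcol X"] f\<tau> by simp
      moreover have "s = card (\<tau>\<^sub>0 - \<Lambda>) + card (\<Lambda> \<inter> \<tau>\<^sub>0)"
        using card_Int_Diff[OF f\<tau>, of \<Lambda>] by (simp add: Int_commute)
      \<comment> \<open>Neither part exceeds its number of columns, and together they reach
        \<open>s\<close>, so both bounds are equalities.\<close>
      ultimately have cD: "card D = card (\<Lambda> \<inter> \<tau>\<^sub>0)" using cs by linarith
      obtain G where G: "finite G" "(C \<union> D) \<inter> G = {}" "orthonormal ((C \<union> D) \<union> G)"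
        "span ((C \<union> D) \<union> G) = eucl n" "G \<subseteq> eucl n" "card G = n - card (C \<union> D)"
        by (rule orthonormal_complete[OF D(3) He])
      have cG: "card G = n - s" using G(6) \<open>card (C \<union> D) = s\<close> by simp
      obtain x where x: "x \<in> span (xcol X ` (\<tau>\<^sub>0 - \<Lambda>))"
        and r: "\<forall>u. of_vec (Y u) - of_vec (cols_at X \<Lambda> *\<^sub>v \<beta>\<^sub>\<Lambda>) = x + \<sigma>\<^sub>0 *\<^sub>R emb n u"
        using residual_\<beta>\<Lambda> by (rule bexE)
      have xC: "x \<in> span C" using x unfolding C(4) .
      have dx: "inner d (x + \<sigma>\<^sub>0 *\<^sub>R emb n u) = \<sigma>\<^sub>0 * inner d (emb n u)" if "d \<in> D" for d u
        using orthonormal_Un_orthogonal[OF D(3,2) that xC] by (simp add: inner_add_right)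
      have xH: "x \<in> span (C \<union> D)" using xC span_mono[of C "C \<union> D"] by blast
      have gx: "inner g (x + \<sigma>\<^sub>0 *\<^sub>R emb n u) = \<sigma>\<^sub>0 * inner g (emb n u)" if "g \<in> G" for g u
        using orthonormal_Un_orthogonal[OF G(3,2) that xH] by (simp add: inner_add_right)
      let ?D = "\<lambda>u. \<Sum>d\<in>D. (inner d (emb n u))\<^sup>2" and ?G = "\<lambda>u. \<Sum>g\<in>G. (inner g (emb n u))\<^sup>2"
      have sD: "(\<Sum>d\<in>D. (inner d (x + \<sigma>\<^sub>0 *\<^sub>R emb n u))\<^sup>2) = \<sigma>\<^sub>0\<^sup>2 * ?D u" for u
        unfolding sum_distrib_left by (intro sum.cong refl) (simp only: dx power_mult_distrib)
      have sG: "inner (x + \<sigma>\<^sub>0 *\<^sub>R emb n u) (x + \<sigma>\<^sub>0 *\<^sub>R emb n u)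
          - (\<Sum>h\<in>C \<union> D. (inner h (x + \<sigma>\<^sub>0 *\<^sub>R emb n u))\<^sup>2) = \<sigma>\<^sub>0\<^sup>2 * ?G u" for u
      proof -
        let ?r = "x + \<sigma>\<^sub>0 *\<^sub>R emb n u"
        have "x \<in> eucl n" using x span_xcol_eucl[OF X] by blast
        then have "?r \<in> eucl n"
          by (intro real_vector.subspace_add[OF subspace_eucl] real_vector.subspace_scale[OF subspace_eucl] emb_in_eucl)
        then have "?r \<in> span ((C \<union> D) \<union> G)" by (simp only: G(4))
        \<comment> \<open>Parseval in the full basis: the squared norm is the sum over
          \<open>C\<close>, \<open>D\<close> and \<open>G\<close>, so subtracting the fitted part
          leaves the sum over \<open>G\<close>.\<close>
        from oproj_id[OF G(3) finite_UnI[OF finH G(1)] this]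
        have "inner ?r ?r - (\<Sum>h\<in>(C \<union> D) \<union> G. (inner h ?r)\<^sup>2) = 0"
          using norm_residual_sq[OF G(3) finite_UnI[OF finH G(1)], of ?r] by simp
        moreover have "(\<Sum>h\<in>(C \<union> D) \<union> G. (inner h ?r)\<^sup>2) = (\<Sum>h\<in>C \<union> D. (inner h ?r)\<^sup>2) + (\<Sum>g\<in>G. (inner g ?r)\<^sup>2)"
          by (rule sum.union_disjoint[OF finH G(1,2)])
        moreover have "(\<Sum>g\<in>G. (inner g ?r)\<^sup>2) = \<sigma>\<^sub>0\<^sup>2 * ?G u"
          unfolding sum_distrib_left by (intro sum.cong refl) (simp only: gx power_mult_distrib)
        ultimately show ?thesis by linarith
      qed
      have T: "T_stat X \<Lambda> (Y u) \<beta>\<^sub>\<Lambda> \<tau>\<^sub>0 = ereal ((?D u / real (card D)) / (?G u / real (card G)))" for u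
      proof -
        have rn: "real n - real s = real (card G)" using s cG by simp
        have "T_stat X \<Lambda> (Y u) \<beta>\<^sub>\<Lambda> \<tau>\<^sub>0 = ereal ((\<sigma>\<^sub>0\<^sup>2 * ?D u / real (card D)) / (\<sigma>\<^sub>0\<^sup>2 * ?G u / real (card G)))"
          unfolding T_stat_formula[OF X \<tau>\<^sub>0(1) \<Lambda> C(2,1,4) onD D(1,6) D(3) finH H Y_carrier \<beta>\<Lambda>_carrier refl]
            r[rule_format] sD sG cD[symmetric] rn
          using no False by (simp only: if_False)
        then show ?thesis using \<sigma>\<^sub>0 by simp
      qed
      have B: "B_set conv n \<alpha> \<Lambda> \<tau>\<^sub>0 = {0..ereal (quantile (F_distr (card D) (card G)) \<alpha>)}"
        unfolding B_set_def cD cG using False s by simp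
      have "covers \<tau>\<^sub>0 u \<longleftrightarrow> (?D u / real (card D)) / (?G u / real (card G)) \<le> quantile (F_distr (card D) (card G)) \<alpha>" for u
      proof -
        have "0 \<le> (?D u / real (card D)) / (?G u / real (card G))"
          by (intro divide_nonneg_nonneg sum_nonneg) simp_all
        then show ?thesis unfolding T B by simp
      qed
      moreover have on': "orthonormal (D \<union> G)" by (rule orthonormal_subset[OF G(3)]) blast
      moreover have "D \<union> G \<subseteq> eucl n" using He G(5) by blast
      moreover have "D \<inter> G = {}" using G(2) by blast
      ultimately show ?case using F_quantile_coverage[of D G n \<alpha>] \<alpha> by simp
    qed
  qed
qed

end

section \<open>Coverage of the confidence set\<close>

text \<open>Storing \<open>U\<close> at index 0 expresses the joint independence of the data noise
  and the artificial noises through a single family.\<close>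

locale coverage_experiment = coverage_problem +
  fixes M :: "'w measure" and U :: "'w \<Rightarrow> nat \<Rightarrow> real" and W :: "nat \<Rightarrow> 'w \<Rightarrow> nat \<Rightarrow> real" and d :: nat
  assumes M: "prob_space M" and d: "1 \<le> d"
    and indep: "prob_space.indep_vars M (\<lambda>_. \<Pi>\<^sub>M i \<in> {..<n}. borel) (W(0 := U)) {0..d}"
    and law_U: "distr M (\<Pi>\<^sub>M i \<in> {..<n}. borel) U = std_gauss n"
    and law_W: "\<And>b. b \<in> {1..d} \<Longrightarrow> distr M (\<Pi>\<^sub>M i \<in> {..<n}. borel) (W b) = std_gauss n"
begin

abbreviation "N \<equiv> \<Pi>\<^sub>M i \<in> {..<n}. (borel :: real measure)"

abbreviation "Wvec \<equiv> \<lambda>\<omega>. \<lambda>b\<in>{1..d}. W b \<omega>"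

abbreviation "\<G> \<equiv> generated_by M n d W"

abbreviation "E \<equiv> coverage_event M sel conv X \<tau>\<^sub>0 \<beta>\<^sub>0 \<sigma>\<^sub>0 lam \<alpha> \<Lambda> d U W"

abbreviation "select b \<omega> \<equiv> tau_hat sel X lam (Y (U \<omega>)) (vec n (W b \<omega>))"

definition miss :: "'w set" where "miss = {\<omega> \<in> space M. select 1 \<omega> \<noteq> \<tau>\<^sub>0}"

definition hit :: "'w set" where "hit = {\<omega> \<in> space M. covers \<tau>\<^sub>0 (U \<omega>)}"

lemma rv_U [measurable]: "U \<in> M \<rightarrow>\<^sub>M N"
proof -
  interpret prob_space M by (rule M)
  have "\<forall>i\<in>{0..d}. (W(0 := U)) i \<in> M \<rightarrow>\<^sub>M N" using indep unfolding indep_vars_def by blast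
  from bspec[OF this, of 0] show ?thesis by simp
qed

lemma rv_W: "b \<in> {1..d} \<Longrightarrow> W b \<in> M \<rightarrow>\<^sub>M N"
proof -
  assume b: "b \<in> {1..d}"
  interpret prob_space M by (rule M)
  have "\<forall>i\<in>{0..d}. (W(0 := U)) i \<in> M \<rightarrow>\<^sub>M N" using indep unfolding indep_vars_def by blast
  from bspec[OF this, of b] b show ?thesis by simp
qed

lemma rv_Wvec [measurable]: "Wvec \<in> M \<rightarrow>\<^sub>M Pi\<^sub>M {1..d} (\<lambda>_. N)"
  by (rule measurable_restrict) (rule rv_W)

text \<open>\<open>U\<close> as a family over a singleton, the shape produced when an independent
  family is split into blocks.\<close>

abbreviation "Uvec \<equiv> \<lambda>\<omega>. \<lambda>i\<in>{0::nat}. U \<omega>"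

lemma indep_Uvec_Wvec: "prob_space.indep_var M (Pi\<^sub>M {0} (\<lambda>_. N)) Uvec (Pi\<^sub>M {1..d} (\<lambda>_. N)) Wvec"
proof -
  interpret prob_space M by (rule M)
  let ?Z = "W(0 := U)"
  have "indep_var (Pi\<^sub>M {0} (\<lambda>_. N)) (\<lambda>\<omega>. restrict (\<lambda>i. ?Z i \<omega>) {0}) (Pi\<^sub>M {1..d} (\<lambda>_. N)) (\<lambda>\<omega>. restrict (\<lambda>i. ?Z i \<omega>) {1..d})"
    by (rule indep_var_restrict[OF indep]) auto
  moreover have "(\<lambda>\<omega>. restrict (\<lambda>i. ?Z i \<omega>) {0}) = Uvec" by (intro ext) simp
  moreover have "(\<lambda>\<omega>. restrict (\<lambda>i. ?Z i \<omega>) {1..d}) = Wvec" by (intro ext) simp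
  ultimately show ?thesis by (simp only:)
qed

lemma joint_law: "distr M (N \<Otimes>\<^sub>M N) (\<lambda>\<omega>. (U \<omega>, W 1 \<omega>)) = std_gauss n \<Otimes>\<^sub>M std_gauss n"
proof -
  interpret prob_space M by (rule M)
  have d1: "1 \<in> {1..d}" using d by simp
  have "indep_var N ((\<lambda>z. z 0) \<circ> Uvec) N ((\<lambda>z. z 1) \<circ> Wvec)"
    using d1 by (intro indep_var_compose[OF indep_Uvec_Wvec]) simp_all
  moreover have "(\<lambda>z. z 0) \<circ> Uvec = U" "(\<lambda>z. z 1) \<circ> Wvec = W 1" using d1 by (intro ext, simp)+
  ultimately have "indep_var N U N (W 1)" by (simp only:)
  then have "distr M N U \<Otimes>\<^sub>M distr M N (W 1) = distr M (N \<Otimes>\<^sub>M N) (\<lambda>\<omega>. (U \<omega>, W 1 \<omega>))"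
    unfolding indep_var_distribution_eq by (elim conjE)
  then show ?thesis by (simp only: law_U law_W[OF d1])
qed

lemma integrable_ind: "A \<in> sets M \<Longrightarrow> integrable M (indicator A :: 'w \<Rightarrow> real)"
proof -
  interpret prob_space M by (rule M)
  assume "A \<in> sets M"
  then show "integrable M (indicator A :: 'w \<Rightarrow> real)" by (simp add: emeasure_eq_measure)
qed

lemma sets_select: "b \<in> {1..d} \<Longrightarrow> {\<omega> \<in> space M. Q (select b \<omega>)} \<in> sets M"
  by (intro sets_tau_hat measurable_repro_crit rv_U rv_W) (simp_all add: dims)

lemma sets_covers:
  assumes "\<tau> \<subseteq> {..<p}"
  shows "{\<omega> \<in> space M. covers \<tau> (U \<omega>)} \<in> sets M" "{u \<in> space N. covers \<tau> u} \<in> sets N"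
proof -
  have "(\<lambda>u. T_stat X \<Lambda> (Y u) \<beta>\<^sub>\<Lambda> \<tau>) -` B_set conv n \<alpha> \<Lambda> \<tau> \<inter> space N \<in> sets N"
    by (rule measurable_sets[OF measurable_T_stat[OF assms] sets_B_set])
  moreover have "(\<lambda>u. T_stat X \<Lambda> (Y u) \<beta>\<^sub>\<Lambda> \<tau>) -` B_set conv n \<alpha> \<Lambda> \<tau> \<inter> space N = {u \<in> space N. covers \<tau> u}"
    by auto
  ultimately show N: "{u \<in> space N. covers \<tau> u} \<in> sets N" by simp
  have "U -` {u \<in> space N. covers \<tau> u} \<inter> space M = {\<omega> \<in> space M. covers \<tau> (U \<omega>)}"
    using measurable_space[OF rv_U] by auto
  then show "{\<omega> \<in> space M. covers \<tau> (U \<omega>)} \<in> sets M"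
    using measurable_sets[OF rv_U N] by simp
qed

text \<open>Splitting by the selected model separates the choice, which depends on both noises, from
  coverage by a fixed model, which depends on \<open>U\<close>; measurability then follows from a
  finite union.\<close>

lemma E_eq: "E = (\<Union>b\<in>{1..d}. \<Union>\<tau>\<in>Pow {..<p}. {\<omega> \<in> space M. select b \<omega> = \<tau>} \<inter> {\<omega> \<in> space M. covers \<tau> (U \<omega>)})"
proof -
  have "E = {\<omega> \<in> space M. \<exists>b\<in>{1..d}. covers (select b \<omega>) (U \<omega>)}"
    unfolding coverage_event_def conf_set_def candidate_set_def Let_def dims \<beta>\<^sub>\<Lambda>_def[symmetric]
    using \<beta>\<Lambda>_carrier by auto
  also have "\<dots> = (\<Union>b\<in>{1..d}. \<Union>\<tau>\<in>Pow {..<p}. {\<omega> \<in> space M. select b \<omega> = \<tau>} \<inter> {\<omega> \<in> space M. covers \<tau> (U \<omega>)})"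
    using tau_hat_subset by blast
  finally show ?thesis .
qed

lemma sets_E: "E \<in> sets M"
  unfolding E_eq using sets_select sets_covers(1) by (intro sets.finite_UN sets.Int) simp_all

lemma sets_hit: "hit \<in> sets M"
  unfolding hit_def by (rule sets_covers(1)[OF \<tau>\<^sub>0(1)])

lemma sets_miss: "miss \<in> sets M"
  unfolding miss_def using d by (intro sets_select) simp

lemma hit_minus_miss: "hit - miss \<subseteq> E"
proof
  fix \<omega> assume "\<omega> \<in> hit - miss"
  then have "\<omega> \<in> space M" "covers \<tau>\<^sub>0 (U \<omega>)" "select 1 \<omega> = \<tau>\<^sub>0" by (auto simp: hit_def miss_def)
  then show "\<omega> \<in> E" unfolding E_eq using d \<tau>\<^sub>0(1) by (intro UN_I[of 1] UN_I[of \<tau>\<^sub>0]) simp_all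
qed

lemma prob_hit:
  assumes "s < n"
  shows "\<alpha> \<le> measure M hit"
proof -
  have "\<alpha> \<le> measure (std_gauss n) {u \<in> space (std_gauss n). covers \<tau>\<^sub>0 u}"
    by (rule coverage_true_model[OF assms])
  also have "\<dots> = measure (distr M N U) {u \<in> space N. covers \<tau>\<^sub>0 u}"
    by (simp only: law_U) (simp only: sets_eq_imp_space_eq[OF sets_std_gauss])
  also have "\<dots> = measure M (U -` {u \<in> space N. covers \<tau>\<^sub>0 u} \<inter> space M)"
    by (rule measure_distr[OF rv_U sets_covers(2)[OF \<tau>\<^sub>0(1)]])
  also have "U -` {u \<in> space N. covers \<tau>\<^sub>0 u} \<inter> space M = hit"
    unfolding hit_def using measurable_space[OF rv_U] by auto
  finally show ?thesis .
qed

lemma prob_miss: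
  assumes C: "0 < C_min X \<tau>\<^sub>0 \<beta>\<^sub>0" and a: "0 \<le> a"
    and H1: "90 * ((real s + 2) * ln (real p + 1)) + 5 / 2 * a \<le> real n * C_min X \<tau>\<^sub>0 \<beta>\<^sub>0 / \<sigma>\<^sub>0\<^sup>2"
    and H2: "6 * (real s + 1) * ln (real p / 2) + a \<le> lam / \<sigma>\<^sub>0\<^sup>2"
    and H3: "lam \<le> real n * C_min X \<tau>\<^sub>0 \<beta>\<^sub>0 / 20"
    and H4: "4 ^ 16 * exp (- a / 4) \<le> 1 / 2"
    and H5: "real s \<le> real n / 4" "s < n" "real s * ln (real p) \<le> 0.23 * real n"
  shows "measure M miss \<le> 6 * exp (- real n / 50) + 2 * exp (- a / 36) + 2 * (4 ^ 16 * exp (- a / 4))"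
proof -
  let ?\<gamma> = "std_gauss n \<Otimes>\<^sub>M std_gauss n"
  let ?N = "{z \<in> space ?\<gamma>. tau_hat sel X lam (Y (fst z)) (vec n (snd z)) \<noteq> \<tau>\<^sub>0}"
  have sg: "sets ?\<gamma> = sets (N \<Otimes>\<^sub>M N)" by (intro sets_pair_measure_cong sets_std_gauss)
  have m: "fst \<in> ?\<gamma> \<rightarrow>\<^sub>M N" "snd \<in> ?\<gamma> \<rightarrow>\<^sub>M N"
    unfolding measurable_cong_sets[OF sg refl] by measurable
  have mU: "(\<lambda>\<omega>. (U \<omega>, W 1 \<omega>)) \<in> M \<rightarrow>\<^sub>M N \<Otimes>\<^sub>M N"
    using d by (intro measurable_Pair rv_U rv_W) simp
  have NS: "?N \<in> sets ?\<gamma>"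
    by (intro sets_tau_hat measurable_repro_crit m) (simp add: dims)
  have "miss = (\<lambda>\<omega>. (U \<omega>, W 1 \<omega>)) -` ?N \<inter> space M"
    using measurable_space[OF mU] unfolding miss_def sets_eq_imp_space_eq[OF sg] by auto
  then have "measure M miss = measure (distr M (N \<Otimes>\<^sub>M N) (\<lambda>\<omega>. (U \<omega>, W 1 \<omega>))) ?N"
    using measure_distr[OF mU, of ?N] NS sg by simp
  also have "\<dots> = measure ?\<gamma> ?N" by (simp only: joint_law)
  also have "\<dots> \<le> 6 * exp (- real n / 50) + 2 * exp (- a / 36) + 2 * (4 ^ 16 * exp (- a / 4))"
    by (rule selection_error[OF C a H1 H2 H3 H4 H5 NS])
  finally show ?thesis .
qed

lemma prob_E:
  assumes "s < n"
  shows "\<alpha> - measure M miss \<le> measure M E"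
proof -
  interpret prob_space M by (rule M)
  have "\<alpha> \<le> prob hit" by (rule prob_hit[OF assms])
  also have "\<dots> \<le> prob (E \<union> miss)"
    using hit_minus_miss by (intro finite_measure_mono sets.Un sets_E sets_miss) blast
  also have "\<dots> \<le> prob E + prob miss" by (rule measure_Un_le[OF sets_E sets_miss])
  finally show ?thesis by simp
qed

section \<open>Conditioning on the artificial noise\<close>

lemma subalgebra_G: "subalgebra M \<G>"
  unfolding subalgebra_def generated_by_def
  using rv_Wvec by (intro conjI sets_image_in_sets) simp_all

lemma sigma_finite_subalgebra_G: "sigma_finite_subalgebra M \<G>"
proof -
  interpret prob_space M by (rule M)
  show ?thesis
    by (rule finite_measure_subalgebra_is_sigma_finite)
      (rule finite_measure_subalgebra.intro[OF _ finite_measure_subalgebra_axioms.intro[OF subalgebra_G]], unfold_locales)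
qed

text \<open>\<open>hit\<close> is determined by \<open>U\<close>, which is independent of the
  artificial noises. Its probability therefore factorises over every event of the conditioning
  algebra.\<close>

lemma cond_exp_hit: "AE \<omega> in M. real_cond_exp M \<G> (indicator hit) \<omega> = measure M hit"
proof -
  interpret prob_space M by (rule M)
  interpret G: sigma_finite_subalgebra M \<G> by (rule sigma_finite_subalgebra_G)
  show ?thesis
  proof (rule G.real_cond_exp_charact)
    fix A assume A: "A \<in> sets \<G>"
    have AM: "A \<in> sets M" using A subalgebra_G unfolding subalgebra_def by blast
    have Wf: "Wvec \<in> space M \<rightarrow> space (Pi\<^sub>M {1..d} (\<lambda>_. N))" using measurable_space[OF rv_Wvec] by blast
    obtain S where S: "A = Wvec -` S \<inter> space M" "S \<in> sets (Pi\<^sub>M {1..d} (\<lambda>_. N))"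
      using A unfolding generated_by_def sets_vimage_algebra2[OF Wf] by blast
    let ?H = "{u \<in> space N. covers \<tau>\<^sub>0 u}"
    define H' where "H' = (\<lambda>z. z 0) -` ?H \<inter> space (Pi\<^sub>M {0::nat} (\<lambda>_. N))"
    have H'S: "H' \<in> sets (Pi\<^sub>M {0} (\<lambda>_. N))"
      unfolding H'_def by (rule measurable_sets[OF _ sets_covers(2)[OF \<tau>\<^sub>0(1)]]) simp
    have UH: "Uvec -` H' \<inter> space M = hit"
      unfolding H'_def hit_def using measurable_space[OF rv_U] by (auto simp: space_PiM)
    have "(\<lambda>\<omega>. (Uvec \<omega>, Wvec \<omega>)) -` (H' \<times> S) \<inter> space M = hit \<inter> A"
      unfolding S(1) UH[symmetric] by auto
    then have ind: "prob (hit \<inter> A) = prob hit * prob A"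
      using indep_varD[OF indep_Uvec_Wvec H'S S(2)] by (simp only: UH S(1)[symmetric])
    have "(\<integral>\<omega>\<in>A. indicator hit \<omega> \<partial>M) = (\<integral>\<omega>. indicator (hit \<inter> A) \<omega> \<partial>M)"
      unfolding set_lebesgue_integral_def by (intro Bochner_Integration.integral_cong refl) (auto simp: indicator_def)
    also have "\<dots> = prob (hit \<inter> A)"
      using sets.Int[OF sets_hit AM] by simp
    also have "\<dots> = prob hit * prob A" by (rule ind)
    also have "\<dots> = (\<integral>\<omega>\<in>A. prob hit \<partial>M)"
      unfolding set_lebesgue_integral_def using AM by simp
    finally show "(\<integral>\<omega>\<in>A. indicator hit \<omega> \<partial>M) = (\<integral>\<omega>\<in>A. prob hit \<partial>M)" .
  next
    show "integrable M (indicator hit :: 'w \<Rightarrow> real)" by (rule integrable_ind[OF sets_hit])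
  qed simp_all
qed

text \<open>The indicator of \<open>hit\<close> is at most the sum of those of \<open>E\<close> and
  \<open>miss\<close>; conditional expectation preserves this, and the left side becomes a constant
  that is at least \<alpha>.\<close>

lemma cond_prob_E:
  assumes "s < n"
  shows "AE \<omega> in M. \<alpha> - real_cond_exp M \<G> (indicator miss) \<omega> \<le> cond_probability M \<G> E \<omega>"
proof -
  interpret prob_space M by (rule M)
  interpret G: sigma_finite_subalgebra M \<G> by (rule sigma_finite_subalgebra_G)
  note iE = integrable_ind[OF sets_E] and iM = integrable_ind[OF sets_miss]
    and iH = integrable_ind[OF sets_hit]
  have le: "indicator hit \<omega> \<le> (indicator E \<omega> + indicator miss \<omega> :: real)" for \<omega>
    using hit_minus_miss by (auto simp: indicator_def)
  have "AE \<omega> in M. real_cond_exp M \<G> (indicator hit) \<omega> \<le> real_cond_exp M \<G> (\<lambda>\<omega>. indicator E \<omega> + indicator miss \<omega>) \<omega>"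
    by (rule G.real_cond_exp_mono[OF AE_I2 iH Bochner_Integration.integrable_add[OF iE iM]]) (rule le)
  moreover have "AE \<omega> in M. real_cond_exp M \<G> (\<lambda>\<omega>. indicator E \<omega> + indicator miss \<omega>) \<omega>
      = real_cond_exp M \<G> (indicator E) \<omega> + real_cond_exp M \<G> (indicator miss) \<omega>"
    by (rule G.real_cond_exp_add[OF iE iM])
  ultimately show ?thesis
    using cond_exp_hit
  proof eventually_elim
    case (elim \<omega>)
    then show ?case using prob_hit[OF assms] unfolding cond_probability_def by linarith
  qed
qed

text \<open>The conditional error is nonnegative almost everywhere and its mean is the unconditional
  error.\<close>

lemma markov_cond_miss:
  assumes "0 < c"
  shows "measure M {\<omega> \<in> space M. c \<le> \<bar>real_cond_exp M \<G> (indicator miss) \<omega>\<bar>} \<le> measure M miss / c"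
proof -
  interpret prob_space M by (rule M)
  interpret G: sigma_finite_subalgebra M \<G> by (rule sigma_finite_subalgebra_G)
  let ?R = "real_cond_exp M \<G> (indicator miss)"
  note iM = integrable_ind[OF sets_miss]
  have pos: "AE \<omega> in M. 0 \<le> ?R \<omega>"
    using iM by (intro G.real_cond_exp_pos AE_I2 borel_measurable_integrable) simp_all
  have "prob {\<omega> \<in> space M. c \<le> \<bar>?R \<omega>\<bar>} \<le> (\<integral>\<omega>. \<bar>?R \<omega>\<bar> \<partial>M) / c"
    using assms G.real_cond_exp_int(1)[OF iM]
    by (intro integral_Markov_inequality_measure[OF _ sets.top]) simp_all
  also have "(\<integral>\<omega>. \<bar>?R \<omega>\<bar> \<partial>M) = (\<integral>\<omega>. ?R \<omega> \<partial>M)"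
  proof (rule integral_cong_AE)
    show "AE \<omega> in M. \<bar>?R \<omega>\<bar> = ?R \<omega>" using pos by eventually_elim simp
  qed simp_all
  also have "\<dots> = prob miss"
    using G.real_cond_exp_int(2)[OF iM] sets_miss by simp
  finally show ?thesis .
qed

end

section \<open>The asymptotic statement\<close>

text \<open>The assumptions are rescaled by n/\<open>\<sigma>\<^sup>2\<close>. With L for the
  logarithmic term, the separation is at least 120 L and at least 10 a; three quarters of the first
  and one quarter of the second give 90 L + 5/2 a.\<close>

lemma numeric_conditions:
  fixes n s p :: nat and \<sigma> t lam C :: real
  assumes s: "1 \<le> s" "s \<le> p" and \<sigma>: "0 < \<sigma>" and t: "0 < t" and n: "8 \<le> n"
    and a: "24 \<le> real n * t / \<sigma>\<^sup>2"
    and lam: "lam / real n \<in> {6 * \<sigma>\<^sup>2 * ((real s + 1) * ln (real p / 2) / real n) + t .. 0.05 * C}"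
    and log: "real s * ln (real p) / real n < 0.23"
    and C: "C > 120 * ((real s + 2) * ln (real p + 1) / real n) * \<sigma>\<^sup>2"
  shows "0 < C"
    and "90 * ((real s + 2) * ln (real p + 1)) + 5 / 2 * (real n * t / \<sigma>\<^sup>2) \<le> real n * C / \<sigma>\<^sup>2"
    and "6 * (real s + 1) * ln (real p / 2) + real n * t / \<sigma>\<^sup>2 \<le> lam / \<sigma>\<^sup>2"
    and "lam \<le> real n * C / 20"
    and "real s \<le> real n / 4" and "s < n" and "real s * ln (real p) \<le> 0.23 * real n"
proof -
  let ?a = "real n * t / \<sigma>\<^sup>2" and ?L = "(real s + 2) * ln (real p + 1)" and ?l = "(real s + 1) * ln (real p / 2)"
  have n0: "0 < real n" using n by simp
  have s2: "0 < \<sigma>\<^sup>2" using \<sigma> by simp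
  have L: "0 \<le> ?L" using s by simp
  have "0 \<le> 120 * (?L / real n) * \<sigma>\<^sup>2"
    using L by (intro mult_nonneg_nonneg divide_nonneg_nonneg) simp_all
  then show "0 < C" using C by linarith
  have "real n / \<sigma>\<^sup>2 * (120 * (?L / real n) * \<sigma>\<^sup>2) \<le> real n / \<sigma>\<^sup>2 * C"
    using C n0 s2 by (intro mult_left_mono) simp_all
  moreover have "real n / \<sigma>\<^sup>2 * (120 * (?L / real n) * \<sigma>\<^sup>2) = 120 * ?L"
    using n0 s2 by (simp add: field_simps)
  ultimately have CL: "120 * ?L \<le> real n * C / \<sigma>\<^sup>2" by simp
  have "real n / \<sigma>\<^sup>2 * (6 * \<sigma>\<^sup>2 * (?l / real n) + t) \<le> real n / \<sigma>\<^sup>2 * (lam / real n)"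
    using lam n0 s2 by (intro mult_left_mono) simp_all
  moreover have "real n / \<sigma>\<^sup>2 * (6 * \<sigma>\<^sup>2 * (?l / real n) + t) = 6 * ?l + ?a"
    using n0 s2 by (simp add: field_simps)
  moreover have "real n / \<sigma>\<^sup>2 * (lam / real n) = lam / \<sigma>\<^sup>2" using n0 by simp
  ultimately have l: "6 * ?l + ?a \<le> lam / \<sigma>\<^sup>2" by simp
  then show "6 * (real s + 1) * ln (real p / 2) + ?a \<le> lam / \<sigma>\<^sup>2" by (simp only: mult.assoc)
  have "real n * (lam / real n) \<le> real n * (0.05 * C)"
    using lam n0 by (intro mult_left_mono) simp_all
  then show lC: "lam \<le> real n * C / 20" using n0 by simp
  then have "lam / \<sigma>\<^sup>2 \<le> (real n * C / 20) / \<sigma>\<^sup>2" using s2 by (intro divide_right_mono) simp_all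
  also have "\<dots> = (real n * C / \<sigma>\<^sup>2) / 20" by simp
  finally have C20: "20 * (6 * ?l + ?a) \<le> real n * C / \<sigma>\<^sup>2" using l by argo
  \<comment> \<open>ln (p/2) is negative only for p = 1, where s = 1 and the value is -2 ln 2. Since
    a \<ge> 24, the bound -2 gives 6 l + a \<ge> a/2, which turns the factor 20 into 10 a.\<close>
  have "- 2 \<le> ?l"
  proof (cases "p = 1")
    case True
    then have "s = 1" using s by simp
    moreover have "ln (1 / 2 :: real) = - ln 2" by (simp add: ln_div)
    moreover have "ln 2 \<le> (1 :: real)" using ln_le_minus_one[of "2::real"] by simp
    ultimately show ?thesis using True by simp
  next
    case False
    then have "2 \<le> p" using s by simp
    then have "0 \<le> ?l" by (intro mult_nonneg_nonneg) simp_all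
    then show ?thesis by simp
  qed
  then have "10 * ?a \<le> real n * C / \<sigma>\<^sup>2" using C20 a by argo
  moreover have "90 * x + 5 / 2 * y \<le> z" if "10 * y \<le> z" "120 * x \<le> z" for x y z :: real
    using that by linarith
  ultimately show "90 * ?L + 5 / 2 * ?a \<le> real n * C / \<sigma>\<^sup>2" using CL by blast
  show log': "real s * ln (real p) \<le> 0.23 * real n"
    using log n0 by (simp add: pos_divide_less_eq)
  \<comment> \<open>For p \<ge> 3 the logarithm is at least 1, so the bound on s ln p controls
    \<open>s\<close> itself; for p \<le> 2 one has s \<le> 2 and n \<ge> 8.\<close>
  show sn: "real s \<le> real n / 4"
  proof (cases "3 \<le> p")
    case True
    then have "3 \<le> real p" by simp
    then have "exp 1 \<le> real p" using exp_le by linarith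
    then have "ln (exp 1) \<le> ln (real p)" by (intro ln_mono) simp_all
    then have "real s * 1 \<le> real s * ln (real p)" by (intro mult_left_mono) simp_all
    then show ?thesis using log' n0 by simp
  next
    case False
    then have "s \<le> 2" using s by simp
    then show ?thesis using n by simp
  qed
  show "s < n" using sn n by linarith
qed

lemma error_bound_exp:
  fixes n :: nat and t \<sigma> c :: real
  assumes c: "c \<le> 1 / 50" "c \<le> t / (36 * \<sigma>\<^sup>2)" and t: "0 < t"
  defines "a \<equiv> real n * t / \<sigma>\<^sup>2"
  shows "6 * exp (- real n / 50) + 2 * exp (- a / 36) + 2 * (4 ^ 16 * exp (- a / 4))
    \<le> (8 + 2 * 4 ^ 16) * exp (- c * real n)"
proof -
  have "c * real n \<le> 1 / 50 * real n" using c(1) by (intro mult_right_mono) simp_all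
  then have 1: "exp (- real n / 50) \<le> exp (- c * real n)" by simp
  have "c * real n \<le> t / (36 * \<sigma>\<^sup>2) * real n" using c(2) by (intro mult_right_mono) simp_all
  also have "\<dots> = a / 36" by (simp add: a_def mult.commute)
  finally have ca: "c * real n \<le> a / 36" .
  have "0 \<le> a" unfolding a_def using t by simp
  then have "c * real n \<le> a / 4" using ca by linarith
  then have 2: "exp (- a / 4) \<le> exp (- c * real n)" by simp
  have 3: "exp (- a / 36) \<le> exp (- c * real n)" using ca by simp
  have "6 * exp (- real n / 50) + 2 * exp (- a / 36) + 2 * (4 ^ 16 * exp (- a / 4))
    \<le> 6 * exp (- c * real n) + 2 * exp (- c * real n) + 2 * (4 ^ 16 * exp (- c * real n))"
    using 1 2 3 by (intro add_mono mult_left_mono) simp_all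
  also have "\<dots> = (8 + 2 * 4 ^ 16) * exp (- c * real n)" by (simp only: distrib_right mult.assoc)
  finally show ?thesis .
qed

theorem theorem11:
  fixes M :: "nat \<Rightarrow> 'w measure"
    and U :: "nat \<Rightarrow> 'w \<Rightarrow> nat \<Rightarrow> real"
    and Ustar :: "nat \<Rightarrow> nat \<Rightarrow> 'w \<Rightarrow> nat \<Rightarrow> real"
    and p :: "nat \<Rightarrow> nat"
    and X :: "nat \<Rightarrow> real mat"
    and \<tau>\<^sub>0 \<Lambda> :: "nat \<Rightarrow> nat set"
    and \<beta>\<^sub>0 :: "nat \<Rightarrow> real vec"
    and lam :: "nat \<Rightarrow> real"
    and sel :: "nat \<Rightarrow> nat set set \<Rightarrow> nat set"
    and conv :: "nat \<Rightarrow> nat set \<Rightarrow> ereal set"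
    and d :: nat
    and \<sigma>\<^sub>0 \<alpha> t :: real
  assumes "0 < \<alpha>" "\<alpha> < 1" "0 < \<sigma>\<^sub>0" "0 < t" "1 \<le> d"
    and "\<And>n. 1 \<le> n \<Longrightarrow> 1 \<le> p n"
    and "\<And>n. 1 \<le> n \<Longrightarrow> X n \<in> carrier_mat n (p n)"
    and "\<And>n. 1 \<le> n \<Longrightarrow> \<tau>\<^sub>0 n \<subseteq> {..<p n}"
    and "\<And>n. 1 \<le> n \<Longrightarrow> \<tau>\<^sub>0 n \<noteq> {}"
    and "\<And>n. 1 \<le> n \<Longrightarrow> \<beta>\<^sub>0 n \<in> carrier_vec (card (\<tau>\<^sub>0 n))"
    and "\<And>n. 1 \<le> n \<Longrightarrow> \<Lambda> n \<subseteq> {..<p n}"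
    and "\<And>n. 1 \<le> n \<Longrightarrow> 0 < lam n"
    and "\<And>n. 1 \<le> n \<Longrightarrow> identifiable (X n) (\<tau>\<^sub>0 n) (\<beta>\<^sub>0 n)"
    and "\<And>n A. A \<noteq> {} \<Longrightarrow> sel n A \<in> A"
    and "\<And>n \<tau>. conv n \<tau> \<in> sets borel"
    and "\<And>n. 1 \<le> n \<Longrightarrow> prob_space (M n)"
    and "\<And>n. 1 \<le> n \<Longrightarrow> prob_space.indep_vars (M n) (\<lambda>_. \<Pi>\<^sub>M i \<in> {..<n}. borel)
            ((Ustar n)(0 := U n)) {0..d}"
    and "\<And>n. 1 \<le> n \<Longrightarrow> distr (M n) (\<Pi>\<^sub>M i \<in> {..<n}. borel) (U n) = std_gauss n"
    and "\<And>n b. 1 \<le> n \<Longrightarrow> b \<in> {1..d} \<Longrightarrow>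
            distr (M n) (\<Pi>\<^sub>M i \<in> {..<n}. borel) (Ustar n b) = std_gauss n"
    and "\<forall>\<^sub>F n in sequentially.
            lam n / real n \<in>
              {6 * \<sigma>\<^sub>0\<^sup>2 * ((real (card (\<tau>\<^sub>0 n)) + 1) * ln (real (p n) / 2) / real n) + t
                .. 0.05 * C_min (X n) (\<tau>\<^sub>0 n) (\<beta>\<^sub>0 n)}"
    and "\<forall>\<^sub>F n in sequentially. real (card (\<tau>\<^sub>0 n)) * ln (real (p n)) / real n < 0.23"
    and "\<forall>\<^sub>F n in sequentially.
            C_min (X n) (\<tau>\<^sub>0 n) (\<beta>\<^sub>0 n)
              > 120 * ((real (card (\<tau>\<^sub>0 n)) + 2) * ln (real (p n) + 1) / real n) * \<sigma>\<^sub>0\<^sup>2"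
  defines "E \<equiv> \<lambda>n. coverage_event (M n) (sel n) (conv n) (X n) (\<tau>\<^sub>0 n) (\<beta>\<^sub>0 n) \<sigma>\<^sub>0 (lam n) \<alpha> (\<Lambda> n) d
                    (U n) (Ustar n)"
    and "G \<equiv> \<lambda>n. generated_by (M n) n d (Ustar n)"
  shows "\<exists>c\<^sub>2>0.
           (\<exists>\<rho> \<in> o(\<lambda>n. exp (- c\<^sub>2 * real n)).
              \<forall>\<^sub>F n in sequentially. measure (M n) (E n) \<ge> \<alpha> - \<rho> n) \<and>
           (\<exists>R. (\<forall>n. R n \<in> borel_measurable (G n)) \<and>
              little_o_p M R (\<lambda>n. exp (- c\<^sub>2 * real n)) \<and>
              (\<forall>\<^sub>F n in sequentially. AE \<omega> in M n.
                 cond_probability (M n) (G n) (E n) \<omega> \<ge> \<alpha> - R n \<omega>))"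
proof -
  \<comment> \<open>1/50 is the rate of the alignment events. The other entry is the slowest
    deviation rate, exp (-a/36) with a = n t / \<open>\<sigma>\<^sub>0\<^sup>2\<close>.\<close>
  define c where "c = min (1 / 50) (t / (36 * \<sigma>\<^sub>0\<^sup>2))"
  define k where "k = t / \<sigma>\<^sub>0\<^sup>2"
  define B where "B = (\<lambda>n. {\<omega> \<in> space (M n). tau_hat (sel n) (X n) (lam n)
    (response (X n) (\<tau>\<^sub>0 n) (\<beta>\<^sub>0 n) \<sigma>\<^sub>0 (vec n (U n \<omega>))) (vec n (Ustar n 1 \<omega>)) \<noteq> \<tau>\<^sub>0 n})"
  \<comment> \<open>The conditional selection error. As a conditional expectation it is measurable
    for \<open>G n\<close> at every index, including n = 0 where no model is assumed.\<close>
  define R where "R = (\<lambda>n. real_cond_exp (M n) (G n) (indicator (B n)))"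
  let ?K = "8 + 2 * 4 ^ 16 :: real"
  have c: "0 < c" and k: "0 < k" using assms(3,4) by (simp_all add: c_def k_def)
  have c_le: "c \<le> 1 / 50" "c \<le> t / (36 * \<sigma>\<^sub>0\<^sup>2)" by (simp_all add: c_def)
  have loc: "coverage_experiment (X n) n (p n) (\<tau>\<^sub>0 n) (\<beta>\<^sub>0 n) \<sigma>\<^sub>0 (lam n) (sel n) (\<Lambda> n) (conv n) \<alpha> (M n) (U n) (Ustar n) d"
    if n: "1 \<le> n" for n
  proof (intro coverage_experiment.intro coverage_problem.intro)
    show "repro_problem (X n) n (p n) (\<tau>\<^sub>0 n) (\<beta>\<^sub>0 n) \<sigma>\<^sub>0 (lam n) (sel n)"
      using assms(3,7-10,12,14) n by (intro repro_problem.intro) simp_all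
    show "coverage_problem_axioms (X n) (p n) (\<tau>\<^sub>0 n) (\<beta>\<^sub>0 n) (\<Lambda> n) (conv n) \<alpha>"
      using assms(1,2,11,13,15) n by (intro coverage_problem_axioms.intro) simp_all
    show "coverage_experiment_axioms n (M n) (U n) (Ustar n) d"
      using assms(5,16-19) n by (intro coverage_experiment_axioms.intro) simp_all
  qed
  have B: "coverage_experiment.miss (X n) n (\<tau>\<^sub>0 n) (\<beta>\<^sub>0 n) \<sigma>\<^sub>0 (lam n) (sel n) (M n) (U n) (Ustar n) = B n"
    if "1 \<le> n" for n
    unfolding coverage_experiment.miss_def[OF loc[OF that]] B_def ..
  have large: "\<forall>\<^sub>F n in sequentially. 24 \<le> k * real n \<and> 4 ^ 16 * exp (- (k * real n) / 4) \<le> (1 / 2 :: real)"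
    using k by (intro eventually_conj) real_asymp+
  have good: "\<forall>\<^sub>F n in sequentially. 1 \<le> n \<and> card (\<tau>\<^sub>0 n) < n \<and> measure (M n) (B n) \<le> ?K * exp (- c * real n)"
    using assms(20-22) large eventually_ge_at_top[of 8]
  proof eventually_elim
    case (elim n)
    then have n: "1 \<le> n" by simp
    interpret coverage_experiment "X n" n "p n" "\<tau>\<^sub>0 n" "\<beta>\<^sub>0 n" \<sigma>\<^sub>0 "lam n" "sel n" "\<Lambda> n" "conv n" \<alpha> "M n" "U n" "Ustar n" d
      by (rule loc[OF n])
    have kn: "k * real n = real n * t / \<sigma>\<^sub>0\<^sup>2" by (simp add: k_def)
    have "24 \<le> real n * t / \<sigma>\<^sub>0\<^sup>2" using elim(4) unfolding kn by blast
    note num = numeric_conditions[OF s_pos s_le_p assms(3,4) elim(5) this elim(1-3)]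
    have "0 \<le> real n * t / \<sigma>\<^sub>0\<^sup>2" using assms(4) by simp
    moreover have "4 ^ 16 * exp (- (real n * t / \<sigma>\<^sub>0\<^sup>2) / 4) \<le> (1 / 2 :: real)" using elim(4) unfolding kn by blast
    ultimately have "measure (M n) (B n) \<le> 6 * exp (- real n / 50) + 2 * exp (- (real n * t / \<sigma>\<^sub>0\<^sup>2) / 36)
        + 2 * (4 ^ 16 * exp (- (real n * t / \<sigma>\<^sub>0\<^sup>2) / 4))"
      unfolding B[OF n, symmetric] by (intro prob_miss num)
    also have "\<dots> \<le> ?K * exp (- c * real n)" by (rule error_bound_exp[OF c_le assms(4)])
    finally show ?case using n num(6) by blast
  qed
  show ?thesis
  \<comment> \<open>Half of the available rate is given away: the bound of order exp (-c n) is then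
    negligible against exp (-c n / 2), also after Markov's inequality divides by it.\<close>
  proof (intro exI[of _ "c / 2"] conjI)
    show "0 < c / 2" using c by simp
    have "(\<lambda>n. ?K * exp (- c * real n)) \<in> o(\<lambda>n. exp (- (c / 2) * real n))"
      using c by real_asymp
    moreover have "\<forall>\<^sub>F n in sequentially. \<alpha> - ?K * exp (- c * real n) \<le> measure (M n) (E n)"
      using good
    proof eventually_elim
      case (elim n)
      then have n: "1 \<le> n" and s: "card (\<tau>\<^sub>0 n) < n" and m: "measure (M n) (B n) \<le> ?K * exp (- c * real n)" by blast+
      show ?case
        using coverage_experiment.prob_E[OF loc[OF n] s] m unfolding B[OF n] E_def by linarith
    qed
    ultimately show "\<exists>\<rho>\<in>o(\<lambda>n. exp (- (c / 2) * real n)). \<forall>\<^sub>F n in sequentially. \<alpha> - \<rho> n \<le> measure (M n) (E n)"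
      by (intro bexI[of _ "\<lambda>n. ?K * exp (- c * real n)"])
    show "\<exists>R. (\<forall>n. R n \<in> borel_measurable (G n)) \<and> little_o_p M R (\<lambda>n. exp (- (c / 2) * real n)) \<and>
      (\<forall>\<^sub>F n in sequentially. AE \<omega> in M n. \<alpha> - R n \<omega> \<le> cond_probability (M n) (G n) (E n) \<omega>)"
    proof (intro exI[of _ R] conjI allI)
      show "R n \<in> borel_measurable (G n)" for n by (simp add: R_def)
      show "\<forall>\<^sub>F n in sequentially. AE \<omega> in M n. \<alpha> - R n \<omega> \<le> cond_probability (M n) (G n) (E n) \<omega>"
        using good
      proof eventually_elim
        case (elim n)
        then have n: "1 \<le> n" and s: "card (\<tau>\<^sub>0 n) < n" by blast+
        show ?case
          using coverage_experiment.cond_prob_E[OF loc[OF n] s] unfolding B[OF n] R_def E_def G_def .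
      qed
      show "little_o_p M R (\<lambda>n. exp (- (c / 2) * real n))"
        unfolding little_o_p_def
      proof (intro allI impI)
        fix \<epsilon> :: real assume \<epsilon>: "0 < \<epsilon>"
        let ?a = "\<lambda>n. exp (- (c / 2) * real n)"
        let ?P = "\<lambda>n. measure (M n) {\<omega> \<in> space (M n). \<epsilon> < \<bar>R n \<omega> / ?a n\<bar>}"
        have lim: "(\<lambda>n. ?K * exp (- c * real n) / (\<epsilon> * ?a n)) \<longlonglongrightarrow> 0"
          using c \<epsilon> by real_asymp
        have "\<forall>\<^sub>F n in sequentially. ?P n \<le> ?K * exp (- c * real n) / (\<epsilon> * ?a n)"
          using good
        proof eventually_elim
          case (elim n)
          then have n: "1 \<le> n" and m: "measure (M n) (B n) \<le> ?K * exp (- c * real n)" by blast+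
          interpret prob_space "M n" by (rule assms(16)[OF n])
          have pos: "0 < \<epsilon> * ?a n" using \<epsilon> by simp
          have "?P n \<le> measure (M n) {\<omega> \<in> space (M n). \<epsilon> * ?a n \<le> \<bar>R n \<omega>\<bar>}"
          proof (rule finite_measure_mono)
            show "{\<omega> \<in> space (M n). \<epsilon> < \<bar>R n \<omega> / ?a n\<bar>} \<subseteq> {\<omega> \<in> space (M n). \<epsilon> * ?a n \<le> \<bar>R n \<omega>\<bar>}"
              by (auto simp: pos_less_divide_eq)
            have [measurable]: "R n \<in> borel_measurable (M n)" by (simp add: R_def)
            show "{\<omega> \<in> space (M n). \<epsilon> * ?a n \<le> \<bar>R n \<omega>\<bar>} \<in> events" by measurable
          qed
          also have "\<dots> \<le> measure (M n) (B n) / (\<epsilon> * ?a n)"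
            using coverage_experiment.markov_cond_miss[OF loc[OF n] pos] unfolding B[OF n] R_def G_def .
          also have "\<dots> \<le> ?K * exp (- c * real n) / (\<epsilon> * ?a n)"
            using m pos by (intro divide_right_mono) simp_all
          finally show ?case .
        qed
        then show "?P \<longlonglongrightarrow> 0"
          by (intro tendsto_sandwich[OF _ _ tendsto_const lim]) simp_all
      qed
    qed
  qed
qed

end
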